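(* Let $(A,\alpha)$ be a finite-dimensional Hom-Hopf algebra with $\alpha$ bijective. (1) The Heisenberg double $H(A^{op})$ of $A^{op}$ is the left twist ${}_\sigma D(A)$ of the Drinfel'd double $D(A)$ by the left Hom-2-cocycle $$\sigma(h\otimes f,k\otimes g)=\varepsilon(h)\,g(1)\,\langle f,\alpha(k)\rangle,\qquad h,k\in A,\ f,g\in A^*;$$ i.e. on the common underlying space $A\otimes A^*$ the two multiplications coincide. (2) The Heisenberg double $H(A^* )$ of $A^*$ is the right twist $\widetilde{D(A)}_\eta$ of $\widetilde{D(A)}$ by the right Hom-2-cocycle $$\eta(f\otimes a,g\otimes b)=\varepsilon(b)\,f(1)\,\langle g,\alpha(a)\rangle,\qquad a,b\in A,\ f,g\in A^*;$$ i.e. on the common underlying space $A^*\otimes A$ the two multiplications coincide.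
   Context: Everything is over a fixed field $k$; Sweedler notation $\Delta(c)=c_1\otimes c_2$, $\Delta(c_2)=c_{21}\otimes c_{22}$ etc. (summation omitted). A (unital) Hom-associative algebra is $(A,\mu,\alpha)$ with $\mu(a\otimes b)=ab$, $1_A\in A$, such that $\alpha(ab)=\alpha(a)\alpha(b)$, $\alpha(1_A)=1_A$, $1_Aa=\alpha(a)=a1_A$, $\alpha(a)(bc)=(ab)\alpha(c)$. A (counital) Hom-coassociative coalgebra is $(C,\Delta,\varepsilon,\alpha)$ with $\varepsilon\alpha=\varepsilon$, $(\alpha\otimes\alpha)\Delta=\Delta\alpha$, $(\varepsilon\otimes id)\Delta=\alpha=(id\otimes\varepsilon)\Delta$, $(\Delta\otimes\alpha)\Delta=(\alpha\otimes\Delta)\Delta$. A Hom-bialgebra is both, with the same $\alpha$, such that $\Delta,\varepsilon$ are unital and multiplicative. A Hom-Hopf algebra is a Hom-bialgebra with $S$ such that $S\alpha=\alpha S$, $S(h_1)h_2=h_1S(h_2)=\varepsilon(h)1$. Dual: $A^*$ has structure map $(\alpha^{-1})^*$ ($f\mapsto f\circ\alpha^{-1}$), product $(f\bullet g)(h)=f(\alpha^{-2}(h_1))g(\alpha^{-2}(h_2))$ (written $fg$), unit $\varepsilon$, coproduct determined by $f_1(h)f_2(k)=f(\alpha^{-2}(hk))$, counit $f\mapsto f(1)$. $A^{op}$ has the opposite product and the same $\Delta$, so $(A^{op})^*$ has the same product as $A^*$ and the opposite coproduct. Write $\alpha^*(f)=f\circ\alpha$, $\langle f\leftharpoonup h,k\rangle=\langle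 f,h\alpha^{-2}(k)\rangle$, $\langle h\rightharpoonup f,k\rangle=\langle f,\alpha^{-2}(k)h\rangle$. $D(A)=A^{op}\bowtie A^*$ is $A\otimes A^*$ with structure map $\alpha\otimes(\alpha^{-1})^*$, unit $1\otimes\varepsilon$, counit $\varepsilon(h)f(1)$, $\Delta(h\otimes f)=h_1\otimes f_1\otimes h_2\otimes f_2$ and $$(h\otimes f)(k\otimes g)=\alpha^{-2}(k_{21})h\otimes[\alpha^{-3}(k_{22})\rightharpoonup((\alpha^* )^2(f)\leftharpoonup S\alpha^{-3}(k_1))]g.$$ $\widetilde{D(A)}$ is $(A^{op})^*\otimes A$ with structure map $(\alpha^{-1})^*\otimes\alpha$, unit $\varepsilon\otimes1$, counit $f(1)\varepsilon(a)$, the tensor comultiplication of $(A^{op})^*\otimes A$ (so, in terms of $\Delta(f)=f_1\otimes f_2$ in $A^*$, $\Delta(f\otimes a)=f_2\otimes a_1\otimes f_1\otimes a_2$) and $$(f\otimes a)(g\otimes b)=f[(\alpha^{-3}(a_1)\rightharpoonup(\alpha^* )^2(g))\leftharpoonup S^{-1}\alpha^{-3}(a_{22})]\otimes\alpha^{-2}(a_{21})b.$$ For a Hom-Hopf algebra $(H,\alpha_H)$, a bilinear map $\sigma:H\otimes H\to k$ with $\sigma(\alpha_H\otimes\alpha_H)=\sigma$ is a left Hom-2-cocycle if $\sigma(l_1,k_1)\sigma(\alpha_H^2(h),l_2k_2)=\sigma(h_1,l_1)\sigma(h_2l_2,\alpha_H^2(k))$, and a right Hom-2-cocycle if $\sigma(\alpha_H^2(h),l_1k_1)\sigma(l_2,k_2)=\sigma(h_1l_1,\alpha_H^2(k))\sigma(h_2,l_2)$,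 for all $h,l,k\in H$. The left twist ${}_\sigma H$ is the space $H$ with product $h\cdot_\sigma k=\sigma(h_1,k_1)\alpha_H^{-1}(h_2k_2)$; the right twist $H_\sigma$ has product $\alpha_H^{-1}(h_1k_1)\sigma(h_2,k_2)$. The Heisenberg double $H(A)$ is the smash product $A\#A^*$ with respect to the left regular action of $A^*$ on $A$, $f\rightharpoonup b=f(b_2)b_1$: $$(a\#f)(b\#g)=a\,(f_1\circ\alpha^2\rightharpoonup\alpha^{-1}(b))\#(f_2\circ\alpha)g.$$ $H(A^{op})$ is this construction applied to $A^{op}$, using the product of $A^{op}$ and the coproduct of $(A^{op})^*$. $H(A^* )$ is the smash product $A^*\#A$ (with $A^{**}$ identified with $A$) for the action $a\rightharpoonup g$ of $A$ on $A^*$ given above, i.e. $(f\#a)(g\#b)=f\,(\alpha^{-2}(a_1)\rightharpoonup\alpha^*(g))\#\alpha^{-1}(a_2)b$. *)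

theory Defs
  imports Complex_Main "HOL-Library.Function_Algebras"
begin

section \<open>Vector spaces, duals and tensor products\<close>

text \<open>
  A vector space over the field \<open>'k\<close> is a subspace \<open>vcar V\<close> of a type that is a vector space
  with respect to \<open>vscale V\<close>. Carriers are needed because dual spaces and tensor products
  depend on the scalar multiplication and hence cannot be types of their own.
\<close>

record ('k, 'v) vspace =
  vcar :: "'v set"
  vscale :: "'k \<Rightarrow> 'v \<Rightarrow> 'v"

definition is_vspace :: "('k::field, 'v::ab_group_add, 'z) vspace_scheme \<Rightarrow> bool" where
  "is_vspace V \<longleftrightarrow> vector_space (vscale V) \<and> module.subspace (vscale V) (vcar V)"

definition fin_dim :: "('k::field, 'v::ab_group_add, 'z) vspace_scheme \<Rightarrow> bool" where
  "fin_dim V \<longleftrightarrow> (\<exists>B. finite B \<and> module.span (vscale V) B = vcar V)"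

definition scalars :: "('k::field, 'k) vspace" where
  "scalars = \<lparr>vcar = UNIV, vscale = (*)\<rparr>"

definition linear_on ::
  "('k::field, 'v::ab_group_add, 'z) vspace_scheme \<Rightarrow> ('k, 'w::ab_group_add, 'y) vspace_scheme
    \<Rightarrow> ('v \<Rightarrow> 'w) \<Rightarrow> bool" where
  "linear_on V W f \<longleftrightarrow>
     (\<forall>x\<in>vcar V. f x \<in> vcar W) \<and>
     (\<forall>x\<in>vcar V. \<forall>y\<in>vcar V. f (x + y) = f x + f y) \<and>
     (\<forall>c. \<forall>x\<in>vcar V. f (vscale V c x) = vscale W c (f x))"

definition bilinear_on ::
  "('k::field, 'v::ab_group_add, 'z) vspace_scheme \<Rightarrow> ('k, 'w::ab_group_add, 'y) vspace_scheme
    \<Rightarrow> ('k, 'u::ab_group_add, 'x) vspace_scheme \<Rightarrow> ('v \<Rightarrow> 'w \<Rightarrow> 'u) \<Rightarrow> bool" where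
  "bilinear_on V W U \<beta> \<longleftrightarrow>
     (\<forall>v\<in>vcar V. linear_on W U (\<lambda>w. \<beta> v w)) \<and> (\<forall>w\<in>vcar W. linear_on V U (\<lambda>v. \<beta> v w))"

text \<open>
  Linear forms are normalised to vanish outside the carrier, so that equality of linear forms
  on \<open>V\<close> is equality of functions.
\<close>

definition form_on :: "('k::field, 'v, 'z) vspace_scheme \<Rightarrow> ('v \<Rightarrow> 'k) \<Rightarrow> 'v \<Rightarrow> 'k" where
  "form_on V f = (\<lambda>x. if x \<in> vcar V then f x else 0)"

definition dual_space ::
  "('k::field, 'v::ab_group_add, 'z) vspace_scheme \<Rightarrow> ('k, 'v \<Rightarrow> 'k) vspace" where
  "dual_space V =
     \<lparr>vcar = {f. linear_on V scalars f \<and> (\<forall>x. x \<notin> vcar V \<longrightarrow> f x = 0)},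
      vscale = (\<lambda>c f x. c * f x)\<rparr>"

text \<open>
  \<open>V \<otimes> W\<close> is realised inside the dual of the space of bilinear forms on \<open>V \<times> W\<close>: the pure
  tensor \<open>v \<otimes> w\<close> is evaluation at \<open>(v, w)\<close>, and \<open>V \<otimes> W\<close> is the span of the pure tensors.
  Over a field this is the usual tensor product (in any dimension).
\<close>

type_synonym ('v, 'w, 'k) tensor = "('v \<Rightarrow> 'w \<Rightarrow> 'k) \<Rightarrow> 'k"

definition ptensor ::
  "('k::field, 'v::ab_group_add, 'z) vspace_scheme \<Rightarrow> ('k, 'w::ab_group_add, 'y) vspace_scheme
    \<Rightarrow> 'v \<Rightarrow> 'w \<Rightarrow> ('v, 'w, 'k) tensor" where
  "ptensor V W v w = (\<lambda>\<beta>. if bilinear_on V W scalars \<beta> then \<beta> v w else 0)"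

definition vtensor ::
  "('k::field, 'v::ab_group_add, 'z) vspace_scheme \<Rightarrow> ('k, 'w::ab_group_add, 'y) vspace_scheme
    \<Rightarrow> ('k, ('v, 'w, 'k) tensor) vspace" where
  "vtensor V W =
     \<lparr>vcar = module.span (\<lambda>c t \<beta>. c * t \<beta>) {ptensor V W v w | v w. v \<in> vcar V \<and> w \<in> vcar W},
      vscale = (\<lambda>c t \<beta>. c * t \<beta>)\<rparr>"

text \<open>
  The linear map on \<open>V \<otimes> W\<close> induced by a bilinear map \<open>\<beta>\<close>: write \<open>t = \<Sum>\<^sub>i v\<^sub>i \<otimes> w\<^sub>i\<close> and take
  \<open>\<Sum>\<^sub>i \<beta> v\<^sub>i w\<^sub>i\<close>. Independence of the chosen expression is \<open>tensor_lift_sum\<close> below.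
\<close>

definition tensor_lift ::
  "('k::field, 'v::ab_group_add, 'z) vspace_scheme \<Rightarrow> ('k, 'w::ab_group_add, 'y) vspace_scheme
    \<Rightarrow> ('v \<Rightarrow> 'w \<Rightarrow> 'u::ab_group_add) \<Rightarrow> ('v, 'w, 'k) tensor \<Rightarrow> 'u" where
  "tensor_lift V W \<beta> t =
     (THE u. \<exists>ps. set ps \<subseteq> vcar V \<times> vcar W \<and>
                  t = (\<Sum>(v, w)\<leftarrow>ps. ptensor V W v w) \<and> u = (\<Sum>(v, w)\<leftarrow>ps. \<beta> v w))"

lemma sum_list_ptensor_apply:
  assumes "bilinear_on V W scalars \<gamma>"
  shows "(\<Sum>(v, w)\<leftarrow>ps. ptensor V W v w) \<gamma> = (\<Sum>(v, w)\<leftarrow>ps. \<gamma> v w)"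
  using assms by (induction ps) (auto simp: ptensor_def)

lemma tensor_lift_sum:
  assumes U: "is_vspace U" and \<beta>: "bilinear_on V W U \<beta>"
    and ps: "set ps \<subseteq> vcar V \<times> vcar W"
  shows "tensor_lift V W \<beta> (\<Sum>(v, w)\<leftarrow>ps. ptensor V W v w) = (\<Sum>(v, w)\<leftarrow>ps. \<beta> v w)"
proof -
  have vs: "vector_space (vscale U)"
    using U by (simp add: is_vspace_def)
  interpret vector_space "vscale U" by (fact vs)
  have "vector_space ((*) :: 'a \<Rightarrow> 'a \<Rightarrow> 'a)"
    by unfold_locales (simp_all add: algebra_simps)
  then interpret pair: vector_space_pair "vscale U" "(*)"
    by (intro vector_space_pair.intro vs)
  have unique: "(\<Sum>(v, w)\<leftarrow>qs. \<beta> v w) = (\<Sum>(v, w)\<leftarrow>ps. \<beta> v w)"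
    if qs: "set qs \<subseteq> vcar V \<times> vcar W"
      and eq: "(\<Sum>(v, w)\<leftarrow>ps. ptensor V W v w) = (\<Sum>(v, w)\<leftarrow>qs. ptensor V W v w)" for qs
  proof (rule ccontr)
    let ?z = "(\<Sum>(v, w)\<leftarrow>qs. \<beta> v w) - (\<Sum>(v, w)\<leftarrow>ps. \<beta> v w)"
    assume "\<not> ?thesis"
    then have "independent {?z}"
      by (simp add: dependent_single)
    then obtain \<phi> where \<phi>: "Vector_Spaces.linear (vscale U) (*) \<phi>" "\<phi> ?z = 1"
      using pair.linear_independent_extend[of "{?z}" "\<lambda>_. 1"] by auto
    interpret \<phi>: Vector_Spaces.linear "vscale U" "(*)" \<phi> by (fact \<phi>(1))
    have bil: "bilinear_on V W scalars (\<lambda>v w. \<phi> (\<beta> v w))"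
      using \<beta> by (auto simp: bilinear_on_def linear_on_def scalars_def \<phi>.add \<phi>.scale)
    have sum: "\<phi> (\<Sum>(v, w)\<leftarrow>rs. \<beta> v w) = (\<Sum>(v, w)\<leftarrow>rs. \<phi> (\<beta> v w))" for rs
      by (induction rs) (auto simp: \<phi>.add \<phi>.zero)
    have "(\<Sum>(v, w)\<leftarrow>ps. \<phi> (\<beta> v w)) = (\<Sum>(v, w)\<leftarrow>qs. \<phi> (\<beta> v w))"
      using sum_list_ptensor_apply[OF bil, of ps] sum_list_ptensor_apply[OF bil, of qs] eq
      by simp
    then have "\<phi> ?z = 0"
      by (simp add: \<phi>.diff sum)
    with \<phi>(2) show False by simp
  qed
  show ?thesis
    unfolding tensor_lift_def
  proof (rule the_equality)
    show "\<exists>qs. set qs \<subseteq> vcar V \<times> vcar W \<and>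
            (\<Sum>(v, w)\<leftarrow>ps. ptensor V W v w) = (\<Sum>(v, w)\<leftarrow>qs. ptensor V W v w) \<and>
            (\<Sum>(v, w)\<leftarrow>ps. \<beta> v w) = (\<Sum>(v, w)\<leftarrow>qs. \<beta> v w)"
      using ps by blast
  qed (blast dest: unique)
qed

lemma tensor_lift_ptensor:
  assumes "is_vspace U" "bilinear_on V W U \<beta>" "v \<in> vcar V" "w \<in> vcar W"
  shows "tensor_lift V W \<beta> (ptensor V W v w) = \<beta> v w"
  using tensor_lift_sum[OF assms(1,2), of "[(v, w)]"] assms(3,4) by simp


section \<open>Hom-Hopf algebras\<close>

record ('k, 'v) alg = "('k, 'v) vspace" +
  hmul :: "'v \<Rightarrow> 'v \<Rightarrow> 'v"  (infixl "\<cdot>\<index>" 70)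

record ('k, 'v) hom_bialg = "('k, 'v) alg" +
  hone :: "'v"
  hcomul :: "'v \<Rightarrow> ('v, 'v, 'k) tensor"
  hcounit :: "'v \<Rightarrow> 'k"
  hmap :: "'v \<Rightarrow> 'v"

record ('k, 'v) hom_hopf = "('k, 'v) hom_bialg" +
  hantipode :: "'v \<Rightarrow> 'v"

text \<open>
  Sweedler notation: \<open>sweedler C c (\<lambda>c\<^sub>1 c\<^sub>2. E)\<close> is the expression \<open>E\<close> with the
  summation over \<open>\<Delta>(c) = c\<^sub>1 \<otimes> c\<^sub>2\<close> made explicit.
\<close>

definition sweedler ::
  "('k::field, 'v::ab_group_add, 'z) hom_bialg_scheme \<Rightarrow> 'v \<Rightarrow> ('v \<Rightarrow> 'v \<Rightarrow> 'u::ab_group_add) \<Rightarrow> 'u"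
  where "sweedler C c E = tensor_lift C C E (hcomul C c)"

locale hom_algebra =
  fixes A :: "('k::field, 'v::ab_group_add, 'z) hom_bialg_scheme" (structure)
  assumes vspace: "is_vspace A"
    and mul_bilinear: "bilinear_on A A A (hmul A)"
    and one_closed: "hone A \<in> vcar A"
    and map_linear: "linear_on A A (hmap A)"
    and map_mul: "\<lbrakk>a \<in> vcar A; b \<in> vcar A\<rbrakk> \<Longrightarrow> hmap A (a \<cdot> b) = hmap A a \<cdot> hmap A b"
    and map_one: "hmap A (hone A) = hone A"
    and one_left: "a \<in> vcar A \<Longrightarrow> hone A \<cdot> a = hmap A a"
    and one_right: "a \<in> vcar A \<Longrightarrow> a \<cdot> hone A = hmap A a"
    and hom_assoc: "\<lbrakk>a \<in> vcar A; b \<in> vcar A; c \<in> vcar A\<rbrakk>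
                      \<Longrightarrow> hmap A a \<cdot> (b \<cdot> c) = (a \<cdot> b) \<cdot> hmap A c"

text \<open>
  In \<open>hom_coassoc\<close> both sides are read in \<open>C \<otimes> (C \<otimes> C)\<close>:
  \<open>c\<^sub>1\<^sub>1 \<otimes> (c\<^sub>1\<^sub>2 \<otimes> \<alpha>(c\<^sub>2)) = \<alpha>(c\<^sub>1) \<otimes> (c\<^sub>2\<^sub>1 \<otimes> c\<^sub>2\<^sub>2)\<close>.
\<close>

locale hom_coalgebra =
  fixes C :: "('k::field, 'v::ab_group_add, 'z) hom_bialg_scheme" (structure)
  assumes vspace: "is_vspace C"
    and comul_linear: "linear_on C (vtensor C C) (hcomul C)"
    and counit_linear: "linear_on C scalars (hcounit C)"
    and map_linear: "linear_on C C (hmap C)"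
    and counit_map: "c \<in> vcar C \<Longrightarrow> hcounit C (hmap C c) = hcounit C c"
    and comul_map: "c \<in> vcar C \<Longrightarrow>
          sweedler C c (\<lambda>c1 c2. ptensor C C (hmap C c1) (hmap C c2)) = hcomul C (hmap C c)"
    and counit_left: "c \<in> vcar C \<Longrightarrow>
          sweedler C c (\<lambda>c1 c2. vscale C (hcounit C c1) c2) = hmap C c"
    and counit_right: "c \<in> vcar C \<Longrightarrow>
          sweedler C c (\<lambda>c1 c2. vscale C (hcounit C c2) c1) = hmap C c"
    and hom_coassoc: "c \<in> vcar C \<Longrightarrow>
          sweedler C c (\<lambda>c1 c2. sweedler C c1 (\<lambda>c11 c12.
            ptensor C (vtensor C C) c11 (ptensor C C c12 (hmap C c2)))) =
          sweedler C c (\<lambda>c1 c2. sweedler C c2 (\<lambda>c21 c22.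
            ptensor C (vtensor C C) (hmap C c1) (ptensor C C c21 c22)))"

locale hom_bialgebra =
  alg: hom_algebra A + coalg: hom_coalgebra A
  for A :: "('k::field, 'v::ab_group_add, 'z) hom_bialg_scheme" (structure) +
  assumes comul_one: "hcomul A (hone A) = ptensor A A (hone A) (hone A)"
    and comul_mul: "\<lbrakk>a \<in> vcar A; b \<in> vcar A\<rbrakk> \<Longrightarrow>
          hcomul A (a \<cdot> b) =
          sweedler A a (\<lambda>a1 a2. sweedler A b (\<lambda>b1 b2. ptensor A A (a1 \<cdot> b1) (a2 \<cdot> b2)))"
    and counit_one: "hcounit A (hone A) = 1"
    and counit_mul: "\<lbrakk>a \<in> vcar A; b \<in> vcar A\<rbrakk> \<Longrightarrow>
          hcounit A (a \<cdot> b) = hcounit A a * hcounit A b"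

locale hom_hopf_algebra =
  hom_bialgebra A
  for A :: "('k::field, 'v::ab_group_add, 'z) hom_hopf_scheme" (structure) +
  assumes antipode_linear: "linear_on A A (hantipode A)"
    and antipode_map: "a \<in> vcar A \<Longrightarrow> hantipode A (hmap A a) = hmap A (hantipode A a)"
    and antipode_left: "a \<in> vcar A \<Longrightarrow>
          sweedler A a (\<lambda>a1 a2. hantipode A a1 \<cdot> a2) = vscale A (hcounit A a) (hone A)"
    and antipode_right: "a \<in> vcar A \<Longrightarrow>
          sweedler A a (\<lambda>a1 a2. a1 \<cdot> hantipode A a2) = vscale A (hcounit A a) (hone A)"

text \<open>\<open>hinv A n\<close> is \<open>\<alpha>\<^sup>-\<^sup>n\<close>.\<close>

definition hinv :: "('k, 'v, 'z) hom_bialg_scheme \<Rightarrow> nat \<Rightarrow> 'v \<Rightarrow> 'v" where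
  "hinv A n = (inv_into (vcar A) (hmap A)) ^^ n"

definition antipode_inv :: "('k, 'v, 'z) hom_hopf_scheme \<Rightarrow> 'v \<Rightarrow> 'v" where
  "antipode_inv A = inv_into (vcar A) (hantipode A)"

text \<open>
  The record of \<open>A\<^sup>o\<^sup>p\<close> does not carry an antipode, since that of \<open>A\<close> is in general not an
  antipode for \<open>A\<^sup>o\<^sup>p\<close>.
\<close>

definition hom_op ::
  "('k, 'v, 'z) hom_bialg_scheme \<Rightarrow> ('k, 'v) hom_bialg" where
  "hom_op A =
     \<lparr>vcar = vcar A, vscale = vscale A, hmul = (\<lambda>a b. hmul A b a), hone = hone A,
      hcomul = hcomul A, hcounit = hcounit A, hmap = hmap A\<rparr>"

text \<open>
  The comultiplication of the dual is the element \<open>f\<^sub>1 \<otimes> f\<^sub>2\<close> of \<open>A\<^sup>* \<otimes> A\<^sup>*\<close> determined by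
  \<open>f\<^sub>1(h) f\<^sub>2(k) = f(\<alpha>\<^sup>-\<^sup>2(hk))\<close>; it exists for finite-dimensional \<open>A\<close>.
\<close>

definition hom_dual ::
  "('k::field, 'v::ab_group_add, 'z) hom_bialg_scheme \<Rightarrow> ('k, 'v \<Rightarrow> 'k) hom_bialg" where
  "hom_dual A =
     \<lparr>vcar = vcar (dual_space A),
      vscale = vscale (dual_space A),
      hmul = (\<lambda>f g. form_on A (\<lambda>h. sweedler A h (\<lambda>h1 h2. f (hinv A 2 h1) * g (hinv A 2 h2)))),
      hone = form_on A (hcounit A),
      hcomul = (\<lambda>f. THE t. t \<in> vcar (vtensor (dual_space A) (dual_space A)) \<and>
        (\<forall>h\<in>vcar A. \<forall>k\<in>vcar A.
          tensor_lift (dual_space A) (dual_space A) (\<lambda>f1 f2. f1 h * f2 k) t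
            = f (hinv A 2 (h \<cdot>\<^bsub>A\<^esub> k)))),
      hcounit = (\<lambda>f. f (hone A)),
      hmap = (\<lambda>f. form_on A (\<lambda>h. f (hinv A 1 h)))\<rparr>"

text \<open>\<open>dual_pow A n f\<close> is \<open>(\<alpha>\<^sup>*)\<^sup>n(f) = f \<circ> \<alpha>\<^sup>n\<close>.\<close>

definition dual_pow ::
  "('k::field, 'v, 'z) hom_bialg_scheme \<Rightarrow> nat \<Rightarrow> ('v \<Rightarrow> 'k) \<Rightarrow> 'v \<Rightarrow> 'k" where
  "dual_pow A n f = form_on A (\<lambda>h. f ((hmap A ^^ n) h))"

text \<open>\<open>f \<leftharpoonup> h\<close> and \<open>h \<rightharpoonup> f\<close> on the dual.\<close>

definition dual_ract ::
  "('k::field, 'v, 'z) hom_bialg_scheme \<Rightarrow> ('v \<Rightarrow> 'k) \<Rightarrow> 'v \<Rightarrow> 'v \<Rightarrow> 'k" where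
  "dual_ract A f h = form_on A (\<lambda>k. f (h \<cdot>\<^bsub>A\<^esub> hinv A 2 k))"

definition dual_lact ::
  "('k::field, 'v, 'z) hom_bialg_scheme \<Rightarrow> 'v \<Rightarrow> ('v \<Rightarrow> 'k) \<Rightarrow> 'v \<Rightarrow> 'k" where
  "dual_lact A h f = form_on A (\<lambda>k. f (hinv A 2 k \<cdot>\<^bsub>A\<^esub> h))"


section \<open>The two Drinfel'd doubles\<close>

definition drinfeld_double ::
  "('k::field, 'v::ab_group_add, 'z) hom_hopf_scheme
    \<Rightarrow> ('k, ('v, 'v \<Rightarrow> 'k, 'k) tensor) hom_bialg" where
  "drinfeld_double A =
    (let A' = hom_dual A; D = vtensor A A'; S = hantipode A in
     \<lparr>vcar = vcar D,
      vscale = vscale D,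
      hmul = (\<lambda>x y. tensor_lift A A' (\<lambda>h f. tensor_lift A A' (\<lambda>k g.
        sweedler A k (\<lambda>k1 k2. sweedler A k2 (\<lambda>k21 k22.
          ptensor A A'
            (hinv A 2 k21 \<cdot>\<^bsub>A\<^esub> h)
            (dual_lact A (hinv A 3 k22) (dual_ract A (dual_pow A 2 f) (S (hinv A 3 k1)))
              \<cdot>\<^bsub>A'\<^esub> g)))) y) x),
      hone = ptensor A A' (hone A) (hone A'),
      hcomul = (\<lambda>x. tensor_lift A A' (\<lambda>h f.
        sweedler A h (\<lambda>h1 h2. sweedler A' f (\<lambda>f1 f2.
          ptensor D D (ptensor A A' h1 f1) (ptensor A A' h2 f2)))) x),
      hcounit = (\<lambda>x. tensor_lift A A' (\<lambda>h f. hcounit A h * hcounit A' f) x),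
      hmap = (\<lambda>x. tensor_lift A A' (\<lambda>h f. ptensor A A' (hmap A h) (hmap A' f)) x)\<rparr>)"

definition drinfeld_double_tilde ::
  "('k::field, 'v::ab_group_add, 'z) hom_hopf_scheme
    \<Rightarrow> ('k, ('v \<Rightarrow> 'k, 'v, 'k) tensor) hom_bialg" where
  "drinfeld_double_tilde A =
    (let P = hom_dual (hom_op A); D = vtensor P A; Sinv = antipode_inv A in
     \<lparr>vcar = vcar D,
      vscale = vscale D,
      hmul = (\<lambda>x y. tensor_lift P A (\<lambda>f a. tensor_lift P A (\<lambda>g b.
        sweedler A a (\<lambda>a1 a2. sweedler A a2 (\<lambda>a21 a22.
          ptensor P A
            (f \<cdot>\<^bsub>P\<^esub> dual_ract A (dual_lact A (hinv A 3 a1) (dual_pow A 2 g)) (Sinv (hinv A 3 a22)))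
            (hinv A 2 a21 \<cdot>\<^bsub>A\<^esub> b)))) y) x),
      hone = ptensor P A (hone P) (hone A),
      hcomul = (\<lambda>x. tensor_lift P A (\<lambda>f a.
        sweedler P f (\<lambda>f1 f2. sweedler A a (\<lambda>a1 a2.
          ptensor D D (ptensor P A f1 a1) (ptensor P A f2 a2)))) x),
      hcounit = (\<lambda>x. tensor_lift P A (\<lambda>f a. hcounit P f * hcounit A a) x),
      hmap = (\<lambda>x. tensor_lift P A (\<lambda>f a. ptensor P A (hmap P f) (hmap A a)) x)\<rparr>)"


section \<open>Hom-2-cocycles and twists\<close>

definition left_hom_cocycle ::
  "('k::field, 'v::ab_group_add, 'z) hom_bialg_scheme \<Rightarrow> ('v \<Rightarrow> 'v \<Rightarrow> 'k) \<Rightarrow> bool" where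
  "left_hom_cocycle H \<sigma> \<longleftrightarrow>
     bilinear_on H H scalars \<sigma> \<and>
     (\<forall>h\<in>vcar H. \<forall>k\<in>vcar H. \<sigma> (hmap H h) (hmap H k) = \<sigma> h k) \<and>
     (\<forall>h\<in>vcar H. \<forall>l\<in>vcar H. \<forall>k\<in>vcar H.
        sweedler H l (\<lambda>l1 l2. sweedler H k (\<lambda>k1 k2.
          \<sigma> l1 k1 * \<sigma> ((hmap H ^^ 2) h) (l2 \<cdot>\<^bsub>H\<^esub> k2))) =
        sweedler H h (\<lambda>h1 h2. sweedler H l (\<lambda>l1 l2.
          \<sigma> h1 l1 * \<sigma> (h2 \<cdot>\<^bsub>H\<^esub> l2) ((hmap H ^^ 2) k))))"

definition right_hom_cocycle ::
  "('k::field, 'v::ab_group_add, 'z) hom_bialg_scheme \<Rightarrow> ('v \<Rightarrow> 'v \<Rightarrow> 'k) \<Rightarrow> bool" where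
  "right_hom_cocycle H \<sigma> \<longleftrightarrow>
     bilinear_on H H scalars \<sigma> \<and>
     (\<forall>h\<in>vcar H. \<forall>k\<in>vcar H. \<sigma> (hmap H h) (hmap H k) = \<sigma> h k) \<and>
     (\<forall>h\<in>vcar H. \<forall>l\<in>vcar H. \<forall>k\<in>vcar H.
        sweedler H l (\<lambda>l1 l2. sweedler H k (\<lambda>k1 k2.
          \<sigma> ((hmap H ^^ 2) h) (l1 \<cdot>\<^bsub>H\<^esub> k1) * \<sigma> l2 k2)) =
        sweedler H h (\<lambda>h1 h2. sweedler H l (\<lambda>l1 l2.
          \<sigma> (h1 \<cdot>\<^bsub>H\<^esub> l1) ((hmap H ^^ 2) k) * \<sigma> h2 l2)))"

definition left_twist ::
  "('k::field, 'v::ab_group_add, 'z) hom_bialg_scheme \<Rightarrow> ('v \<Rightarrow> 'v \<Rightarrow> 'k) \<Rightarrow> ('k, 'v) alg" where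
  "left_twist H \<sigma> =
     \<lparr>vcar = vcar H, vscale = vscale H,
      hmul = (\<lambda>h k. sweedler H h (\<lambda>h1 h2. sweedler H k (\<lambda>k1 k2.
        vscale H (\<sigma> h1 k1) (hinv H 1 (h2 \<cdot>\<^bsub>H\<^esub> k2)))))\<rparr>"

definition right_twist ::
  "('k::field, 'v::ab_group_add, 'z) hom_bialg_scheme \<Rightarrow> ('v \<Rightarrow> 'v \<Rightarrow> 'k) \<Rightarrow> ('k, 'v) alg" where
  "right_twist H \<sigma> =
     \<lparr>vcar = vcar H, vscale = vscale H,
      hmul = (\<lambda>h k. sweedler H h (\<lambda>h1 h2. sweedler H k (\<lambda>k1 k2.
        vscale H (\<sigma> h2 k2) (hinv H 1 (h1 \<cdot>\<^bsub>H\<^esub> k1)))))\<rparr>"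

definition double_cocycle ::
  "('k::field, 'v::ab_group_add, 'z) hom_hopf_scheme
    \<Rightarrow> ('v, 'v \<Rightarrow> 'k, 'k) tensor \<Rightarrow> ('v, 'v \<Rightarrow> 'k, 'k) tensor \<Rightarrow> 'k" where
  "double_cocycle A x y =
    (let A' = hom_dual A in
     tensor_lift A A' (\<lambda>h f. tensor_lift A A' (\<lambda>k g.
       hcounit A h * g (hone A) * f (hmap A k)) y) x)"

definition double_tilde_cocycle ::
  "('k::field, 'v::ab_group_add, 'z) hom_hopf_scheme
    \<Rightarrow> ('v \<Rightarrow> 'k, 'v, 'k) tensor \<Rightarrow> ('v \<Rightarrow> 'k, 'v, 'k) tensor \<Rightarrow> 'k" where
  "double_tilde_cocycle A x y =
    (let P = hom_dual (hom_op A) in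
     tensor_lift P A (\<lambda>f a. tensor_lift P A (\<lambda>g b.
       hcounit A b * f (hone A) * g (hmap A a)) y) x)"


section \<open>Heisenberg doubles\<close>

text \<open>The left regular action \<open>f \<rightharpoonup> b = f(b\<^sub>2) b\<^sub>1\<close> of \<open>A\<^sup>*\<close> on \<open>A\<close>.\<close>

definition reg_act ::
  "('k::field, 'v::ab_group_add, 'z) hom_bialg_scheme \<Rightarrow> ('v \<Rightarrow> 'k) \<Rightarrow> 'v \<Rightarrow> 'v" where
  "reg_act A f b = sweedler A b (\<lambda>b1 b2. vscale A (f b2) b1)"

definition heisenberg_double ::
  "('k::field, 'v::ab_group_add, 'z) hom_bialg_scheme
    \<Rightarrow> ('k, ('v, 'v \<Rightarrow> 'k, 'k) tensor) alg" where
  "heisenberg_double A =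
    (let A' = hom_dual A in
     \<lparr>vcar = vcar (vtensor A A'),
      vscale = vscale (vtensor A A'),
      hmul = (\<lambda>x y. tensor_lift A A' (\<lambda>a f. tensor_lift A A' (\<lambda>b g.
        sweedler A' f (\<lambda>f1 f2.
          ptensor A A'
            (a \<cdot>\<^bsub>A\<^esub> reg_act A (dual_pow A 2 f1) (hinv A 1 b))
            (dual_pow A 1 f2 \<cdot>\<^bsub>A'\<^esub> g))) y) x)\<rparr>)"

text \<open>
  The Heisenberg double \<open>H(A\<^sup>*)\<close>, written on \<open>A\<^sup>* \<otimes> A\<close> after identifying \<open>A\<^sup>*\<^sup>*\<close> with \<open>A\<close>:
  the smash product for the action \<open>dual_lact\<close> of \<open>A\<close> on \<open>A\<^sup>*\<close>.
\<close>

definition heisenberg_double_dual ::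
  "('k::field, 'v::ab_group_add, 'z) hom_bialg_scheme
    \<Rightarrow> ('k, ('v \<Rightarrow> 'k, 'v, 'k) tensor) alg" where
  "heisenberg_double_dual A =
    (let A' = hom_dual A in
     \<lparr>vcar = vcar (vtensor A' A),
      vscale = vscale (vtensor A' A),
      hmul = (\<lambda>x y. tensor_lift A' A (\<lambda>f a. tensor_lift A' A (\<lambda>g b.
        sweedler A a (\<lambda>a1 a2.
          ptensor A' A
            (f \<cdot>\<^bsub>A'\<^esub> dual_lact A (hinv A 2 a1) (dual_pow A 1 g))
            (hinv A 1 a2 \<cdot>\<^bsub>A\<^esub> b))) y) x)\<rparr>)"

text \<open>
  Two algebras are the same if they have the same underlying space and the two products
  coincide on it (values of the products outside the carrier are irrelevant).
\<close>

definition same_alg :: "('k, 'v) alg \<Rightarrow> ('k, 'v) alg \<Rightarrow> bool" where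
  "same_alg X Y \<longleftrightarrow> vcar X = vcar Y \<and> vscale X = vscale Y \<and>
     (\<forall>x\<in>vcar X. \<forall>y\<in>vcar X. x \<cdot>\<^bsub>X\<^esub> y = x \<cdot>\<^bsub>Y\<^esub> y)"

end

theory Submission
  imports Defs
begin

text \<open>
  Since \<open>\<alpha>\<close> is bijective, \<open>A\<close> is an ordinary Hopf algebra for \<open>a * b = \<alpha>\<^sup>-\<^sup>1(ab)\<close> and \<open>\<Delta> \<circ> \<alpha>\<^sup>-\<^sup>1\<close>,
  with \<open>\<alpha>\<close> an automorphism. In these terms, and up to the structure map, the product of
  \<open>h \<otimes> f\<close> and \<open>k \<otimes> g\<close> in \<open>D(A)\<close> is \<open>k\<^sub>2 * h \<otimes> f(\<alpha>(S k\<^sub>1) * x\<^sub>1 * \<alpha>(k\<^sub>3)) g(x\<^sub>2)\<close>, the second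
  factor being a function of \<open>x\<close>. The twist by \<open>\<sigma>\<close> puts a factor \<open>\<alpha>(k\<^sub>1)\<close> in front of \<open>\<alpha>(S k\<^sub>2)\<close>;
  the two cancel, and \<open>k\<^sub>1 * h \<otimes> f(x\<^sub>1 * \<alpha>(k\<^sub>2)) g(x\<^sub>2)\<close> is the product of the Heisenberg double.
  The right twist is treated in the same way, with the cancellation \<open>a\<^sub>2 S\<^sup>-\<^sup>1(a\<^sub>1) = \<epsilon>(a)\<close>.

  The two sides of the cocycle condition for \<open>\<sigma>\<close> are \<open>\<sigma>(\<alpha> h, l \<cdot>\<^sub>\<sigma> k)\<close> and \<open>\<sigma>(h \<cdot>\<^sub>\<sigma> l, \<alpha> k)\<close>, so
  it can be read off from the formula for the twisted product.

  That \<open>S\<close> is bijective follows Larson and Sweedler: the dual is a Hopf module, hence has a nonzero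
  integral, which forces \<open>S\<close> to be injective.
\<close>

section \<open>Linear algebra with carriers\<close>

text \<open>Tensors are functions on bilinear forms and \<open>tensor_lift\<close> is a definite
  description, so a nested Sweedler expression can be rewritten only where each level is known to be
  bilinear. Tensor identities are therefore paired with forms first: the Sweedler sums become finite
  sums of scalars over a coordinate frame, in which exchanging two sums and pulling out factors is
  unconditional, and multilinearity is checked only where an axiom is applied. Finite dimension is
  used beyond this bookkeeping: it provides the coproduct of the dual as an explicit finite sum, it
  allows the structure theorem for Hopf modules to be proved by traces over the frame, and it turns
  injectivity of S into surjectivity. Bijectivity of S matters for the second double, whose product
  contains \<open>antipode_inv\<close>: this is an \<open>inv_into\<close>, about which nothing can
  be computed until S is known to be a bijection of the carrier.\<close>

lemma vsD:
  assumes "is_vspace V"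
  shows "0 \<in> vcar V" "x \<in> vcar V \<Longrightarrow> y \<in> vcar V \<Longrightarrow> x + y \<in> vcar V"
    "x \<in> vcar V \<Longrightarrow> vscale V c x \<in> vcar V"
    "vscale V c (x + y) = vscale V c x + vscale V c y"
    "vscale V (c + c') x = vscale V c x + vscale V c' x"
    "vscale V c (vscale V c' x) = vscale V (c * c') x"
    "vscale V 1 x = x" "vscale V c 0 = 0" "vscale V 0 x = 0"
proof -
  interpret vector_space "vscale V" using assms by (simp add: is_vspace_def)
  have "subspace (vcar V)" using assms by (simp add: is_vspace_def)
  then show "0 \<in> vcar V" "x \<in> vcar V \<Longrightarrow> y \<in> vcar V \<Longrightarrow> x + y \<in> vcar V"
    "x \<in> vcar V \<Longrightarrow> vscale V c x \<in> vcar V"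
    by (auto simp: subspace_def)
qed (use assms in \<open>simp_all add: is_vspace_def vector_space_def module.scale_zero_right
      module.scale_zero_left module_iff_vector_space\<close>)

lemma vs_sum:
  assumes "is_vspace V" "\<And>i. i \<in> I \<Longrightarrow> g i \<in> vcar V"
  shows "(\<Sum>i\<in>I. g i) \<in> vcar V"
  using assms(2) by (induction I rule: infinite_finite_induct) (auto intro: vsD[OF assms(1)])

lemma vs_scale_sum:
  assumes "is_vspace V"
  shows "vscale V c (\<Sum>i\<in>I. g i) = (\<Sum>i\<in>I. vscale V c (g i))"
  by (induction I rule: infinite_finite_induct) (auto simp: vsD[OF assms])

lemma vsI:
  assumes "vector_space (vscale V)" "0 \<in> vcar V"
    and "\<And>x y. x \<in> vcar V \<Longrightarrow> y \<in> vcar V \<Longrightarrow> x + y \<in> vcar V"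
    and "\<And>c x. x \<in> vcar V \<Longrightarrow> vscale V c x \<in> vcar V"
  shows "is_vspace V"
proof -
  interpret vector_space "vscale V" by fact
  show ?thesis using assms by (auto simp: is_vspace_def subspace_def)
qed

lemma vs_cong:
  "vcar V = vcar V' \<Longrightarrow> vscale V = vscale V' \<Longrightarrow> is_vspace V \<longleftrightarrow> is_vspace V'"
  by (simp add: is_vspace_def)

lemma linear_on_congD:
  assumes "linear_on V W f" "\<And>x. x \<in> vcar V \<Longrightarrow> f x = f' x" "is_vspace V"
  shows "linear_on V W f'"
  using assms(1,2) vsD(2,3)[OF assms(3)] by (simp add: linear_on_def)

lemma bilinear_on_cong:
  assumes "vcar V = vcar V'" "vscale V = vscale V'" "vcar W = vcar W'" "vscale W = vscale W'"
    "vcar U = vcar U'" "vscale U = vscale U'"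
  shows "bilinear_on V W U = bilinear_on V' W' U'"
  using assms by (intro ext) (simp add: bilinear_on_def linear_on_def)

text \<open>Tensors see only carriers and scalings, so \<open>hom_dual A\<close>,
  \<open>dual_space A\<close> and the dual of \<open>hom_op A\<close> give literally the same pure
  tensors although the records differ. This congruence and the next two let later arguments work
  with \<open>dual_space A\<close> throughout.\<close>

lemma ptensor_cong:
  assumes "vcar V = vcar V'" "vscale V = vscale V'" "vcar W = vcar W'" "vscale W = vscale W'"
  shows "ptensor V W = ptensor V' W'"
  using bilinear_on_cong[OF assms refl refl, of scalars] by (simp add: ptensor_def[abs_def])

lemma vtensor_cong:
  assumes "vcar V = vcar V'" "vscale V = vscale V'" "vcar W = vcar W'" "vscale W = vscale W'"
  shows "vtensor V W = vtensor V' W'"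
  using assms ptensor_cong[OF assms] by (simp add: vtensor_def)

lemma tensor_lift_scheme_cong:
  assumes "vcar V = vcar V'" "vscale V = vscale V'" "vcar W = vcar W'" "vscale W = vscale W'"
  shows "tensor_lift V W = tensor_lift V' W'"
  using assms ptensor_cong[OF assms] by (intro ext) (simp add: tensor_lift_def)

text \<open>The predicates under the definite description coincide, so the lifts agree for arbitrary
  maps, even where the description determines no value.\<close>

lemma tensor_lift_cong:
  assumes "\<And>v w. v \<in> vcar V \<Longrightarrow> w \<in> vcar W \<Longrightarrow> \<beta> v w = \<beta>' v w"
  shows "tensor_lift V W \<beta> t = tensor_lift V W \<beta>' t"
proof -
  have "(\<Sum>(v, w)\<leftarrow>ps. \<beta> v w) = (\<Sum>(v, w)\<leftarrow>ps. \<beta>' v w)" if "set ps \<subseteq> vcar V \<times> vcar W" for ps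
    using that assms by (induction ps) auto
  then have "(\<exists>ps. set ps \<subseteq> vcar V \<times> vcar W \<and> t = (\<Sum>(v, w)\<leftarrow>ps. ptensor V W v w) \<and>
        u = (\<Sum>(v, w)\<leftarrow>ps. \<beta> v w)) \<longleftrightarrow>
      (\<exists>ps. set ps \<subseteq> vcar V \<times> vcar W \<and> t = (\<Sum>(v, w)\<leftarrow>ps. ptensor V W v w) \<and>
        u = (\<Sum>(v, w)\<leftarrow>ps. \<beta>' v w))" for u
    by (intro ex_cong1) auto
  then show ?thesis by (simp add: tensor_lift_def)
qed

lemma linear_onD:
  assumes "linear_on V W f"
  shows "x \<in> vcar V \<Longrightarrow> f x \<in> vcar W"
    "x \<in> vcar V \<Longrightarrow> y \<in> vcar V \<Longrightarrow> f (x + y) = f x + f y"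
    "x \<in> vcar V \<Longrightarrow> f (vscale V c x) = vscale W c (f x)"
  using assms by (auto simp: linear_on_def)

lemma bilinear_onD:
  assumes "bilinear_on V W U \<beta>"
  shows "v \<in> vcar V \<Longrightarrow> linear_on W U (\<beta> v)" "w \<in> vcar W \<Longrightarrow> linear_on V U (\<lambda>v. \<beta> v w)"
    "v \<in> vcar V \<Longrightarrow> w \<in> vcar W \<Longrightarrow> \<beta> v w \<in> vcar U"
  using assms by (auto simp: bilinear_on_def linear_on_def)

lemma linear_on_zero:
  assumes "linear_on V W f" "is_vspace V" "is_vspace W"
  shows "f 0 = 0"
  using linear_onD(3)[OF assms(1), of 0 0] vsD[OF assms(2)] vsD[OF assms(3)] by simp

lemma linear_on_sum:
  assumes f: "linear_on V W f" and V: "is_vspace V" and W: "is_vspace W"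
    and g: "\<And>i. i \<in> I \<Longrightarrow> g i \<in> vcar V"
  shows "f (\<Sum>i\<in>I. g i) = (\<Sum>i\<in>I. f (g i))"
  using g
  by (induction I rule: infinite_finite_induct)
     (auto simp: linear_on_zero[OF f V W] linear_onD[OF f] vs_sum[OF V])

lemma linear_on_sum_list:
  assumes f: "linear_on V W f" and V: "is_vspace V" and W: "is_vspace W"
    and g: "\<And>i. i \<in> set I \<Longrightarrow> g i \<in> vcar V"
  shows "f (\<Sum>i\<leftarrow>I. g i) = (\<Sum>i\<leftarrow>I. f (g i)) \<and> (\<Sum>i\<leftarrow>I. g i) \<in> vcar V"
  using g
  by (induction I)
     (auto simp: linear_on_zero[OF f V W] linear_onD[OF f] vsD[OF V])

lemma linear_on_comp: "linear_on V W f \<Longrightarrow> linear_on U V g \<Longrightarrow> linear_on U W (\<lambda>x. f (g x))"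
  by (simp add: linear_on_def)

lemma bilinear_on_comp:
  assumes "bilinear_on V W U \<beta>" "linear_on V' V f" "linear_on W' W g"
  shows "bilinear_on V' W' U (\<lambda>x y. \<beta> (f x) (g y))"
  using assms by (simp add: bilinear_on_def linear_on_def)

lemma lin_bilinear_left:
  "bilinear_on V W U \<beta> \<Longrightarrow> w \<in> vcar W \<Longrightarrow> linear_on X V g \<Longrightarrow> linear_on X U (\<lambda>x. \<beta> (g x) w)"
  using linear_on_comp[OF bilinear_onD(2)] .

lemma lin_bilinear_right:
  "bilinear_on V W U \<beta> \<Longrightarrow> v \<in> vcar V \<Longrightarrow> linear_on X W g \<Longrightarrow> linear_on X U (\<lambda>x. \<beta> v (g x))"
  using linear_on_comp[OF bilinear_onD(1)] .

lemma linear_on_bilinear: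
  assumes "linear_on U U' f" "bilinear_on V W U \<beta>"
  shows "bilinear_on V W U' (\<lambda>x y. f (\<beta> x y))"
  using assms by (simp add: bilinear_on_def linear_on_def)

lemma bilinear_onI:
  assumes "\<And>v. v \<in> vcar V \<Longrightarrow> linear_on W U (\<beta> v)" "\<And>w. w \<in> vcar W \<Longrightarrow> linear_on V U (\<lambda>v. \<beta> v w)"
  shows "bilinear_on V W U \<beta>"
  using assms by (simp add: bilinear_on_def)

lemma linear_on_id: "linear_on V V (\<lambda>x. x)"
  by (simp add: linear_on_def)

lemma linear_on_scale: "is_vspace W \<Longrightarrow> linear_on V W f \<Longrightarrow> linear_on V W (\<lambda>x. vscale W c (f x))"
  by (simp add: linear_on_def vsD mult.commute)

lemma linear_on_scale_left:
  "is_vspace W \<Longrightarrow> linear_on V scalars f \<Longrightarrow> w \<in> vcar W \<Longrightarrow> linear_on V W (\<lambda>x. vscale W (f x) w)"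
  by (simp add: linear_on_def scalars_def vsD)

section \<open>Tensor products: spanning by pure tensors and linearity of lifts\<close>

lemma scalars_simps [simp]: "vcar scalars = UNIV" "vscale scalars = (*)"
  by (simp_all add: scalars_def)

lemma vs_scalars: "is_vspace scalars"
  by (intro vsI) (auto simp: vector_space_def algebra_simps)

lemma vector_space_fun_scale:
  "vector_space (\<lambda>(c :: 'k::field) (f :: 'b \<Rightarrow> 'k) x. c * f x)"
  by unfold_locales (auto simp: algebra_simps)

lemma vtensor_scale: "vscale (vtensor V W) = (\<lambda>c t \<beta>. c * t \<beta>)"
  by (simp add: vtensor_def)

lemma vs_vtensor:
  fixes V :: "('k::field, 'v::ab_group_add, 'z) vspace_scheme"
  shows "is_vspace (vtensor V W)"
proof -
  interpret vector_space "\<lambda>(c :: 'k) (f :: _ \<Rightarrow> 'k) x. c * f x"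
    by (fact vector_space_fun_scale)
  show ?thesis
    by (simp add: is_vspace_def vtensor_def vector_space_axioms)
qed

lemma ptensor_in:
  fixes V :: "('k::field, 'v::ab_group_add, 'z) vspace_scheme"
  shows "v \<in> vcar V \<Longrightarrow> w \<in> vcar W \<Longrightarrow> ptensor V W v w \<in> vcar (vtensor V W)"
proof -
  interpret vector_space "\<lambda>(c :: 'k) (f :: _ \<Rightarrow> 'k) x. c * f x"
    by (fact vector_space_fun_scale)
  show "v \<in> vcar V \<Longrightarrow> w \<in> vcar W \<Longrightarrow> ptensor V W v w \<in> vcar (vtensor V W)"
    by (auto simp: vtensor_def intro!: span_base)
qed

lemma ptensor_apply: "bilinear_on V W scalars \<beta> \<Longrightarrow> ptensor V W v w \<beta> = \<beta> v w"
  by (simp add: ptensor_def)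

lemma ptensor_bilinear: "bilinear_on V W (vtensor V W) (ptensor V W)"
proof (rule bilinear_onI)
  show "linear_on W (vtensor V W) (ptensor V W v)" if "v \<in> vcar V" for v
    using that unfolding linear_on_def
    by (auto simp: ptensor_in) (auto simp: vtensor_scale ptensor_def fun_eq_iff bilinear_on_def linear_on_def)
  show "linear_on V (vtensor V W) (\<lambda>v. ptensor V W v w)" if "w \<in> vcar W" for w
    using that unfolding linear_on_def
    by (auto simp: ptensor_in) (auto simp: vtensor_scale ptensor_def fun_eq_iff bilinear_on_def linear_on_def)
qed

text \<open>The coefficients of a linear combination are absorbed into the left factors, which
  leaves the unweighted sum of pure tensors that \<open>tensor_lift_sum\<close> expects.\<close>

lemma vtensor_sum_list:
  fixes V :: "('k::field, 'v::ab_group_add, 'z) vspace_scheme"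
  assumes V: "is_vspace V" and t: "t \<in> vcar (vtensor V W)"
  obtains ps where "set ps \<subseteq> vcar V \<times> vcar W" "t = (\<Sum>(v, w)\<leftarrow>ps. ptensor V W v w)"
proof -
  interpret vector_space "\<lambda>(c :: 'k) (f :: _ \<Rightarrow> 'k) x. c * f x"
    by (fact vector_space_fun_scale)
  have "t \<in> span {ptensor V W v w | v w. v \<in> vcar V \<and> w \<in> vcar W}"
    using t by (simp add: vtensor_def)
  then have "\<exists>ps. set ps \<subseteq> vcar V \<times> vcar W \<and> t = (\<Sum>(v, w)\<leftarrow>ps. ptensor V W v w)"
  proof (induction rule: span_induct_alt)
    case base
    show ?case by (rule exI[of _ "[]"]) auto
  next
    case (step c x y)
    then obtain ps v w where ps: "set ps \<subseteq> vcar V \<times> vcar W" "y = (\<Sum>(v, w)\<leftarrow>ps. ptensor V W v w)"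
      and vw: "v \<in> vcar V" "w \<in> vcar W" "x = ptensor V W v w" by blast
    have "(\<lambda>\<beta>. c * x \<beta>) = ptensor V W (vscale V c v) w"
      using linear_onD(3)[OF bilinear_onD(2)[OF ptensor_bilinear vw(2)] vw(1)] vw(3)
      by (simp add: vtensor_scale)
    then show ?case using ps vw vsD(3)[OF V vw(1)]
      by (intro exI[of _ "(vscale V c v, w) # ps"]) auto
  qed
  then show ?thesis using that by blast
qed

lemma tensor_lift_commute:
  assumes V: "is_vspace V" and U: "is_vspace U" and U': "is_vspace U'"
    and \<beta>: "bilinear_on V W U \<beta>" and f: "linear_on U U' f" and t: "t \<in> vcar (vtensor V W)"
  shows "f (tensor_lift V W \<beta> t) = tensor_lift V W (\<lambda>v w. f (\<beta> v w)) t"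
proof -
  obtain ps where ps: "set ps \<subseteq> vcar V \<times> vcar W" "t = (\<Sum>(v, w)\<leftarrow>ps. ptensor V W v w)"
    using vtensor_sum_list[OF V t] .
  have *: "(\<lambda>(v, w). \<beta> v w) p \<in> vcar U" if "p \<in> set ps" for p
    using that ps(1) \<beta> by (auto simp: bilinear_on_def linear_on_def)
  show ?thesis
    unfolding ps(2) tensor_lift_sum[OF U \<beta> ps(1)]
      tensor_lift_sum[OF U' linear_on_bilinear[OF f \<beta>] ps(1)]
    using linear_on_sum_list[OF f U U' *, of ps "\<lambda>p. p"] by (simp add: case_prod_unfold)
qed

text \<open>A tensor is itself a function on bilinear forms, and lifting a scalar-valued \<beta>
  amounts to applying the tensor to \<beta>. Scalar Sweedler sums thereby become plain function
  applications.\<close>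

lemma tensor_lift_scalar:
  assumes V: "is_vspace V" and \<beta>: "bilinear_on V W scalars \<beta>" and t: "t \<in> vcar (vtensor V W)"
  shows "tensor_lift V W \<beta> t = t \<beta>"
proof -
  obtain ps where ps: "set ps \<subseteq> vcar V \<times> vcar W" "t = (\<Sum>(v, w)\<leftarrow>ps. ptensor V W v w)"
    using vtensor_sum_list[OF V t] .
  show ?thesis
    unfolding ps(2) tensor_lift_sum[OF vs_scalars \<beta> ps(1)] sum_list_ptensor_apply[OF \<beta>] ..
qed

lemma tensor_lift_apply:
  assumes V: "is_vspace V" and \<beta>: "bilinear_on V W U \<beta>" and f: "linear_on U scalars f"
    and U: "is_vspace U" and t: "t \<in> vcar (vtensor V W)"
  shows "f (tensor_lift V W \<beta> t) = t (\<lambda>v w. f (\<beta> v w))"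
  using tensor_lift_commute[OF V U vs_scalars \<beta> f t]
    tensor_lift_scalar[OF V linear_on_bilinear[OF f \<beta>] t] by simp

lemma tensor_lift_linear:
  assumes V: "is_vspace V" and U: "is_vspace U" and \<beta>: "bilinear_on V W U \<beta>"
  shows "linear_on (vtensor V W) U (tensor_lift V W \<beta>)"
proof -
  have rep: "\<exists>ps. set ps \<subseteq> vcar V \<times> vcar W \<and> t = (\<Sum>(v, w)\<leftarrow>ps. ptensor V W v w)"
    if "t \<in> vcar (vtensor V W)" for t
    using vtensor_sum_list[OF V that] by metis
  have in_U: "(\<Sum>(v, w)\<leftarrow>ps. \<beta> v w) \<in> vcar U" if "set ps \<subseteq> vcar V \<times> vcar W" for ps
    using that by (induction ps) (auto simp: vsD[OF U] bilinear_onD[OF \<beta>])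
  show ?thesis unfolding linear_on_def
  proof (intro conjI ballI allI)
    fix t assume "t \<in> vcar (vtensor V W)"
    then obtain ps where ps: "set ps \<subseteq> vcar V \<times> vcar W" "t = (\<Sum>(v, w)\<leftarrow>ps. ptensor V W v w)"
      using rep by metis
    show "tensor_lift V W \<beta> t \<in> vcar U"
      unfolding ps(2) tensor_lift_sum[OF U \<beta> ps(1)] by (rule in_U[OF ps(1)])
    fix c
    define qs where "qs = map (\<lambda>(v, w). (vscale V c v, w)) ps"
    have qs: "set qs \<subseteq> vcar V \<times> vcar W"
      using ps(1) vsD(3)[OF V] by (auto simp: qs_def)
    have 1: "vscale (vtensor V W) c t = (\<Sum>(v, w)\<leftarrow>qs. ptensor V W v w)"
      using ps(1) unfolding ps(2) qs_def
      by (induction ps)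
         (auto simp: vsD[OF vs_vtensor]
           linear_onD(3)[OF bilinear_onD(2)[OF ptensor_bilinear]])
    have 2: "vscale U c (\<Sum>(v, w)\<leftarrow>ps. \<beta> v w) = (\<Sum>(v, w)\<leftarrow>qs. \<beta> v w)"
      using ps(1) unfolding qs_def
      by (induction ps) (auto simp: vsD[OF U] linear_onD(3)[OF bilinear_onD(2)[OF \<beta>]])
    show "tensor_lift V W \<beta> (vscale (vtensor V W) c t) = vscale U c (tensor_lift V W \<beta> t)"
      unfolding 1 tensor_lift_sum[OF U \<beta> qs] by (simp add: ps(2) tensor_lift_sum[OF U \<beta> ps(1)] 2)
  next
    fix t t' assume "t \<in> vcar (vtensor V W)" "t' \<in> vcar (vtensor V W)"
    then obtain ps qs where ps: "set ps \<subseteq> vcar V \<times> vcar W" "t = (\<Sum>(v, w)\<leftarrow>ps. ptensor V W v w)"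
      and qs: "set qs \<subseteq> vcar V \<times> vcar W" "t' = (\<Sum>(v, w)\<leftarrow>qs. ptensor V W v w)"
      using rep by metis
    have 1: "t + t' = (\<Sum>(v, w)\<leftarrow>ps @ qs. ptensor V W v w)"
      by (simp add: ps qs)
    have "set (ps @ qs) \<subseteq> vcar V \<times> vcar W" using ps qs by auto
    from tensor_lift_sum[OF U \<beta> this]
    show "tensor_lift V W \<beta> (t + t') = tensor_lift V W \<beta> t + tensor_lift V W \<beta> t'"
      unfolding 1 by (simp add: ps(2) qs(2) tensor_lift_sum[OF U \<beta>] ps(1) qs(1))
  qed
qed

lemma sum_list_linear_param:
  assumes U: "is_vspace U" and "set ps \<subseteq> vcar V \<times> vcar W"
    and "\<And>v w. v \<in> vcar V \<Longrightarrow> w \<in> vcar W \<Longrightarrow> linear_on X U (\<lambda>x. \<beta> x v w)"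
  shows "linear_on X U (\<lambda>x. \<Sum>(v, w)\<leftarrow>ps. \<beta> x v w)"
  using assms(2,3)
proof (induction ps)
  case Nil
  then show ?case by (simp add: linear_on_def vsD[OF U])
next
  case (Cons p ps)
  then show ?case
    by (cases p) (fastforce simp: linear_on_def vsD[OF U])
qed

text \<open>Companion of \<open>tensor_lift_linear\<close>: here the tensor is fixed and the form
  varies. Nested Sweedler sums need both, since an inner sum must be linear in the outer variables
  before the outer lift can be evaluated.\<close>

lemma tensor_lift_linear_param:
  assumes V: "is_vspace V" and U: "is_vspace U" and X: "is_vspace X"
    and \<beta>: "\<And>x. x \<in> vcar X \<Longrightarrow> bilinear_on V W U (\<beta> x)"
    and lin: "\<And>v w. v \<in> vcar V \<Longrightarrow> w \<in> vcar W \<Longrightarrow> linear_on X U (\<lambda>x. \<beta> x v w)"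
    and t: "t \<in> vcar (vtensor V W)"
  shows "linear_on X U (\<lambda>x. tensor_lift V W (\<beta> x) t)"
proof -
  obtain ps where ps: "set ps \<subseteq> vcar V \<times> vcar W" "t = (\<Sum>(v, w)\<leftarrow>ps. ptensor V W v w)"
    using vtensor_sum_list[OF V t] .
  show ?thesis
    using sum_list_linear_param[where \<beta>=\<beta>, OF U ps(1) lin]
    by (rule linear_on_congD) (simp_all add: ps(2) tensor_lift_sum[OF U \<beta> ps(1)] X)
qed

lemma vtensor_linear_eqI:
  assumes V: "is_vspace V" and U: "is_vspace U"
    and f: "linear_on (vtensor V W) U f" and g: "linear_on (vtensor V W) U g"
    and eq: "\<And>v w. v \<in> vcar V \<Longrightarrow> w \<in> vcar W \<Longrightarrow> f (ptensor V W v w) = g (ptensor V W v w)"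
    and t: "t \<in> vcar (vtensor V W)"
  shows "f t = g t"
proof -
  obtain ps where ps: "set ps \<subseteq> vcar V \<times> vcar W" "t = (\<Sum>(v, w)\<leftarrow>ps. ptensor V W v w)"
    using vtensor_sum_list[OF V t] .
  have *: "(\<lambda>(v, w). ptensor V W v w) p \<in> vcar (vtensor V W)" if "p \<in> set ps" for p
    using that ps(1) by (auto simp: ptensor_in)
  have "map (\<lambda>p. f (case p of (v, w) \<Rightarrow> ptensor V W v w)) ps
      = map (\<lambda>p. g (case p of (v, w) \<Rightarrow> ptensor V W v w)) ps"
    using ps(1) eq by auto
  from arg_cong[OF this, of sum_list] show ?thesis
    unfolding ps(2)
    using linear_on_sum_list[OF f vs_vtensor U *, of ps "\<lambda>p. p"]
      linear_on_sum_list[OF g vs_vtensor U *, of ps "\<lambda>p. p"]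
    by simp
qed

section \<open>Dual spaces and coordinate frames\<close>

lemma dual_space_simps:
  "f \<in> vcar (dual_space V) \<longleftrightarrow> linear_on V scalars f \<and> (\<forall>x. x \<notin> vcar V \<longrightarrow> f x = 0)"
  "vscale (dual_space V) = (\<lambda>c f x. c * f x)"
  by (simp_all add: dual_space_def)

lemma vs_dual: "is_vspace (dual_space V)"
proof (rule vsI)
  show "vector_space (vscale (dual_space V))"
    unfolding dual_space_simps by (rule vector_space_fun_scale)
qed (auto simp: dual_space_simps linear_on_def algebra_simps)

lemma form_on_apply [simp]: "x \<in> vcar V \<Longrightarrow> form_on V f x = f x"
  by (simp add: form_on_def)

lemma form_on_dual: "is_vspace V \<Longrightarrow> linear_on V scalars f \<Longrightarrow> form_on V f \<in> vcar (dual_space V)"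
  by (auto simp: dual_space_simps linear_on_def form_on_def vsD)

lemma dual_eqI:
  assumes "f \<in> vcar (dual_space V)" "g \<in> vcar (dual_space V)" "\<And>x. x \<in> vcar V \<Longrightarrow> f x = g x"
  shows "f = g"
  using assms by (intro ext) (metis dual_space_simps(1))

lemma eval_dual_linear: "linear_on (dual_space V) scalars (\<lambda>f. f x)"
  by (simp add: linear_on_def dual_space_simps)

text \<open>Dual bases, recorded through the completeness relation. In this form the notion passes
  to the dual space by exchanging vectors and coordinate forms; the separate index set keeps the
  same indices on both sides.\<close>

definition coord_frame ::
  "('k::field, 'v::ab_group_add, 'z) vspace_scheme \<Rightarrow> 'i set \<Rightarrow> ('i \<Rightarrow> 'v) \<Rightarrow> ('i \<Rightarrow> 'v \<Rightarrow> 'k) \<Rightarrow> bool"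
  where "coord_frame V I b e \<longleftrightarrow> finite I \<and>
    (\<forall>i\<in>I. b i \<in> vcar V \<and> e i \<in> vcar (dual_space V)) \<and>
    (\<forall>x\<in>vcar V. x = (\<Sum>i\<in>I. vscale V (e i x) (b i)))"

lemma coord_frameD:
  assumes "coord_frame V I b e"
  shows "finite I" "i \<in> I \<Longrightarrow> b i \<in> vcar V" "i \<in> I \<Longrightarrow> e i \<in> vcar (dual_space V)"
    "i \<in> I \<Longrightarrow> linear_on V scalars (e i)"
    "x \<in> vcar V \<Longrightarrow> (\<Sum>i\<in>I. vscale V (e i x) (b i)) = x"
  using assms by (auto simp: coord_frame_def dual_space_simps)

lemma fin_dim_coord_frame:
  assumes V: "is_vspace V" and "fin_dim V"
  obtains B e where "coord_frame V B (\<lambda>i. i) e"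
proof -
  interpret vector_space "vscale V" using V by (simp add: is_vspace_def)
  obtain C where C: "finite C" "span C = vcar V" using assms(2) by (auto simp: fin_dim_def)
  obtain B where B: "B \<subseteq> C" "independent B" "C \<subseteq> span B"
    using maximal_independent_subset[of C] by metis
  have sB: "span B = vcar V"
    using B C by (metis span_eq span_base subset_eq)
  have fB: "finite B" using B C finite_subset by blast
  have rep: "(\<Sum>b\<in>B. vscale V (representation B x b) b) = x" if "x \<in> vcar V" for x
    using sum_representation_eq[OF B(2) _ fB] that sB by simp
  have "coord_frame V B (\<lambda>i. i) (\<lambda>i. form_on V (\<lambda>x. representation B x i))"
    unfolding coord_frame_def
  proof (intro conjI ballI fB)
    fix i assume "i \<in> B"
    then show "i \<in> vcar V" using sB span_base by blast
    show "form_on V (\<lambda>x. representation B x i) \<in> vcar (dual_space V)"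
      using sB by (intro form_on_dual V) (simp add: linear_on_def representation_add[OF B(2)]
        representation_scale[OF B(2)])
  next
    fix x assume "x \<in> vcar V"
    then show "x = (\<Sum>i\<in>B. vscale V (form_on V (\<lambda>x. representation B x i) x) i)"
      by (simp add: rep)
  qed
  then show ?thesis by (rule that)
qed

lemma coord_frame_linear:
  assumes V: "is_vspace V" and U: "is_vspace U" and fr: "coord_frame V I b e"
    and f: "linear_on V U f" and x: "x \<in> vcar V"
  shows "f x = (\<Sum>i\<in>I. vscale U (e i x) (f (b i)))"
proof -
  have "f (\<Sum>i\<in>I. vscale V (e i x) (b i)) = (\<Sum>i\<in>I. f (vscale V (e i x) (b i)))"
    by (rule linear_on_sum[OF f V U]) (simp add: coord_frameD[OF fr] vsD[OF V])
  then show ?thesis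
    by (simp add: coord_frameD[OF fr] linear_onD[OF f] x)
qed

lemma sum_fun_apply: "(\<Sum>i\<in>I. F i) x = (\<Sum>i\<in>I. F i x)"
  by (induction I rule: infinite_finite_induct) auto

text \<open>Applying f to the completeness relation for x gives f(x) as the sum of f(b_i) e_i(x), so
  evaluation at the frame vectors provides the coordinates of f.\<close>

lemma coord_frame_dual:
  assumes V: "is_vspace V" and fr: "coord_frame V I b e"
  shows "coord_frame (dual_space V) I e (\<lambda>i. form_on (dual_space V) (\<lambda>f. f (b i)))"
  unfolding coord_frame_def
proof (intro conjI ballI)
  fix f assume f: "f \<in> vcar (dual_space V)"
  have S: "(\<Sum>i\<in>I. vscale (dual_space V) (form_on (dual_space V) (\<lambda>f. f (b i)) f) (e i))
      \<in> vcar (dual_space V)"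
    by (intro vs_sum vs_dual vsD(3)[OF vs_dual] coord_frameD(3)[OF fr])
  show "f = (\<Sum>i\<in>I. vscale (dual_space V) (form_on (dual_space V) (\<lambda>f. f (b i)) f) (e i))"
  proof (rule dual_eqI[OF f S])
    fix x assume x: "x \<in> vcar V"
    have "f x = (\<Sum>i\<in>I. vscale scalars (e i x) (f (b i)))"
      using coord_frame_linear[OF V vs_scalars fr _ x] f by (simp add: dual_space_simps)
    then show "f x = (\<Sum>i\<in>I. vscale (dual_space V) (form_on (dual_space V) (\<lambda>f. f (b i)) f) (e i)) x"
      using f by (simp add: sum_fun_apply dual_space_simps(2) mult.commute)
  qed
next
  show "form_on (dual_space V) (\<lambda>f. f (b i)) \<in> vcar (dual_space (dual_space V))" for i
    by (intro form_on_dual vs_dual eval_dual_linear)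
qed (use fr in \<open>simp_all add: coord_frameD\<close>)

text \<open>Expanding \<beta> in both arguments shows that a tensor is determined by its finite
  matrix of values on products of coordinate forms. For \<Delta>(c) this matrix supplies the
  coefficients of \<open>sw\<close>.\<close>

lemma vtensor_expand:
  assumes V: "is_vspace V" and W: "is_vspace W"
    and fV: "coord_frame V I b e" and fW: "coord_frame W J c d"
    and \<beta>: "bilinear_on V W scalars \<beta>" and t: "t \<in> vcar (vtensor V W)"
  shows "t \<beta> = (\<Sum>i\<in>I. \<Sum>j\<in>J. t (\<lambda>v w. e i v * d j w) * \<beta> (b i) (c j))"
proof -
  have ed: "bilinear_on V W scalars (\<lambda>v w. e i v * d j w)" if "i \<in> I" "j \<in> J" for i j
    using coord_frameD(4)[OF fV that(1)] coord_frameD(4)[OF fW that(2)]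
    by (simp add: bilinear_on_def linear_on_def algebra_simps)
  have 1: "\<beta> v w = (\<Sum>i\<in>I. \<Sum>j\<in>J. e i v * d j w * \<beta> (b i) (c j))"
    if v: "v \<in> vcar V" and w: "w \<in> vcar W" for v w
    using coord_frame_linear[OF V vs_scalars fV bilinear_onD(2)[OF \<beta> w] v]
      coord_frame_linear[OF W vs_scalars fW bilinear_onD(1)[OF \<beta> coord_frameD(2)[OF fV]] w]
    by (simp add: sum_distrib_left mult.assoc)
  obtain ps where ps: "set ps \<subseteq> vcar V \<times> vcar W" "t = (\<Sum>(v, w)\<leftarrow>ps. ptensor V W v w)"
    using vtensor_sum_list[OF V t] .
  have "(\<Sum>(v, w)\<leftarrow>ps. \<beta> v w)
      = (\<Sum>i\<in>I. \<Sum>j\<in>J. (\<Sum>(v, w)\<leftarrow>ps. e i v * d j w) * \<beta> (b i) (c j))"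
    using ps(1)
    by (induction ps) (auto simp: 1 sum.distrib distrib_right)
  then show ?thesis
    unfolding ps(2) by (simp add: sum_list_ptensor_apply[OF \<beta>] sum_list_ptensor_apply[OF ed])
qed

text \<open>Equality of tensors is equality on all functions \<beta>, bilinear or not. On those that
  are not bilinear, pure tensors vanish by definition.\<close>

lemma vtensor_outside:
  assumes "t \<in> vcar (vtensor V W)" "is_vspace V" "\<not> bilinear_on V W scalars \<beta>"
  shows "t \<beta> = 0"
proof -
  obtain ps where ps: "t = (\<Sum>(v, w)\<leftarrow>ps. ptensor V W v w)"
    using vtensor_sum_list[OF assms(2,1)] by metis
  show ?thesis unfolding ps using assms(3) by (induction ps) (auto simp: ptensor_def)
qed

lemma vtensor_eqI:
  assumes V: "is_vspace V" and W: "is_vspace W"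
    and fV: "coord_frame V I b e" and fW: "coord_frame W J c d"
    and t: "t \<in> vcar (vtensor V W)" and t': "t' \<in> vcar (vtensor V W)"
    and eq: "\<And>i j. i \<in> I \<Longrightarrow> j \<in> J \<Longrightarrow> t (\<lambda>v w. e i v * d j w) = t' (\<lambda>v w. e i v * d j w)"
  shows "t = t'"
proof
  fix \<beta>
  show "t \<beta> = t' \<beta>"
  proof (cases "bilinear_on V W scalars \<beta>")
    case True
    show ?thesis
      unfolding vtensor_expand[OF V W fV fW True t] vtensor_expand[OF V W fV fW True t']
      by (simp add: eq)
  qed (simp add: vtensor_outside[OF t V] vtensor_outside[OF t' V])
qed

text \<open>Since f is linear only on the carrier, it is replaced by a map \<open>g\<close> that
  agrees with it on a basis and is linear on the whole type. The image of the basis is independent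
  and as large as the basis, so a carrier vector outside its span would give an independent set that
  is too large.\<close>

lemma injective_imp_surjective_on:
  assumes V: "is_vspace V" and fd: "fin_dim V" and f: "linear_on V V f" and inj: "inj_on f (vcar V)"
  shows "f ` vcar V = vcar V"
proof -
  interpret vector_space "vscale V" using V by (simp add: is_vspace_def)
  interpret pair: vector_space_pair "vscale V" "vscale V" by unfold_locales
  obtain C where C: "finite C" "span C = vcar V" using fd by (auto simp: fin_dim_def)
  obtain B where B: "B \<subseteq> C" "independent B" "C \<subseteq> span B"
    using maximal_independent_subset[of C] by metis
  have sB: "span B = vcar V"
    using B C by (metis span_eq span_base subset_eq)
  have fB: "finite B" using B C finite_subset by blast
  obtain g where g: "Vector_Spaces.linear (vscale V) (vscale V) g" "\<And>x. x \<in> B \<Longrightarrow> g x = f x"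
    using pair.linear_independent_extend[OF B(2), of f] by blast
  interpret g: Vector_Spaces.linear "vscale V" "vscale V" g by fact
  have "x \<in> vcar V \<and> g x = f x" if "x \<in> span B" for x
    using that
  proof (induction rule: span_induct_alt)
    case base
    show ?case using linear_on_zero[OF f V V] g.zero vsD(1)[OF V] by simp
  next
    case (step c x y)
    moreover have "x \<in> vcar V"
      using step(1) span_base[of x B] by (simp flip: sB)
    ultimately show ?case
      by (simp add: g.add g.scale g(2) linear_onD[OF f] vsD[OF V])
  qed
  then have gf: "g x = f x" if "x \<in> span B" for x
    using that by blast
  have inj_g: "inj_on g (span B)"
    using inj gf unfolding sB by (simp add: inj_on_def)
  have ind: "independent (g ` B)"
    using g.independent_injective_image[OF B(2) inj_g] .
  have card: "card (g ` B) = card B"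
    using inj_g span_superset by (intro card_image) (rule inj_on_subset)
  have gB: "g ` B \<subseteq> span B"
    using linear_onD(1)[OF f] span_base gf unfolding sB[symmetric] by fastforce
  have "v \<in> span (g ` B)" if "v \<in> vcar V" for v
  proof (rule ccontr)
    assume v: "v \<notin> span (g ` B)"
    then have "independent (insert v (g ` B))"
      using ind by (rule independent_insertI)
    moreover have "insert v (g ` B) \<subseteq> span B" using gB that sB by simp
    ultimately have "card (insert v (g ` B)) \<le> card B"
      using independent_span_bound[OF fB] by blast
    moreover have "v \<notin> g ` B" using v span_base by blast
    ultimately show False using fB card by simp
  qed
  then have "vcar V \<subseteq> g ` vcar V"
    using g.span_image[of B] sB by auto
  moreover have "g ` vcar V = f ` vcar V"
    using gf sB by (intro image_cong) auto
  ultimately show ?thesis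
    using linear_onD(1)[OF f] by blast
qed

section \<open>Finite-dimensional Hopf algebras in coordinates\<close>

abbreviation lin :: "('k::field, 'v::ab_group_add, 'z) vspace_scheme \<Rightarrow> ('v \<Rightarrow> 'k) \<Rightarrow> bool" where
  "lin V \<equiv> linear_on V scalars"

definition trilinear_on ::
  "('k::field, 'v::ab_group_add, 'z) vspace_scheme \<Rightarrow> ('v \<Rightarrow> 'v \<Rightarrow> 'v \<Rightarrow> 'k) \<Rightarrow> bool" where
  "trilinear_on V F \<longleftrightarrow>
     (\<forall>x\<in>vcar V. bilinear_on V V scalars (F x)) \<and>
     (\<forall>y\<in>vcar V. \<forall>z\<in>vcar V. lin V (\<lambda>x. F x y z))"

lemma trilinear_onI:
  assumes "\<And>y z. y \<in> vcar V \<Longrightarrow> z \<in> vcar V \<Longrightarrow> lin V (\<lambda>x. F x y z)"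
    and "\<And>x z. x \<in> vcar V \<Longrightarrow> z \<in> vcar V \<Longrightarrow> lin V (\<lambda>y. F x y z)"
    and "\<And>x y. x \<in> vcar V \<Longrightarrow> y \<in> vcar V \<Longrightarrow> lin V (\<lambda>z. F x y z)"
  shows "trilinear_on V F"
  using assms by (simp add: trilinear_on_def bilinear_on_def)

lemma trilinear_onD:
  assumes "trilinear_on V F"
  shows "y \<in> vcar V \<Longrightarrow> z \<in> vcar V \<Longrightarrow> lin V (\<lambda>x. F x y z)"
    and "x \<in> vcar V \<Longrightarrow> z \<in> vcar V \<Longrightarrow> lin V (\<lambda>y. F x y z)"
    and "x \<in> vcar V \<Longrightarrow> y \<in> vcar V \<Longrightarrow> lin V (F x y)"
    and "x \<in> vcar V \<Longrightarrow> bilinear_on V V scalars (F x)"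
  using assms by (simp_all add: trilinear_on_def bilinear_on_def)

lemma lin_mult_right: "lin V f \<Longrightarrow> lin V (\<lambda>x. f x * c)"
  by (simp add: linear_on_def algebra_simps)

lemma lin_mult_left: "lin V f \<Longrightarrow> lin V (\<lambda>x. c * f x)"
  by (simp add: linear_on_def algebra_simps)

lemma lin_sum: "(\<And>i. i \<in> I \<Longrightarrow> lin V (f i)) \<Longrightarrow> lin V (\<lambda>x. \<Sum>i\<in>I. f i x)"
  by (simp add: linear_on_def sum.distrib sum_distrib_left)

text \<open>\<open>d c i j\<close> are the coordinates of \<open>\<Delta>(c)\<close>, so \<open>sw c E\<close> is \<open>\<Sum> E(c\<^sub>1, c\<^sub>2)\<close>
  for bilinear \<open>E\<close>. Written as a sum over coordinates it is linear in \<open>E\<close> and commutes with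
  other such sums without any side condition.\<close>

locale fd_comul =
  fixes V :: "('k::field, 'v::ab_group_add, 'z) vspace_scheme"
    and B :: "'v set" and e :: "'v \<Rightarrow> 'v \<Rightarrow> 'k" and d :: "'v \<Rightarrow> 'v \<Rightarrow> 'v \<Rightarrow> 'k"
  assumes vs: "is_vspace V"
    and frame: "coord_frame V B (\<lambda>i. i) e"
    and d_lin: "\<lbrakk>i \<in> B; j \<in> B\<rbrakk> \<Longrightarrow> lin V (\<lambda>c. d c i j)"
begin

definition sw :: "'v \<Rightarrow> ('v \<Rightarrow> 'v \<Rightarrow> 'k) \<Rightarrow> 'k" where
  "sw c E = (\<Sum>i\<in>B. \<Sum>j\<in>B. d c i j * E i j)"

lemma B_closed [simp]: "i \<in> B \<Longrightarrow> i \<in> vcar V"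
  using coord_frameD(2)[OF frame] .

lemma expand: "lin V f \<Longrightarrow> x \<in> vcar V \<Longrightarrow> f x = (\<Sum>i\<in>B. e i x * f i)"
  using coord_frame_linear[OF vs vs_scalars frame] by simp

lemma sw_cong:
  "(\<And>x y. x \<in> vcar V \<Longrightarrow> y \<in> vcar V \<Longrightarrow> E x y = E' x y) \<Longrightarrow> sw c E = sw c E'"
  unfolding sw_def by (intro sum.cong refl) simp

lemma sw_cong_arg:
  "c = c' \<Longrightarrow> (\<And>x y. x \<in> vcar V \<Longrightarrow> y \<in> vcar V \<Longrightarrow> E x y = E' x y) \<Longrightarrow> sw c E = sw c' E'"
  by (auto intro: sw_cong)

lemma sw_prod: "sw c E = (\<Sum>p\<in>B \<times> B. d c (fst p) (snd p) * E (fst p) (snd p))"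
  by (simp add: sw_def sum.cartesian_product case_prod_unfold)

lemma sw_swap: "sw a (\<lambda>x y. sw b (F x y)) = sw b (\<lambda>u v. sw a (\<lambda>x y. F x y u v))"
  unfolding sw_prod sum_distrib_left
  by (subst sum.swap) (simp add: mult.left_commute)

lemma sw_sum: "sw c (\<lambda>x y. \<Sum>i\<in>I. E i x y) = (\<Sum>i\<in>I. sw c (E i))"
  unfolding sw_prod sum_distrib_left by (subst sum.swap) simp

lemma sw_mult_left: "sw c (\<lambda>x y. k * E x y) = k * sw c E"
  by (simp add: sw_def sum_distrib_left mult.left_commute)

lemma sw_mult_right: "sw c (\<lambda>x y. E x y * k) = sw c E * k"
  by (simp add: sw_def sum_distrib_right mult.assoc)

lemma sw_zero [simp]: "sw c (\<lambda>x y. 0) = 0"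
  by (simp add: sw_def)

lemma lin_comp: "lin V f \<Longrightarrow> linear_on V V g \<Longrightarrow> lin V (\<lambda>x. f (g x))"
  by (rule linear_on_comp)

lemma lin_sw_arg: "linear_on V V g \<Longrightarrow> lin V (\<lambda>x. sw (g x) E)"
  unfolding sw_def by (intro lin_sum lin_mult_right lin_comp[OF d_lin])

lemma lin_sw_body:
  "(\<And>i j. i \<in> vcar V \<Longrightarrow> j \<in> vcar V \<Longrightarrow> lin X (\<lambda>x. F x i j)) \<Longrightarrow> lin X (\<lambda>x. sw c (F x))"
  unfolding sw_def by (intro lin_sum lin_mult_left) auto

lemma lin_e: "i \<in> B \<Longrightarrow> linear_on V V g \<Longrightarrow> lin V (\<lambda>x. e i (g x))"
  using coord_frameD(4)[OF frame] by (rule lin_comp)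

lemmas lin_intros = lin_mult_left lin_mult_right lin_sw_arg lin_sw_body lin_e linear_on_id
  bilinear_onI trilinear_onI

end

text \<open>The axioms that involve \<Delta> are paired with forms, which keeps all Sweedler sums
  scalar. \<open>d_sw\<close> makes the coefficients consistent with the frame:
  \<open>d c i j\<close> is the value of \<Delta>(c) on the product of two coordinate forms. The
  trace formula \<open>trace_sw\<close> rests on this.\<close>

locale fd_hopf = fd_comul V B e d
  for V :: "('k::field, 'v::ab_group_add, 'z) vspace_scheme"
    and B :: "'v set" and e :: "'v \<Rightarrow> 'v \<Rightarrow> 'k" and d :: "'v \<Rightarrow> 'v \<Rightarrow> 'v \<Rightarrow> 'k" +
  fixes M :: "'v \<Rightarrow> 'v \<Rightarrow> 'v" (infixl "\<star>" 70)
    and one :: 'v and eps :: "'v \<Rightarrow> 'k" and S :: "'v \<Rightarrow> 'v"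
  assumes M_bil: "bilinear_on V V V (\<star>)"
    and one_closed [simp]: "one \<in> vcar V"
    and S_lin: "linear_on V V S"
    and eps_lin: "lin V eps"
    and M_assoc: "\<lbrakk>a \<in> vcar V; b \<in> vcar V; c \<in> vcar V\<rbrakk> \<Longrightarrow> a \<star> b \<star> c = a \<star> (b \<star> c)"
    and M_one [simp]: "a \<in> vcar V \<Longrightarrow> one \<star> a = a" "a \<in> vcar V \<Longrightarrow> a \<star> one = a"
    and eps_one [simp]: "eps one = 1"
    and eps_M [simp]: "\<lbrakk>a \<in> vcar V; b \<in> vcar V\<rbrakk> \<Longrightarrow> eps (a \<star> b) = eps a * eps b"
    and d_sw: "\<lbrakk>c \<in> vcar V; i \<in> B; j \<in> B\<rbrakk> \<Longrightarrow> d c i j = sw c (\<lambda>u v. e i u * e j v)"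
    and coassoc: "\<lbrakk>c \<in> vcar V; trilinear_on V F\<rbrakk> \<Longrightarrow>
      sw c (\<lambda>x y. sw x (\<lambda>u v. F u v y)) = sw c (\<lambda>x y. sw y (\<lambda>u v. F x u v))"
    and counit_left: "\<lbrakk>c \<in> vcar V; lin V f\<rbrakk> \<Longrightarrow> sw c (\<lambda>x y. eps x * f y) = f c"
    and counit_right: "\<lbrakk>c \<in> vcar V; lin V f\<rbrakk> \<Longrightarrow> sw c (\<lambda>x y. eps y * f x) = f c"
    and comul_one: "bilinear_on V V scalars E \<Longrightarrow> sw one E = E one one"
    and comul_M: "\<lbrakk>a \<in> vcar V; b \<in> vcar V; bilinear_on V V scalars E\<rbrakk> \<Longrightarrow>
      sw (a \<star> b) E = sw a (\<lambda>a1 a2. sw b (\<lambda>b1 b2. E (a1 \<star> b1) (a2 \<star> b2)))"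
    and S_left: "\<lbrakk>a \<in> vcar V; lin V f\<rbrakk> \<Longrightarrow> sw a (\<lambda>x y. f (S x \<star> y)) = eps a * f one"
    and S_right: "\<lbrakk>a \<in> vcar V; lin V f\<rbrakk> \<Longrightarrow> sw a (\<lambda>x y. f (x \<star> S y)) = eps a * f one"
begin

lemma M_closed [simp]: "a \<in> vcar V \<Longrightarrow> b \<in> vcar V \<Longrightarrow> a \<star> b \<in> vcar V"
  using bilinear_onD(3)[OF M_bil] .

lemma S_closed [simp]: "a \<in> vcar V \<Longrightarrow> S a \<in> vcar V"
  using linear_onD(1)[OF S_lin] .

lemma lin_M_left: "a \<in> vcar V \<Longrightarrow> linear_on V V g \<Longrightarrow> linear_on V V (\<lambda>x. g x \<star> a)"
  using linear_on_comp[OF bilinear_onD(2)[OF M_bil]] .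

lemma lin_M_right: "a \<in> vcar V \<Longrightarrow> linear_on V V g \<Longrightarrow> linear_on V V (\<lambda>x. a \<star> g x)"
  using linear_on_comp[OF bilinear_onD(1)[OF M_bil]] .

lemma lin_S: "linear_on V V g \<Longrightarrow> linear_on V V (\<lambda>x. S (g x))"
  using linear_on_comp[OF S_lin] .

lemma lin_eps: "linear_on V V g \<Longrightarrow> lin V (\<lambda>x. eps (g x))"
  using linear_on_comp[OF eps_lin] .

lemmas hopf_lin_intros = lin_intros lin_M_left lin_M_right lin_S lin_eps

lemma eps_S [simp]: "a \<in> vcar V \<Longrightarrow> eps (S a) = eps a"
proof -
  assume a: "a \<in> vcar V"
  have "eps a = sw a (\<lambda>x y. eps (S x \<star> y))"
    using S_left[OF a eps_lin] by simp
  also have "\<dots> = sw a (\<lambda>x y. eps y * eps (S x))"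
    by (rule sw_cong) (simp add: mult.commute)
  also have "\<dots> = eps (S a)"
    by (rule counit_right[OF a]) (auto intro!: hopf_lin_intros)
  finally show ?thesis by simp
qed

text \<open>Uniqueness of convolution inverses: \<Delta> composed with S is a left inverse of
  \<Delta>, and the flipped version is a right inverse. Concretely, \<Delta>(S h1) \<Delta>(h2) (S
  h4 \<otimes> S h3) is collapsed from either end.\<close>

lemma S_comul:
  assumes h: "h \<in> vcar V" and E: "bilinear_on V V scalars E"
  shows "sw (S h) E = sw h (\<lambda>x y. E (S y) (S x))"
proof -
  note li = hopf_lin_intros lin_bilinear_left[OF E] lin_bilinear_right[OF E]
  \<comment> \<open>The right end: w1 S(w4) \<otimes> w2 S(w3) = \<epsilon>(w) 1 \<otimes> 1.
    Coassociativity first brings the inner pair w2, w3 together, and once it is gone the outer pair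
    cancels. The factors \<open>p\<close> and \<open>q\<close> leave room for \<Delta>(S h1) in
    front.\<close>
  have K: "sw w (\<lambda>a b. sw a (\<lambda>a1 a2. sw b (\<lambda>b1 b2.
      E (p \<star> (a1 \<star> S b2)) (q \<star> (a2 \<star> S b1))))) = eps w * E p q"
    if [simp]: "p \<in> vcar V" "q \<in> vcar V" "w \<in> vcar V" for p q w
  proof -
    have "sw w (\<lambda>a b. sw a (\<lambda>a1 a2. sw b (\<lambda>b1 b2.
        E (p \<star> (a1 \<star> S b2)) (q \<star> (a2 \<star> S b1)))))
      = sw w (\<lambda>a1 y. sw y (\<lambda>a2 b. sw b (\<lambda>b1 b2.
        E (p \<star> (a1 \<star> S b2)) (q \<star> (a2 \<star> S b1)))))"
      by (rule coassoc) (auto intro!: li)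
    also have "\<dots> = sw w (\<lambda>a1 y. sw y (\<lambda>z b2. sw z (\<lambda>a2 b1.
        E (p \<star> (a1 \<star> S b2)) (q \<star> (a2 \<star> S b1)))))"
      by (intro sw_cong coassoc[symmetric]) (auto intro!: li)
    also have "\<dots> = sw w (\<lambda>a1 y. sw y (\<lambda>z b2. eps z * E (p \<star> (a1 \<star> S b2)) (q \<star> one)))"
      by (intro sw_cong S_right) (auto intro!: li)
    also have "\<dots> = sw w (\<lambda>a1 y. E (p \<star> (a1 \<star> S y)) (q \<star> one))"
      by (intro sw_cong counit_left) (auto intro!: li)
    also have "\<dots> = eps w * E (p \<star> one) (q \<star> one)"
      by (rule S_right) (auto intro!: li)
    finally show ?thesis by simp
  qed
  have "sw (S h) E = sw h (\<lambda>x w. eps w * sw (S x) E)"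
    by (rule counit_right[symmetric]) (auto intro!: li h)
  also have "\<dots> = sw h (\<lambda>x w. sw (S x) (\<lambda>p q. eps w * E p q))"
    by (simp add: sw_mult_left)
  also have "\<dots> = sw h (\<lambda>x w. sw (S x) (\<lambda>p q. sw w (\<lambda>a b. sw a (\<lambda>a1 a2. sw b (\<lambda>b1 b2.
      E (p \<star> (a1 \<star> S b2)) (q \<star> (a2 \<star> S b1)))))))"
    by (intro sw_cong K[symmetric])
  also have "\<dots> = sw h (\<lambda>x w. sw w (\<lambda>a b. sw (S x) (\<lambda>p q. sw a (\<lambda>a1 a2. sw b (\<lambda>b1 b2.
      E (p \<star> (a1 \<star> S b2)) (q \<star> (a2 \<star> S b1)))))))"
    by (subst sw_swap) simp
  also have "\<dots> = sw h (\<lambda>x w. sw w (\<lambda>a b. sw (S x) (\<lambda>p q. sw a (\<lambda>a1 a2. sw b (\<lambda>b1 b2.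
      E (p \<star> a1 \<star> S b2) (q \<star> a2 \<star> S b1))))))"
    by (intro sw_cong) (simp add: M_assoc)
  also have "\<dots> = sw h (\<lambda>x w. sw w (\<lambda>a b. sw (S x \<star> a) (\<lambda>u v. sw b (\<lambda>b1 b2.
      E (u \<star> S b2) (v \<star> S b1)))))"
    by (intro sw_cong comul_M[symmetric]) (auto intro!: li)
  \<comment> \<open>Now the left end: since \<Delta> is multiplicative, S(x) and \<open>a\<close>
    occur only through their product, which becomes a scalar once they are legs of the same element
    z.\<close>
  also have "\<dots> = sw h (\<lambda>z b. sw z (\<lambda>x a. sw (S x \<star> a) (\<lambda>u v. sw b (\<lambda>b1 b2.
      E (u \<star> S b2) (v \<star> S b1)))))"
    by (rule coassoc[symmetric]) (auto intro!: li h)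
  also have "\<dots> = sw h (\<lambda>z b. eps z * sw one (\<lambda>u v. sw b (\<lambda>b1 b2.
      E (u \<star> S b2) (v \<star> S b1))))"
    by (intro sw_cong S_left) (auto intro!: li)
  also have "\<dots> = sw one (\<lambda>u v. sw h (\<lambda>b1 b2. E (u \<star> S b2) (v \<star> S b1)))"
    by (intro counit_left) (auto intro!: li h)
  also have "\<dots> = sw h (\<lambda>b1 b2. E (one \<star> S b2) (one \<star> S b1))"
    by (rule comul_one) (auto intro!: li)
  also have "\<dots> = sw h (\<lambda>x y. E (S y) (S x))"
    by (rule sw_cong) simp
  finally show ?thesis .
qed

end

subsection \<open>Integrals and bijectivity of the antipode\<close>

context fd_hopf begin

text \<open>A left integral of the dual algebra: the convolution of f with l is f(1) l, and
  evaluation at 1 is the counit of the dual.\<close>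

definition integral :: "('v \<Rightarrow> 'k) \<Rightarrow> bool" where
  "integral l \<longleftrightarrow> lin V l \<and>
     (\<forall>f x. lin V f \<longrightarrow> x \<in> vcar V \<longrightarrow> sw x (\<lambda>x1 x2. f x1 * l x2) = f one * l x)"

text \<open>The dual of \<open>V\<close> is a Hopf module for \<open>(f \<cdot> h)(x) = f (x \<star> S h)\<close>; this is its compatibility
  condition.\<close>

lemma hopf_module:
  assumes [simp]: "x \<in> vcar V" "h \<in> vcar V" and f: "lin V f" and l: "lin V l"
  shows "sw x (\<lambda>x1 x2. f x1 * l (x2 \<star> S h)) =
    sw h (\<lambda>h1 h2. sw (x \<star> S h1) (\<lambda>y1 y2. f (y1 \<star> h2) * l y2))"
proof -
  note li = hopf_lin_intros lin_comp[OF f] lin_comp[OF l]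
  have "sw h (\<lambda>h1 h2. sw (x \<star> S h1) (\<lambda>y1 y2. f (y1 \<star> h2) * l y2))
    = sw h (\<lambda>h1 h2. sw x (\<lambda>x1 x2. sw (S h1) (\<lambda>u v. f (x1 \<star> u \<star> h2) * l (x2 \<star> v))))"
    by (intro sw_cong comul_M) (auto intro!: li)
  \<comment> \<open>S reverses \<Delta>, so under \<open>f\<close> there stands S of the second leg
    of \<open>h1\<close>, the neighbour of \<open>h2\<close>. The two cancel after
    coassociativity.\<close>
  also have "\<dots> = sw h (\<lambda>h1 h2. sw x (\<lambda>x1 x2. sw h1 (\<lambda>u v. f (x1 \<star> S v \<star> h2) * l (x2 \<star> S u))))"
    by (intro sw_cong S_comul) (auto intro!: li)
  also have "\<dots> = sw x (\<lambda>x1 x2. sw h (\<lambda>h1 h2. sw h1 (\<lambda>u v. f (x1 \<star> S v \<star> h2) * l (x2 \<star> S u))))"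
    by (rule sw_swap)
  also have "\<dots> = sw x (\<lambda>x1 x2. sw h (\<lambda>u w. sw w (\<lambda>v h2. f (x1 \<star> S v \<star> h2) * l (x2 \<star> S u))))"
    by (intro sw_cong coassoc) (auto intro!: li)
  also have "\<dots> = sw x (\<lambda>x1 x2. sw h (\<lambda>u w. sw w (\<lambda>v h2. f (x1 \<star> (S v \<star> h2)) * l (x2 \<star> S u))))"
    by (intro sw_cong) (simp add: M_assoc)
  also have "\<dots> = sw x (\<lambda>x1 x2. sw h (\<lambda>u w. eps w * (f (x1 \<star> one) * l (x2 \<star> S u))))"
    by (intro sw_cong S_left) (auto intro!: li)
  also have "\<dots> = sw x (\<lambda>x1 x2. f (x1 \<star> one) * l (x2 \<star> S h))"
    by (intro sw_cong counit_right) (auto intro!: li)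
  also have "\<dots> = sw x (\<lambda>x1 x2. f x1 * l (x2 \<star> S h))"
    by (intro sw_cong) simp
  finally show ?thesis by simp
qed

text \<open>The coaction on the dual sends \<open>f\<close> to \<open>\<Sum>\<^sub>i (e\<^sub>i * f) \<otimes> i\<close>; this is its coassociativity,
  both sides being traces over the coordinates.\<close>

lemma trace_sw:
  assumes G: "\<And>p q g g'. \<lbrakk>p \<in> B; q \<in> B; \<And>x. x \<in> vcar V \<Longrightarrow> g x = g' x\<rbrakk> \<Longrightarrow> G p q g = G p q g'"
    and Gsum: "\<And>p q c. \<lbrakk>p \<in> B; q \<in> B\<rbrakk> \<Longrightarrow> G p q (\<lambda>y. \<Sum>i\<in>B. c i * e i y) = (\<Sum>i\<in>B. c i * G p q (e i))"
  shows "(\<Sum>i\<in>B. sw i (\<lambda>p q. G p q (e i))) =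
    (\<Sum>p\<in>B. \<Sum>q\<in>B. G p q (\<lambda>y. sw y (\<lambda>u v. e p u * e q v)))"
proof -
  have "(\<Sum>i\<in>B. sw i (\<lambda>p q. G p q (e i))) = (\<Sum>p\<in>B. \<Sum>i\<in>B. \<Sum>q\<in>B. d i p q * G p q (e i))"
    unfolding sw_def by (rule sum.swap)
  also have "\<dots> = (\<Sum>p\<in>B. \<Sum>q\<in>B. \<Sum>i\<in>B. d i p q * G p q (e i))"
    by (intro sum.cong refl sum.swap)
  also have "\<dots> = (\<Sum>p\<in>B. \<Sum>q\<in>B. G p q (\<lambda>y. sw y (\<lambda>u v. e p u * e q v)))"
  proof (intro sum.cong refl)
    fix p q assume pq: "p \<in> B" "q \<in> B"
    \<comment> \<open>The form sending y to \<open>d y p q\<close> has the coordinates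
      \<open>d i p q\<close>; by linearity of \<open>G\<close> in its last slot the sum over i
      collapses.\<close>
    have "(\<Sum>i\<in>B. d i p q * e i y) = sw y (\<lambda>u v. e p u * e q v)" if "y \<in> vcar V" for y
      using expand[OF d_lin[OF pq] that] d_sw[OF that pq] by (simp add: mult.commute)
    then have "G p q (\<lambda>y. \<Sum>i\<in>B. d i p q * e i y) = G p q (\<lambda>y. sw y (\<lambda>u v. e p u * e q v))"
      by (rule G[OF pq])
    then show "(\<Sum>i\<in>B. d i p q * G p q (e i)) = G p q (\<lambda>y. sw y (\<lambda>u v. e p u * e q v))"
      by (simp add: Gsum[OF pq])
  qed
  finally show ?thesis .
qed

text \<open>The projection \<open>f \<mapsto> f\<^sub>0 \<cdot> S f\<^sub>1\<close> of a Hopf module onto its coinvariants, here the integrals.\<close>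

definition proj_integral :: "('v \<Rightarrow> 'k) \<Rightarrow> 'v \<Rightarrow> 'k" where
  "proj_integral f x = (\<Sum>i\<in>B. sw (x \<star> S (S i)) (\<lambda>y1 y2. e i y1 * f y2))"

text \<open>Coinvariance of the projection. With h = S i, \<open>hopf_module\<close> pulls the
  convolution with g inside, and coassociativity of the coaction splits i into p and q. The sum over
  p then replaces S p by S u for a leg u adjacent to z1, so that z1 S(u) cancels and only g(1) is
  left of g.\<close>

lemma proj_integral:
  assumes f: "lin V f"
  shows "integral (proj_integral f)"
  unfolding integral_def
proof (intro conjI allI impI)
  note li = hopf_lin_intros lin_comp[OF f] lin_sum
  show "lin V (proj_integral f)"
    unfolding proj_integral_def by (auto intro!: li)
  fix g x assume g: "lin V g" and x [simp]: "x \<in> vcar V"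
  note li = li lin_comp[OF g]
  \<comment> \<open>The form is left as a free argument, because \<open>trace_sw\<close> replaces
    the coordinate form \<open>e i\<close> by the convolution of \<open>e p\<close> and
    \<open>e q\<close>.\<close>
  define G where "G p q \<phi> = sw (x \<star> S (S q)) (\<lambda>z1 z2. g (z1 \<star> S p) * sw z2 (\<lambda>y1 y2. \<phi> y1 * f y2))"
    for p q \<phi>
  have "sw x (\<lambda>x1 x2. g x1 * proj_integral f x2) =
      (\<Sum>i\<in>B. sw x (\<lambda>x1 x2. g x1 * sw (x2 \<star> S (S i)) (\<lambda>y1 y2. e i y1 * f y2)))"
    by (simp add: proj_integral_def sum_distrib_left sw_sum)
  also have "\<dots> = (\<Sum>i\<in>B. sw (S i) (\<lambda>h1 h2. sw (x \<star> S h1) (\<lambda>z1 z2. g (z1 \<star> h2) *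
      sw z2 (\<lambda>y1 y2. e i y1 * f y2))))"
    by (intro sum.cong refl hopf_module) (auto intro!: li)
  also have "\<dots> = (\<Sum>i\<in>B. sw i (\<lambda>p q. G p q (e i)))"
    unfolding G_def by (intro sum.cong refl S_comul) (auto intro!: li)
  also have "\<dots> = (\<Sum>p\<in>B. \<Sum>q\<in>B. G p q (\<lambda>y. sw y (\<lambda>u v. e p u * e q v)))"
  proof (rule trace_sw)
    show "G p q \<phi> = G p q \<phi>'" if "\<And>x. x \<in> vcar V \<Longrightarrow> \<phi> x = \<phi>' x" for p q \<phi> \<phi>'
      unfolding G_def by (intro sw_cong arg_cong2[where f="(*)"] refl that)
    show "G p q (\<lambda>y. \<Sum>i\<in>B. c i * e i y) = (\<Sum>i\<in>B. c i * G p q (e i))" for p q c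
      by (simp add: G_def sum_distrib_left sum_distrib_right sw_sum sw_mult_left[symmetric] mult_ac)
  qed
  also have "\<dots> = (\<Sum>p\<in>B. \<Sum>q\<in>B. sw (x \<star> S (S q)) (\<lambda>z1 z2. g (z1 \<star> S p) *
      sw z2 (\<lambda>u w. e p u * sw w (\<lambda>v y. e q v * f y))))"
  proof -
    have "sw z (\<lambda>y1 y2. sw y1 (\<lambda>u v. e p u * e q v) * f y2) =
        sw z (\<lambda>u w. e p u * sw w (\<lambda>v y. e q v * f y))"
      if [simp]: "p \<in> B" "q \<in> B" "z \<in> vcar V" for p q z
    proof -
      have "sw z (\<lambda>y1 y2. sw y1 (\<lambda>u v. e p u * e q v) * f y2)
          = sw z (\<lambda>y1 y2. sw y1 (\<lambda>u v. e p u * (e q v * f y2)))"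
        by (simp add: sw_mult_right[symmetric] mult.assoc)
      also have "\<dots> = sw z (\<lambda>u w. sw w (\<lambda>v y. e p u * (e q v * f y)))"
        by (rule coassoc) (auto intro!: li)
      finally show ?thesis
        by (simp add: sw_mult_left)
    qed
    then show ?thesis
      by (simp add: G_def cong: sw_cong sum.cong)
  qed
  also have "\<dots> = (\<Sum>q\<in>B. \<Sum>p\<in>B. sw (x \<star> S (S q)) (\<lambda>z1 z2. g (z1 \<star> S p) *
      sw z2 (\<lambda>u w. e p u * sw w (\<lambda>v y. e q v * f y))))"
    by (rule sum.swap)
  also have "\<dots> = (\<Sum>q\<in>B. sw (x \<star> S (S q)) (\<lambda>z1 z2.
      sw z2 (\<lambda>u w. (\<Sum>p\<in>B. e p u * g (z1 \<star> S p)) * sw w (\<lambda>v y. e q v * f y))))"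
    by (simp add: sum_distrib_left sum_distrib_right sw_sum sw_mult_left[symmetric] mult_ac)
  \<comment> \<open>Completeness of the frame: the sum over p puts u in place of p in the linear
    form g(z1 S p).\<close>
  also have "\<dots> = (\<Sum>q\<in>B. sw (x \<star> S (S q)) (\<lambda>z1 z2.
      sw z2 (\<lambda>u w. g (z1 \<star> S u) * sw w (\<lambda>v y. e q v * f y))))"
    by (intro sum.cong refl sw_cong arg_cong2[where f="(*)"] expand[symmetric]) (auto intro!: li)
  also have "\<dots> = (\<Sum>q\<in>B. sw (x \<star> S (S q)) (\<lambda>z w. sw z (\<lambda>z1 u.
      g (z1 \<star> S u) * sw w (\<lambda>v y. e q v * f y))))"
    by (intro sum.cong refl coassoc[symmetric]) (auto intro!: li)
  also have "\<dots> = (\<Sum>q\<in>B. sw (x \<star> S (S q)) (\<lambda>z w.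
      eps z * (g one * sw w (\<lambda>v y. e q v * f y))))"
    by (intro sum.cong refl sw_cong S_right) (auto intro!: li)
  also have "\<dots> = (\<Sum>q\<in>B. g one * sw (x \<star> S (S q)) (\<lambda>v y. e q v * f y))"
    by (intro sum.cong refl counit_left) (auto intro!: li)
  also have "\<dots> = g one * proj_integral f x"
    by (simp add: proj_integral_def sum_distrib_left)
  finally show "sw x (\<lambda>x1 x2. g x1 * proj_integral f x2) = g one * proj_integral f x" .
qed

text \<open>The half of the structure theorem for Hopf modules that recovers f as P(f_0) acted on by
  f_1, with P the projection onto the integrals. The factors S i and S(S j) are the two legs u and S
  v obtained from \<Delta>(S b), so their product cancels; what remains is the counit axiom.\<close>

lemma reconstruct:
  assumes f: "lin V f" and x [simp]: "x \<in> vcar V"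
  shows "f x = (\<Sum>i\<in>B. proj_integral (\<lambda>z. sw z (\<lambda>u v. e i u * f v)) (x \<star> S i))"
proof -
  note li = hopf_lin_intros lin_comp[OF f] lin_sum
  define G where "G j i \<phi> = sw (x \<star> (S i \<star> S (S j))) (\<lambda>y w. \<phi> y * f w)" for i j \<phi>
  have "(\<Sum>i\<in>B. proj_integral (\<lambda>z. sw z (\<lambda>u v. e i u * f v)) (x \<star> S i))
    = (\<Sum>i\<in>B. \<Sum>j\<in>B. sw (x \<star> (S i \<star> S (S j))) (\<lambda>y1 y2. sw y2 (\<lambda>u v. e j y1 * (e i u * f v))))"
    unfolding proj_integral_def by (simp add: M_assoc sw_mult_left)
  also have "\<dots> = (\<Sum>i\<in>B. \<Sum>j\<in>B. sw (x \<star> (S i \<star> S (S j)))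
      (\<lambda>y w. sw y (\<lambda>y1 u. e j y1 * (e i u * f w))))"
    by (intro sum.cong refl coassoc[symmetric]) (auto intro!: li)
  also have "\<dots> = (\<Sum>i\<in>B. \<Sum>j\<in>B. G j i (\<lambda>y. sw y (\<lambda>y1 u. e j y1 * e i u)))"
    unfolding G_def by (simp add: sw_mult_right[symmetric] mult.assoc)
  also have "\<dots> = (\<Sum>j\<in>B. \<Sum>i\<in>B. G j i (\<lambda>y. sw y (\<lambda>y1 u. e j y1 * e i u)))"
    by (rule sum.swap)
  also have "\<dots> = (\<Sum>b\<in>B. sw b (\<lambda>j i. G j i (e b)))"
  proof (rule trace_sw[symmetric])
    show "G p q \<phi> = G p q \<phi>'" if "\<And>x. x \<in> vcar V \<Longrightarrow> \<phi> x = \<phi>' x" for p q \<phi> \<phi>'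
      unfolding G_def by (intro sw_cong arg_cong2[where f="(*)"] refl that)
    show "G p q (\<lambda>y. \<Sum>i\<in>B. c i * e i y) = (\<Sum>i\<in>B. c i * G p q (e i))" for p q c
      by (simp add: G_def sum_distrib_left sum_distrib_right sw_sum sw_mult_left[symmetric] mult_ac)
  qed
  also have "\<dots> = (\<Sum>b\<in>B. sw (S b) (\<lambda>u v. sw (x \<star> (u \<star> S v)) (\<lambda>y w. e b y * f w)))"
    unfolding G_def by (intro sum.cong refl S_comul[symmetric]) (auto intro!: li)
  also have "\<dots> = (\<Sum>b\<in>B. eps (S b) * sw (x \<star> one) (\<lambda>y w. e b y * f w))"
    by (intro sum.cong refl S_right) (auto intro!: li)
  also have "\<dots> = sw x (\<lambda>y w. (\<Sum>b\<in>B. e b y * eps b) * f w)"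
    by (simp add: sum_distrib_left sum_distrib_right sw_sum sw_mult_left[symmetric] mult_ac)
  also have "\<dots> = sw x (\<lambda>y w. eps y * f w)"
    by (intro sw_cong arg_cong2[where f="(*)"] refl expand[symmetric] eps_lin)
  also have "\<dots> = f x"
    by (rule counit_left) (auto intro!: f)
  finally show ?thesis by simp
qed

text \<open>If all integrals vanished on the carrier, every term in the reconstruction of \<epsilon>
  would be zero, against \<epsilon>(1) = 1.\<close>

lemma integral_nonzero:
  obtains l y where "integral l" "y \<in> vcar V" "l y \<noteq> 0"
proof -
  have "\<exists>l y. integral l \<and> y \<in> vcar V \<and> l y \<noteq> 0"
  proof (rule ccontr)
    assume "\<not> ?thesis"
    then have *: "l y = 0" if "integral l" "y \<in> vcar V" for l y
      using that by blast
    have "(\<Sum>i\<in>B. proj_integral (\<lambda>z. sw z (\<lambda>u v. e i u * eps v)) (one \<star> S i)) = 0"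
      by (intro sum.neutral ballI *[OF proj_integral]) (auto intro!: hopf_lin_intros)
    then have "eps one = 0"
      using reconstruct[OF eps_lin one_closed] by simp
    then show False by simp
  qed
  then show ?thesis using that by blast
qed

lemma frame_zeroI:
  assumes "x \<in> vcar V" "\<And>f. lin V f \<Longrightarrow> f x = 0"
  shows "x = 0"
proof -
  have "(\<Sum>i\<in>B. vscale V (e i x) i) = (\<Sum>i\<in>B. 0)"
    by (intro sum.cong refl)
       (simp add: assms(2)[OF coord_frameD(4)[OF frame]] vsD[OF vs])
  then show ?thesis
    using coord_frameD(5)[OF frame assms(1)] by simp
qed

text \<open>If \<open>S h = 0\<close>, then \<open>hopf_module\<close> for a nonzero integral \<open>l\<close> gives \<open>l(x S h\<^sub>1) h\<^sub>2 = 0\<close> for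
  all \<open>x\<close>; replacing \<open>x\<close> by \<open>y S\<^sup>2 h\<^sub>2\<close> turns this into \<open>l(y) h = 0\<close>.\<close>

lemma S_kernel:
  assumes h [simp]: "h \<in> vcar V" and "S h = 0"
  shows "h = 0"
proof -
  obtain l y where l: "integral l" and y [simp]: "y \<in> vcar V" and ly: "l y \<noteq> 0"
    using integral_nonzero .
  have ll: "lin V l" using l by (simp add: integral_def)
  have int: "sw x (\<lambda>x1 x2. f x1 * l x2) = f one * l x" if "lin V f" "x \<in> vcar V" for f x
    using l that by (simp add: integral_def)
  note li = hopf_lin_intros lin_comp[OF ll]
  have zero: "sw h (\<lambda>h1 h2. l (x \<star> S h1) * f h2) = 0" if f: "lin V f" and x [simp]: "x \<in> vcar V" for f x
  proof -
    note li = li lin_comp[OF f]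
    have l0: "l 0 = 0"
      by (rule linear_on_zero[OF ll vs vs_scalars])
    have M0: "z \<star> 0 = 0" if "z \<in> vcar V" for z
      by (rule linear_on_zero[OF bilinear_onD(1)[OF M_bil that] vs vs])
    have "sw x (\<lambda>x1 x2. f x1 * l (x2 \<star> S h)) = sw x (\<lambda>x1 x2. 0)"
      by (intro sw_cong) (simp add: assms(2) M0 l0)
    then have "0 = sw h (\<lambda>h1 h2. sw (x \<star> S h1) (\<lambda>y1 y2. f (y1 \<star> h2) * l y2))"
      using hopf_module[OF x h f ll] by simp
    also have "\<dots> = sw h (\<lambda>h1 h2. f (one \<star> h2) * l (x \<star> S h1))"
      by (intro sw_cong int) (auto intro!: li)
    also have "\<dots> = sw h (\<lambda>h1 h2. l (x \<star> S h1) * f h2)"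
      by (intro sw_cong) (simp add: mult.commute)
    finally show ?thesis by simp
  qed
  have "f h = 0" if f: "lin V f" for f
  proof -
    note li = li lin_comp[OF f]
    have "l y * f h = sw h (\<lambda>u z. eps u * (l y * f z))"
      by (rule counit_left[symmetric]) (auto intro!: li)
    also have "\<dots> = sw h (\<lambda>u z. eps (S u) * (l (y \<star> one) * f z))"
      by (intro sw_cong) simp
    also have "\<dots> = sw h (\<lambda>u z. sw (S u) (\<lambda>a b. l (y \<star> (S a \<star> b)) * f z))"
      by (intro sw_cong S_left[symmetric]) (auto intro!: li)
    also have "\<dots> = sw h (\<lambda>u z. sw u (\<lambda>a b. l (y \<star> (S (S b) \<star> S a)) * f z))"
      by (intro sw_cong S_comul) (auto intro!: li)
    also have "\<dots> = sw h (\<lambda>a w. sw w (\<lambda>b z. l (y \<star> (S (S b) \<star> S a)) * f z))"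
      by (rule coassoc) (auto intro!: li)
    \<comment> \<open>Expanding in \<open>b\<close> frees S(S b) from the Sweedler variables. For
      each j the fact \<open>zero\<close> then applies at the fixed vector y S(S j), with the form
      that sends w to the sum of e_j(b) f(z) over \<Delta>(w).\<close>
    also have "\<dots> = sw h (\<lambda>a w. sw w (\<lambda>b z. (\<Sum>j\<in>B. e j b * l (y \<star> (S (S j) \<star> S a))) * f z))"
      by (intro sw_cong arg_cong2[where f="(*)"] refl expand) (auto intro!: li)
    also have "\<dots> = (\<Sum>j\<in>B. sw h (\<lambda>a w. l (y \<star> S (S j) \<star> S a) * sw w (\<lambda>b z. e j b * f z)))"
      unfolding sw_sum[symmetric]
      by (intro sw_cong)
        (simp add: sum_distrib_left sum_distrib_right sw_sum sw_mult_left[symmetric] mult_ac M_assoc)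
    also have "\<dots> = 0"
      by (intro sum.neutral ballI zero) (auto intro!: li)
    finally show ?thesis using ly by simp
  qed
  then show ?thesis by (rule frame_zeroI[OF h])
qed

lemma S_inj: "inj_on S (vcar V)"
proof (rule inj_onI)
  fix x y assume x: "x \<in> vcar V" and y: "y \<in> vcar V" and eq: "S x = S y"
  have y': "vscale V (-1) y \<in> vcar V" using y by (rule vsD[OF vs])
  have neg: "z + vscale V (-1) z = 0" for z
    using vsD(5)[OF vs, of 1 "-1" z] vsD(7,9)[OF vs, of z] by simp
  have "S (x + vscale V (-1) y) = 0"
    using x y y' by (simp add: linear_onD[OF S_lin] eq neg)
  then have "x + vscale V (-1) y = 0"
    using x y' by (auto intro: S_kernel vsD(2)[OF vs])
  then show "x = y" using neg[of y] by (metis add_right_cancel)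
qed

lemma S_surj: "S ` vcar V = vcar V"
proof (rule injective_imp_surjective_on[OF vs _ S_lin S_inj])
  interpret vector_space "vscale V" using vs by (simp add: is_vspace_def)
  have "module.span (vscale V) B = vcar V"
  proof
    show "span B \<subseteq> vcar V"
      using vs by (intro span_minimal) (auto simp: is_vspace_def)
    show "vcar V \<subseteq> span B"
    proof
      fix x assume "x \<in> vcar V"
      from coord_frameD(5)[OF frame this] show "x \<in> span B"
        by (metis (no_types, lifting) span_sum span_scale span_base)
    qed
  qed
  then show "fin_dim V"
    using coord_frameD(1)[OF frame] by (auto simp: fin_dim_def)
qed

definition T :: "'v \<Rightarrow> 'v" where "T = inv_into (vcar V) S"

lemma T_closed [simp]: "x \<in> vcar V \<Longrightarrow> T x \<in> vcar V"
  unfolding T_def using S_surj by (metis inv_into_into)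

lemma S_T [simp]: "x \<in> vcar V \<Longrightarrow> S (T x) = x"
  unfolding T_def using S_surj by (simp add: f_inv_into_f)

lemma T_S [simp]: "x \<in> vcar V \<Longrightarrow> T (S x) = x"
  unfolding T_def using S_inj by simp

lemma T_lin: "linear_on V V T"
  unfolding linear_on_def
proof (intro conjI ballI allI)
  fix x y c assume x: "x \<in> vcar V" and y: "y \<in> vcar V"
  show "T (x + y) = T x + T y"
    using T_S[of "T x + T y"] x y
    by (simp add: linear_onD[OF S_lin] vsD[OF vs])
  show "T (vscale V c x) = vscale V c (T x)"
    using T_S[of "vscale V c (T x)"] x
    by (simp add: linear_onD[OF S_lin] vsD[OF vs])
qed simp

lemma lin_T: "linear_on V V g \<Longrightarrow> linear_on V V (\<lambda>x. T (g x))"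
  using linear_on_comp[OF T_lin] .

text \<open>Write a = S(T a). By \<open>S_comul\<close> the legs of a are S of the legs of T a in
  reverse order, and T removes one of these antipodes, which leaves \<open>S_left\<close>. The
  reversal is the reason why the second leg stands in front.\<close>

lemma T_right:
  assumes a: "a \<in> vcar V" and f: "lin V f"
  shows "sw a (\<lambda>x y. f (y \<star> T x)) = eps a * f one"
proof -
  note li = hopf_lin_intros lin_T lin_comp[OF f]
  have "sw (S (T a)) (\<lambda>x y. f (y \<star> T x)) = sw (T a) (\<lambda>x y. f (S x \<star> T (S y)))"
    using a by (intro S_comul) (auto intro!: li)
  also have "\<dots> = sw (T a) (\<lambda>x y. f (S x \<star> y))"
    by (intro sw_cong) simp
  also have "\<dots> = eps (T a) * f one"
    using a f by (intro S_left) auto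
  also have "eps (T a) = eps a"
    using eps_S[of "T a"] a by simp
  finally show ?thesis using a by simp
qed

end

section \<open>Untwisting a Hom-Hopf algebra\<close>

lemma lin_tensor_lift_arg:
  assumes "is_vspace V" "is_vspace U" "bilinear_on V W U \<beta>" "linear_on X (vtensor V W) g"
  shows "linear_on X U (\<lambda>x. tensor_lift V W \<beta> (g x))"
  using linear_on_comp[OF tensor_lift_linear[OF assms(1-3)] assms(4)] .

lemma lin_sweedler_arg:
  assumes "is_vspace C" "linear_on C (vtensor C C) (hcomul C)" "is_vspace U"
    "bilinear_on C C U E" "linear_on X C g"
  shows "linear_on X U (\<lambda>x. sweedler C (g x) E)"
  unfolding sweedler_def
  using assms by (intro lin_tensor_lift_arg linear_on_comp[OF assms(2)])

lemma lin_sweedler_body: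
  assumes "is_vspace C" "linear_on C (vtensor C C) (hcomul C)" "is_vspace U" "is_vspace X"
    and "c \<in> vcar C"
    and "\<And>x. x \<in> vcar X \<Longrightarrow> bilinear_on C C U (E x)"
    and "\<And>v w. v \<in> vcar C \<Longrightarrow> w \<in> vcar C \<Longrightarrow> linear_on X U (\<lambda>x. E x v w)"
  shows "linear_on X U (\<lambda>x. sweedler C c (E x))"
  unfolding sweedler_def
  using assms by (intro tensor_lift_linear_param) (auto simp: linear_onD)

lemma sweedler_apply_raw:
  assumes "is_vspace C" "linear_on C (vtensor C C) (hcomul C)" "is_vspace U"
    and "bilinear_on C C U E" "linear_on U scalars f" "c \<in> vcar C"
  shows "f (sweedler C c E) = hcomul C c (\<lambda>x y. f (E x y))"
  unfolding sweedler_def using assms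
  by (intro tensor_lift_apply) (auto simp: linear_onD)

lemma sweedler_commute:
  assumes "is_vspace C" "linear_on C (vtensor C C) (hcomul C)" "is_vspace U" "is_vspace U'"
    and "bilinear_on C C U E" "linear_on U U' f" "c \<in> vcar C"
  shows "f (sweedler C c E) = sweedler C c (\<lambda>x y. f (E x y))"
  unfolding sweedler_def using assms
  by (intro tensor_lift_commute) (auto simp: linear_onD)

lemma sweedler_scalar:
  assumes "is_vspace C" "linear_on C (vtensor C C) (hcomul C)"
    and "bilinear_on C C scalars E" "c \<in> vcar C"
  shows "sweedler C c E = hcomul C c E"
  unfolding sweedler_def using assms
  by (intro tensor_lift_scalar) (auto simp: linear_onD)

lemma sweedler_cong:
  "(\<And>x y. x \<in> vcar C \<Longrightarrow> y \<in> vcar C \<Longrightarrow> E x y = E' x y) \<Longrightarrow> sweedler C c E = sweedler C c E'"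
  unfolding sweedler_def by (rule tensor_lift_cong)

lemma lin_eval_vtensor: "linear_on (vtensor V W) scalars (\<lambda>t. t \<beta>)"
  by (simp add: linear_on_def vtensor_scale)

lemma lin_eval_vtensor_param:
  assumes "is_vspace V" "is_vspace X" "t \<in> vcar (vtensor V W)"
    and "\<And>x. x \<in> vcar X \<Longrightarrow> bilinear_on V W scalars (\<beta> x)"
    and "\<And>v w. v \<in> vcar V \<Longrightarrow> w \<in> vcar W \<Longrightarrow> linear_on X scalars (\<lambda>x. \<beta> x v w)"
  shows "linear_on X scalars (\<lambda>x. t (\<beta> x))"
  using tensor_lift_linear_param[OF assms(1) vs_scalars assms(2,4,5,3)]
  by (rule linear_on_congD) (simp_all add: assms tensor_lift_scalar)

locale fd_hom_hopf = hom_hopf_algebra A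
  for A :: "('k::field, 'v::ab_group_add, 'z) hom_hopf_scheme" (structure) +
  fixes B :: "'v set" and e :: "'v \<Rightarrow> 'v \<Rightarrow> 'k"
  assumes frame_A: "coord_frame A B (\<lambda>i. i) e"
    and map_bij: "bij_betw (hmap A) (vcar A) (vcar A)"
begin

abbreviation al :: "'v \<Rightarrow> 'v" where "al \<equiv> hmap A"

text \<open>The product \<open>\<alpha>\<^sup>-\<^sup>1(ab)\<close> and the coproduct \<open>\<Delta> \<circ> \<alpha>\<^sup>-\<^sup>1\<close>, whose coordinates are \<open>ud\<close>, make \<open>A\<close>
  an ordinary Hopf algebra with automorphism \<open>\<alpha>\<close>.\<close>

definition ai :: "'v \<Rightarrow> 'v" where "ai = inv_into (vcar A) (hmap A)"
definition um :: "'v \<Rightarrow> 'v \<Rightarrow> 'v" (infixl "\<star>" 70) where "a \<star> b = ai (a \<cdot> b)"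
definition ud :: "'v \<Rightarrow> 'v \<Rightarrow> 'v \<Rightarrow> 'k" where
  "ud c i j = hcomul A (ai c) (\<lambda>v w. e i v * e j w)"

lemma hinv_simps: "hinv A 1 = ai" "hinv A 2 x = ai (ai x)" "hinv A 3 x = ai (ai (ai x))"
  by (simp_all add: hinv_def ai_def numeral_eq_Suc)

lemmas vsA [simp] = alg.vspace
lemmas comul_lin [simp] = coalg.comul_linear

lemma mul_closed [simp]: "a \<in> vcar A \<Longrightarrow> b \<in> vcar A \<Longrightarrow> a \<cdot> b \<in> vcar A"
  using bilinear_onD(3)[OF alg.mul_bilinear] .

lemma al_closed [simp]: "a \<in> vcar A \<Longrightarrow> al a \<in> vcar A"
  using linear_onD(1)[OF alg.map_linear] .

lemma ai_closed [simp]: "a \<in> vcar A \<Longrightarrow> ai a \<in> vcar A"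
  unfolding ai_def using map_bij by (metis bij_betw_def inv_into_into)

lemma al_ai [simp]: "a \<in> vcar A \<Longrightarrow> al (ai a) = a"
  unfolding ai_def using map_bij by (metis bij_betw_def f_inv_into_f)

lemma ai_al [simp]: "a \<in> vcar A \<Longrightarrow> ai (al a) = a"
  unfolding ai_def using map_bij by (metis bij_betw_def inv_into_f_f)

lemma ai_linear: "linear_on A A ai"
  unfolding linear_on_def
proof (intro conjI ballI allI)
  fix x y c assume x: "x \<in> vcar A" and y: "y \<in> vcar A"
  show "ai (x + y) = ai x + ai y"
    using ai_al[of "ai x + ai y"] x y
    by (simp add: linear_onD[OF alg.map_linear] vsD[OF vsA])
  show "ai (vscale A c x) = vscale A c (ai x)"
    using ai_al[of "vscale A c (ai x)"] x
    by (simp add: linear_onD[OF alg.map_linear] vsD[OF vsA])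
qed simp

lemma ai_mul: "a \<in> vcar A \<Longrightarrow> b \<in> vcar A \<Longrightarrow> ai (a \<cdot> b) = ai a \<cdot> ai b"
  using ai_al[of "ai a \<cdot> ai b"] by (simp add: alg.map_mul)

lemma mul_um: "a \<in> vcar A \<Longrightarrow> b \<in> vcar A \<Longrightarrow> a \<cdot> b = al (a \<star> b)"
  by (simp add: um_def)

lemma um_closed [simp]: "a \<in> vcar A \<Longrightarrow> b \<in> vcar A \<Longrightarrow> a \<star> b \<in> vcar A"
  by (simp add: um_def)

lemma al_um: "a \<in> vcar A \<Longrightarrow> b \<in> vcar A \<Longrightarrow> al (a \<star> b) = al a \<star> al b"
  by (simp add: um_def flip: alg.map_mul)

lemma ai_um: "a \<in> vcar A \<Longrightarrow> b \<in> vcar A \<Longrightarrow> ai (a \<star> b) = ai a \<star> ai b"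
  by (simp add: um_def ai_mul)

lemma eps_al [simp]: "a \<in> vcar A \<Longrightarrow> hcounit A (al a) = hcounit A a"
  by (rule coalg.counit_map)

lemma eps_ai [simp]: "a \<in> vcar A \<Longrightarrow> hcounit A (ai a) = hcounit A a"
  using coalg.counit_map[of "ai a"] by simp

lemma al_one [simp]: "al (hone A) = hone A"
  by (rule alg.map_one)

lemma ai_one [simp]: "ai (hone A) = hone A"
  using ai_al[OF alg.one_closed] by simp

lemma S_al: "a \<in> vcar A \<Longrightarrow> hantipode A (al a) = al (hantipode A a)"
  by (rule antipode_map)

lemma lin_al: "linear_on X A g \<Longrightarrow> linear_on X A (\<lambda>x. al (g x))"
  using linear_on_comp[OF alg.map_linear] .

lemma lin_ai: "linear_on X A g \<Longrightarrow> linear_on X A (\<lambda>x. ai (g x))"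
  using linear_on_comp[OF ai_linear] .

lemma lin_mul_left: "a \<in> vcar A \<Longrightarrow> linear_on X A g \<Longrightarrow> linear_on X A (\<lambda>x. g x \<cdot> a)"
  using lin_bilinear_left[OF alg.mul_bilinear] .

lemma lin_mul_right: "a \<in> vcar A \<Longrightarrow> linear_on X A g \<Longrightarrow> linear_on X A (\<lambda>x. a \<cdot> g x)"
  using lin_bilinear_right[OF alg.mul_bilinear] .

lemma um_bilinear: "bilinear_on A A A (\<star>)"
  unfolding um_def
  by (intro bilinear_onI lin_ai lin_mul_left lin_mul_right linear_on_id)

sublocale H: fd_comul A B e ud
proof
  show "lin A (\<lambda>c. ud c i j)" for i j
    unfolding ud_def
    using linear_on_comp[OF lin_eval_vtensor linear_on_comp[OF coalg.comul_linear ai_linear]] .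
qed (simp_all add: frame_A)

text \<open>The \<alpha> compensates the inverse built into \<open>ud\<close>. Each passage from
  \<open>sweedler\<close> to \<open>H.sw\<close> costs one such \<alpha>, which \<open>sw_al\<close>
  afterwards distributes over the legs.\<close>

lemma comul_apply:
  assumes "c \<in> vcar A" "bilinear_on A A scalars E"
  shows "hcomul A c E = H.sw (al c) E"
  using vtensor_expand[OF vsA vsA frame_A frame_A assms(2) linear_onD(1)[OF comul_lin assms(1)]] assms(1)
  by (simp add: H.sw_def ud_def)

lemma sweedler_apply:
  assumes "is_vspace U" "bilinear_on A A U E" "linear_on U scalars f" "c \<in> vcar A"
  shows "f (sweedler A c E) = H.sw (al c) (\<lambda>x y. f (E x y))"
  using sweedler_apply_raw[OF vsA comul_lin assms] assms
  by (simp add: comul_apply linear_on_bilinear)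

lemma sweedler_eval:
  assumes "bilinear_on A A (vtensor X Y) E" "c \<in> vcar A"
  shows "sweedler A c E \<beta> = H.sw (al c) (\<lambda>x y. E x y \<beta>)"
  using sweedler_apply[where f="\<lambda>t. t \<beta>", OF vs_vtensor assms(1) lin_eval_vtensor assms(2)] .

lemma sweedler_sw:
  assumes "c \<in> vcar A" "bilinear_on A A scalars E"
  shows "sweedler A c E = H.sw (al c) E"
  using sweedler_apply[OF vs_scalars assms(2) linear_on_id assms(1)] .

lemmas ptensor_lin = lin_bilinear_left[OF ptensor_bilinear] lin_bilinear_right[OF ptensor_bilinear]

text \<open>\<alpha> is also an automorphism for the untwisted coproduct:
  \<open>coalg.comul_map\<close> at the preimage of c, evaluated on E. This rule clears the powers
  of \<alpha> that conversion to \<open>H.sw\<close> leaves in the argument.\<close>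

lemma sw_al:
  assumes c: "c \<in> vcar A" and E: "bilinear_on A A scalars E"
  shows "H.sw (al c) E = H.sw c (\<lambda>x y. E (al x) (al y))"
proof -
  have E': "bilinear_on A A scalars (\<lambda>x y. E (al x) (al y))"
    by (rule bilinear_on_comp[OF E alg.map_linear alg.map_linear])
  have "sweedler A (ai c) (\<lambda>c1 c2. ptensor A A (al c1) (al c2)) E
      = H.sw (al (ai c)) (\<lambda>x y. ptensor A A (al x) (al y) E)"
    by (rule sweedler_eval)
       (auto intro!: bilinear_onI ptensor_lin lin_al linear_on_id simp: c)
  then have "hcomul A c E = H.sw c (\<lambda>x y. E (al x) (al y))"
    using c by (simp add: coalg.comul_map ptensor_apply[OF E])
  then show ?thesis
    using comul_apply[OF c E] by simp
qed

lemma sw_coassoc: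
  assumes c: "c \<in> vcar A" and F: "trilinear_on A F"
  shows "H.sw c (\<lambda>x y. H.sw x (\<lambda>u v. F u v y)) = H.sw c (\<lambda>x y. H.sw y (\<lambda>u v. F x u v))"
proof -
  let ?U = "vtensor A (vtensor A A)"
  \<comment> \<open>The Hom-coassociativity axiom is an equation in A \<otimes> (A \<otimes> A). The
    trilinear F becomes a bilinear form there by letting the second argument, itself a function on
    forms, act on F x.\<close>
  define \<Gamma> where "\<Gamma> x t = t (F x)" for x and t :: "('v, 'v, 'k) tensor"
  have \<Gamma>: "bilinear_on A (vtensor A A) scalars \<Gamma>"
  proof (rule bilinear_onI)
    show "lin (vtensor A A) (\<Gamma> x)" for x
      unfolding \<Gamma>_def by (rule lin_eval_vtensor)
    show "lin A (\<lambda>x. \<Gamma> x t)" if "t \<in> vcar (vtensor A A)" for t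
      unfolding \<Gamma>_def
      by (rule lin_eval_vtensor_param[OF vsA vsA that]) (auto intro: trilinear_onD[OF F])
  qed
  have \<Gamma>_pt: "ptensor A (vtensor A A) u (ptensor A A v w) \<Gamma> = F u v w" if "u \<in> vcar A" for u v w
    using that by (simp add: ptensor_apply[OF \<Gamma>] \<Gamma>_def ptensor_apply trilinear_onD[OF F])
  note li = bilinear_onI ptensor_lin lin_al linear_on_id lin_sweedler_arg lin_sweedler_body
    vs_vtensor ptensor_in
  have F2: "bilinear_on A A scalars (\<lambda>u v. F u v y)" if "y \<in> vcar A" for y
    using that by (auto intro!: bilinear_onI trilinear_onD[OF F])
  \<comment> \<open>Two preimages, because each of the two nested conversions to \<open>H.sw\<close>
    contributes one \<alpha>.\<close>
  define c' where "c' = ai (ai c)"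
  have c': "c' \<in> vcar A" "al (al c') = c" using c by (simp_all add: c'_def)
  have "sweedler A c' (\<lambda>c1 c2. sweedler A c1 (\<lambda>c11 c12.
      ptensor A (vtensor A A) c11 (ptensor A A c12 (al c2)))) \<Gamma>
    = H.sw (al c') (\<lambda>c1 c2. sweedler A c1 (\<lambda>c11 c12.
      ptensor A (vtensor A A) c11 (ptensor A A c12 (al c2))) \<Gamma>)"
    by (rule sweedler_eval[OF _ c'(1)])
       (auto intro!: li)
  also have "\<dots> = H.sw (al c') (\<lambda>c1 c2. H.sw (al c1) (\<lambda>c11 c12.
      ptensor A (vtensor A A) c11 (ptensor A A c12 (al c2)) \<Gamma>))"
    by (intro H.sw_cong sweedler_eval)
       (auto intro!: li)
  also have "\<dots> = H.sw (al c') (\<lambda>c1 c2. H.sw (al c1) (\<lambda>c11 c12. F c11 c12 (al c2)))"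
    by (intro H.sw_cong \<Gamma>_pt)
  also have "\<dots> = H.sw (al (al c')) (\<lambda>x y. H.sw x (\<lambda>u v. F u v y))"
    using c' by (intro sw_al[symmetric] bilinear_onI H.lin_intros trilinear_onD[OF F]) auto
  finally have 1: "sweedler A c' (\<lambda>c1 c2. sweedler A c1 (\<lambda>c11 c12.
      ptensor A (vtensor A A) c11 (ptensor A A c12 (al c2)))) \<Gamma>
      = H.sw c (\<lambda>x y. H.sw x (\<lambda>u v. F u v y))"
    by (simp add: c')
  have "sweedler A c' (\<lambda>c1 c2. sweedler A c2 (\<lambda>c21 c22.
      ptensor A (vtensor A A) (al c1) (ptensor A A c21 c22))) \<Gamma>
    = H.sw (al c') (\<lambda>c1 c2. sweedler A c2 (\<lambda>c21 c22.
      ptensor A (vtensor A A) (al c1) (ptensor A A c21 c22)) \<Gamma>)"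
    by (rule sweedler_eval[OF _ c'(1)])
       (auto intro!: li)
  also have "\<dots> = H.sw (al c') (\<lambda>c1 c2. H.sw (al c2) (\<lambda>c21 c22.
      ptensor A (vtensor A A) (al c1) (ptensor A A c21 c22) \<Gamma>))"
    by (intro H.sw_cong sweedler_eval)
       (auto intro!: li)
  also have "\<dots> = H.sw (al c') (\<lambda>c1 c2. H.sw (al c2) (\<lambda>c21 c22. F (al c1) c21 c22))"
    by (intro H.sw_cong \<Gamma>_pt) simp
  also have "\<dots> = H.sw (al (al c')) (\<lambda>x y. H.sw y (\<lambda>u v. F x u v))"
    using c' by (intro sw_al[symmetric] bilinear_onI H.lin_intros trilinear_onD[OF F]) auto
  finally show ?thesis
    using 1 coalg.hom_coassoc[OF c'(1)] by (simp add: c')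
qed

lemma lin_eps_A: "linear_on X A g \<Longrightarrow> linear_on X scalars (\<lambda>x. hcounit A (g x))"
  using linear_on_comp[OF coalg.counit_linear] .

lemma lin_S_A: "linear_on X A g \<Longrightarrow> linear_on X A (\<lambda>x. hantipode A (g x))"
  using linear_on_comp[OF antipode_linear] .

text \<open>Each Hom axiom is used at preimages under \<alpha> chosen so that the surplus structure
  maps cancel: associativity at the preimages of three elements, the counit and antipode axioms at
  the preimage of a, multiplicativity of \<Delta> at second preimages.\<close>

sublocale H: fd_hopf A B e ud "(\<star>)" "hone A" "hcounit A" "hantipode A"
proof
  show "bilinear_on A A A (\<star>)" by (rule um_bilinear)
  show "hone A \<in> vcar A" by (rule alg.one_closed)
  show "linear_on A A (hantipode A)" by (rule antipode_linear)
  show "lin A (hcounit A)" by (rule coalg.counit_linear)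
  show "hcounit A (hone A) = 1" by (rule counit_one)
  fix a b assume a [simp]: "a \<in> vcar A" and b [simp]: "b \<in> vcar A"
  show "hone A \<star> a = a" "a \<star> hone A = a"
    by (simp_all add: um_def alg.one_left alg.one_right)
  show "hcounit A (a \<star> b) = hcounit A a * hcounit A b"
    by (simp add: um_def counit_mul)
  show "a \<star> b \<star> c = a \<star> (b \<star> c)" if [simp]: "c \<in> vcar A" for c
    using alg.hom_assoc[of "ai a" "ai b" "ai c"] by (simp add: um_def ai_mul)
  show "ud a i j = H.sw a (\<lambda>u v. e i u * e j v)" if "i \<in> B" "j \<in> B" for i j
  proof -
    have "bilinear_on A A scalars (\<lambda>u v. e i u * e j v)"
      using that by (auto intro!: H.lin_intros)
    from comul_apply[OF _ this, of "ai a"] show ?thesis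
      by (simp add: ud_def)
  qed
  show "H.sw a (\<lambda>x y. H.sw x (\<lambda>u v. F u v y)) = H.sw a (\<lambda>x y. H.sw y (F x))"
    if "trilinear_on A F" for F
    using sw_coassoc[OF a that] .
  fix f assume f: "lin A f"
  note li = H.lin_intros H.lin_comp[OF f] lin_eps_A lin_ai lin_al lin_S_A lin_mul_left lin_mul_right
    linear_on_scale linear_on_scale_left coalg.counit_linear
  have fs: "f (vscale A c x) = c * f x" if "x \<in> vcar A" for c x
    using linear_onD(3)[OF f that] by simp
  show "H.sw a (\<lambda>x y. hcounit A x * f y) = f a"
  proof -
    have "f (sweedler A (ai a) (\<lambda>c1 c2. vscale A (hcounit A c1) c2))
        = H.sw (al (ai a)) (\<lambda>x y. f (vscale A (hcounit A x) y))"
      by (rule sweedler_apply[OF vsA _ f]) (auto intro!: li)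
    also have "\<dots> = H.sw a (\<lambda>x y. hcounit A x * f y)"
      by (simp add: fs cong: H.sw_cong_arg)
    finally show ?thesis by (simp add: coalg.counit_left)
  qed
  show "H.sw a (\<lambda>x y. hcounit A y * f x) = f a"
  proof -
    have "f (sweedler A (ai a) (\<lambda>c1 c2. vscale A (hcounit A c2) c1))
        = H.sw (al (ai a)) (\<lambda>x y. f (vscale A (hcounit A y) x))"
      by (rule sweedler_apply[OF vsA _ f]) (auto intro!: li)
    also have "\<dots> = H.sw a (\<lambda>x y. hcounit A y * f x)"
      by (simp add: fs cong: H.sw_cong_arg)
    finally show ?thesis by (simp add: coalg.counit_right)
  qed
  show "H.sw a (\<lambda>x y. f (hantipode A x \<star> y)) = hcounit A a * f (hone A)"
  proof -
    have "f (ai (sweedler A (ai a) (\<lambda>a1 a2. hantipode A a1 \<cdot> a2)))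
        = H.sw (al (ai a)) (\<lambda>x y. f (ai (hantipode A x \<cdot> y)))"
      by (rule sweedler_apply[where f="\<lambda>x. f (ai x)", OF vsA]) (auto intro!: li linear_onD[OF antipode_linear])
    then show ?thesis
      by (simp add: antipode_left um_def linear_onD[OF ai_linear] alg.one_closed fs)
  qed
  show "H.sw a (\<lambda>x y. f (x \<star> hantipode A y)) = hcounit A a * f (hone A)"
  proof -
    have "f (ai (sweedler A (ai a) (\<lambda>a1 a2. a1 \<cdot> hantipode A a2)))
        = H.sw (al (ai a)) (\<lambda>x y. f (ai (x \<cdot> hantipode A y)))"
      by (rule sweedler_apply[where f="\<lambda>x. f (ai x)", OF vsA]) (auto intro!: li linear_onD[OF antipode_linear])
    then show ?thesis
      by (simp add: antipode_right um_def linear_onD[OF ai_linear] alg.one_closed fs)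
  qed
next
  fix E :: "'v \<Rightarrow> 'v \<Rightarrow> 'k" assume E: "bilinear_on A A scalars E"
  show "H.sw (hone A) E = E (hone A) (hone A)"
    using comul_apply[OF alg.one_closed E] by (simp add: comul_one ptensor_apply[OF E])
  fix a b assume a [simp]: "a \<in> vcar A" and b [simp]: "b \<in> vcar A"
  note li = bilinear_onI ptensor_lin lin_al lin_ai linear_on_id lin_sweedler_arg lin_sweedler_body
    vs_vtensor ptensor_in lin_mul_left lin_mul_right
  note sw_li = H.lin_intros lin_bilinear_left[OF E] lin_bilinear_right[OF E] lin_al lin_ai
    lin_bilinear_left[OF um_bilinear] lin_bilinear_right[OF um_bilinear]
  \<comment> \<open>One preimage is absorbed by the untwisted product, the other by the conversion
    of the Hom-coproduct.\<close>
  define a' b' where "a' = ai (ai a)" and "b' = ai (ai b)"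
  have ab' [simp]: "a' \<in> vcar A" "b' \<in> vcar A" "al (al a') = a" "al (al b') = b"
    by (simp_all add: a'_def b'_def)
  have "H.sw (a \<star> b) E = H.sw (al (a' \<cdot> b')) E"
    by (simp add: a'_def b'_def um_def flip: ai_mul)
  also have "\<dots> = hcomul A (a' \<cdot> b') E"
    by (rule comul_apply[symmetric, OF _ E]) simp
  also have "\<dots> = sweedler A a' (\<lambda>a1 a2. sweedler A b' (\<lambda>b1 b2. ptensor A A (a1 \<cdot> b1) (a2 \<cdot> b2))) E"
    by (simp add: comul_mul)
  also have "\<dots> = H.sw (al a') (\<lambda>a1 a2. sweedler A b' (\<lambda>b1 b2. ptensor A A (a1 \<cdot> b1) (a2 \<cdot> b2)) E)"
    by (rule sweedler_eval)
       (auto intro!: li)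
  also have "\<dots> = H.sw (al a') (\<lambda>a1 a2. H.sw (al b') (\<lambda>b1 b2. ptensor A A (a1 \<cdot> b1) (a2 \<cdot> b2) E))"
    by (intro H.sw_cong sweedler_eval)
       (auto intro!: li)
  also have "\<dots> = H.sw (al a') (\<lambda>a1 a2. H.sw (al b') (\<lambda>b1 b2.
      E (al a1 \<star> al b1) (al a2 \<star> al b2)))"
    by (intro H.sw_cong) (simp add: ptensor_apply[OF E] mul_um al_um)
  also have "\<dots> = H.sw (al a') (\<lambda>a1 a2. H.sw (al (al b')) (\<lambda>b1 b2.
      E (al a1 \<star> b1) (al a2 \<star> b2)))"
    by (intro H.sw_cong sw_al[symmetric]) (auto intro!: sw_li)
  also have "\<dots> = H.sw (al (al a')) (\<lambda>a1 a2. H.sw (al (al b')) (\<lambda>b1 b2. E (a1 \<star> b1) (a2 \<star> b2)))"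
    by (intro sw_al[symmetric]) (auto intro!: sw_li)
  finally show "H.sw (a \<star> b) E = H.sw a (\<lambda>a1 a2. H.sw b (\<lambda>b1 b2. E (a1 \<star> b1) (a2 \<star> b2)))"
    by simp
qed

end

section \<open>Duals\<close>

lemma hom_dual_simps [simp]:
  "vcar (hom_dual X) = vcar (dual_space X)" "vscale (hom_dual X) = vscale (dual_space X)"
  "hone (hom_dual X) = form_on X (hcounit X)" "hcounit (hom_dual X) f = f (hone X)"
  by (simp_all add: hom_dual_def)

lemma ptensor_hom_dual:
  "ptensor (hom_dual X) (hom_dual X) = ptensor (dual_space X) (dual_space X)"
  "vtensor (hom_dual X) (hom_dual X) = vtensor (dual_space X) (dual_space X)"
  by (intro ptensor_cong vtensor_cong; simp)+

lemma vs_hom_dual: "is_vspace (hom_dual X)"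
  using vs_dual[of X] vs_cong[of "hom_dual X" "dual_space X"] by simp

lemma lin_into_dual:
  assumes V: "is_vspace V"
    and "\<And>y. y \<in> vcar V \<Longrightarrow> linear_on X scalars (\<lambda>x. F x y)"
    and "\<And>x. x \<in> vcar X \<Longrightarrow> linear_on V scalars (F x)"
  shows "linear_on X (dual_space V) (\<lambda>x. form_on V (F x))"
  unfolding linear_on_def
proof (intro conjI ballI allI)
  show "form_on V (F x) \<in> vcar (dual_space V)" if "x \<in> vcar X" for x
    using form_on_dual[OF V assms(3)[OF that]] .
qed (use assms(2) in \<open>auto simp: form_on_def fun_eq_iff linear_on_def dual_space_simps\<close>)

lemma linear_on_hom_dual:
  "linear_on (hom_dual X) U = linear_on (dual_space X) U"
  "linear_on U' (hom_dual X) = linear_on U' (dual_space X)"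
  by (intro ext; simp add: linear_on_def)+

lemma vtensor_apply_cong:
  assumes V: "is_vspace V" and t: "t \<in> vcar (vtensor V W)"
    and E: "bilinear_on V W scalars E" and E': "bilinear_on V W scalars E'"
    and eq: "\<And>v w. v \<in> vcar V \<Longrightarrow> w \<in> vcar W \<Longrightarrow> E v w = E' v w"
  shows "t E = t E'"
  using tensor_lift_cong[of V W E E' t] eq tensor_lift_scalar[OF V E t] tensor_lift_scalar[OF V E' t]
  by simp

context
  fixes X :: "('k::field, 'v::ab_group_add, 'z) hom_bialg_scheme" (structure)
    and I :: "'i set" and b :: "'i \<Rightarrow> 'v" and e :: "'i \<Rightarrow> 'v \<Rightarrow> 'k"
  assumes vs: "is_vspace X" and frame: "coord_frame X I b e"
    and mul: "bilinear_on X X X (hmul X)" and inv: "linear_on X X (hinv X 2)"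
begin

text \<open>Evaluations at the frame vectors are the coordinate forms of the dual, so their products
  separate tensors. This is the uniqueness half of the definite description of the dual
  coproduct.\<close>

lemma hom_dual_comul_unique:
  assumes "t \<in> vcar (vtensor (dual_space X) (dual_space X))"
    and "t' \<in> vcar (vtensor (dual_space X) (dual_space X))"
    and eq: "\<And>h k. h \<in> vcar X \<Longrightarrow> k \<in> vcar X \<Longrightarrow> t (\<lambda>f1 f2. f1 h * f2 k) = t' (\<lambda>f1 f2. f1 h * f2 k)"
  shows "t = t'"
proof -
  have *: "s (\<lambda>v w. form_on (dual_space X) (\<lambda>f. f (b i)) v * form_on (dual_space X) (\<lambda>f. f (b j)) w)
      = s (\<lambda>f1 f2. f1 (b i) * f2 (b j))" if s: "s \<in> vcar (vtensor (dual_space X) (dual_space X))" for s i j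
  proof -
    have 1: "bilinear_on (dual_space X) (dual_space X) scalars (\<lambda>f1 f2. f1 (b i) * f2 (b j))"
      by (intro bilinear_onI lin_mult_left lin_mult_right eval_dual_linear)
    have 2: "bilinear_on (dual_space X) (dual_space X) scalars
        (\<lambda>v w. form_on (dual_space X) (\<lambda>f. f (b i)) v * form_on (dual_space X) (\<lambda>f. f (b j)) w)"
      using form_on_dual[OF vs_dual eval_dual_linear, of X]
      by (intro bilinear_onI lin_mult_left lin_mult_right) (simp_all add: dual_space_simps)
    show ?thesis
      by (rule vtensor_apply_cong[OF vs_dual s 2 1]) simp
  qed
  show ?thesis
    using coord_frame_dual[OF vs frame]
    by (rule vtensor_eqI[OF vs_dual vs_dual _ coord_frame_dual[OF vs frame] assms(1,2)])
       (simp add: * assms(1,2) eq coord_frameD[OF frame])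
qed

text \<open>The existence half: the coefficient at e_i \<otimes> e_j is the value that the defining
  condition prescribes at the pair b_i, b_j, and bilinearity of the product extends the condition to
  all pairs.\<close>

lemma hom_dual_comul:
  assumes f: "f \<in> vcar (dual_space X)"
  shows "hcomul (hom_dual X) f = (\<Sum>i\<in>I. \<Sum>j\<in>I. vscale (vtensor (dual_space X) (dual_space X))
    (f (hinv X 2 (b i \<cdot> b j))) (ptensor (dual_space X) (dual_space X) (e i) (e j)))"
proof -
  let ?D = "dual_space X"
  define t0 where "t0 = (\<Sum>i\<in>I. \<Sum>j\<in>I. vscale (vtensor ?D ?D)
    (f (hinv X 2 (b i \<cdot> b j))) (ptensor ?D ?D (e i) (e j)))"
  have fl: "linear_on X scalars f" using f by (simp add: dual_space_simps)
  have bil: "bilinear_on ?D ?D scalars (\<lambda>f1 f2. f1 h * f2 k)" for h k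
    by (intro bilinear_onI lin_mult_left lin_mult_right eval_dual_linear)
  have t0: "t0 \<in> vcar (vtensor ?D ?D)"
    unfolding t0_def
    by (intro vs_sum vs_vtensor vsD(3)[OF vs_vtensor] ptensor_in
      coord_frameD(3)[OF frame])
  have B: "bilinear_on X X scalars (\<lambda>h k. f (hinv X 2 (h \<cdot> k)))"
    using linear_on_bilinear[OF linear_on_comp[OF fl inv] mul] .
  have val: "t0 (\<lambda>f1 f2. f1 h * f2 k) = f (hinv X 2 (h \<cdot> k))"
    if h: "h \<in> vcar X" and k: "k \<in> vcar X" for h k
  proof -
    have "t0 (\<lambda>f1 f2. f1 h * f2 k) =
        (\<Sum>i\<in>I. \<Sum>j\<in>I. f (hinv X 2 (b i \<cdot> b j)) * (e i h * e j k))"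
      by (simp add: t0_def sum_fun_apply vtensor_scale ptensor_apply[OF bil])
    also have "\<dots> = (\<Sum>i\<in>I. e i h * (\<Sum>j\<in>I. e j k * f (hinv X 2 (b i \<cdot> b j))))"
      by (simp add: sum_distrib_left mult_ac)
    also have "\<dots> = (\<Sum>i\<in>I. e i h * f (hinv X 2 (b i \<cdot> k)))"
      using coord_frame_linear[OF vs vs_scalars frame bilinear_onD(1)[OF B] k]
      by (intro sum.cong refl) (simp add: coord_frameD[OF frame])
    also have "\<dots> = f (hinv X 2 (h \<cdot> k))"
      using coord_frame_linear[OF vs vs_scalars frame bilinear_onD(2)[OF B k] h] by simp
    finally show ?thesis .
  qed
  have lift: "tensor_lift ?D ?D (\<lambda>f1 f2. f1 h * f2 k) t = t (\<lambda>f1 f2. f1 h * f2 k)"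
    if "t \<in> vcar (vtensor ?D ?D)" for t h k
    by (rule tensor_lift_scalar[OF vs_dual bil that])
  have "(THE t. t \<in> vcar (vtensor ?D ?D) \<and> (\<forall>h\<in>vcar X. \<forall>k\<in>vcar X.
          tensor_lift ?D ?D (\<lambda>f1 f2. f1 h * f2 k) t = f (hinv X 2 (h \<cdot> k)))) = t0"
    by (rule the_equality) (auto simp: t0 val lift intro!: hom_dual_comul_unique)
  then show ?thesis
    by (simp add: hom_dual_def t0_def)
qed

lemma hom_dual_comul_apply:
  assumes "f \<in> vcar (dual_space X)" "bilinear_on (hom_dual X) (hom_dual X) scalars E"
  shows "hcomul (hom_dual X) f E = (\<Sum>i\<in>I. \<Sum>j\<in>I. f (hinv X 2 (b i \<cdot> b j)) * E (e i) (e j))"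
proof -
  have "bilinear_on (dual_space X) (dual_space X) scalars E"
    using assms(2) by (simp add: bilinear_on_def linear_on_hom_dual)
  then show ?thesis
    by (simp add: hom_dual_comul[OF assms(1)] sum_fun_apply vtensor_scale ptensor_apply)
qed

lemma hom_dual_comul_linear:
  "linear_on (hom_dual X) (vtensor (hom_dual X) (hom_dual X)) (hcomul (hom_dual X))"
  unfolding linear_on_hom_dual(1) ptensor_hom_dual
proof -
  let ?D = "dual_space X"
  have *: "(\<Sum>i\<in>I. \<Sum>j\<in>I. vscale (vtensor ?D ?D) (c i j) (ptensor ?D ?D (e i) (e j))) \<in> vcar (vtensor ?D ?D)"
    for c
    by (intro vs_sum vs_vtensor vsD(3)[OF vs_vtensor] ptensor_in
      coord_frameD(3)[OF frame])
  have plus: "f + g \<in> vcar ?D" if "f \<in> vcar ?D" "g \<in> vcar ?D" for f g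
    using vsD(2)[OF vs_dual that] .
  have scale: "vscale ?D c f \<in> vcar ?D" if "f \<in> vcar ?D" for f c
    using vsD(3)[OF vs_dual that] .
  show "linear_on ?D (vtensor ?D ?D) (hcomul (hom_dual X))"
    unfolding linear_on_def
  proof (intro conjI ballI allI)
    fix f g c assume f: "f \<in> vcar ?D" and g: "g \<in> vcar ?D"
    show "hcomul (hom_dual X) f \<in> vcar (vtensor ?D ?D)"
      unfolding hom_dual_comul[OF f] by (rule *)
    show "hcomul (hom_dual X) (f + g) = hcomul (hom_dual X) f + hcomul (hom_dual X) g"
      unfolding hom_dual_comul[OF f] hom_dual_comul[OF g] hom_dual_comul[OF plus[OF f g]]
      by (simp add: vsD[OF vs_vtensor] sum.distrib)
    show "hcomul (hom_dual X) (vscale ?D c f) = vscale (vtensor ?D ?D) c (hcomul (hom_dual X) f)"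
      unfolding hom_dual_comul[OF f] hom_dual_comul[OF scale[OF f]]
      by (simp add: vs_scale_sum[OF vs_vtensor] vsD[OF vs_vtensor]
        dual_space_simps(2))
  qed
qed

text \<open>Contracting one leg of \<Delta>(f) with a vector leaves a single functional, f composed
  with a multiplication. This is how the Sweedler sums over the dual are eliminated in the twist
  computations; the choice of leg decides the side of the multiplication.\<close>

lemma hom_dual_comul_left:
  assumes f: "f \<in> vcar (dual_space X)" and G: "linear_on (dual_space X) scalars G" and u: "u \<in> vcar X"
  shows "hcomul (hom_dual X) f (\<lambda>f1 f2. f1 u * G f2) = G (form_on X (\<lambda>y. f (hinv X 2 (u \<cdot> y))))"
proof -
  have fl: "linear_on X scalars f" using f by (simp add: dual_space_simps)
  have B: "bilinear_on X X scalars (\<lambda>h k. f (hinv X 2 (h \<cdot> k)))"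
    using linear_on_bilinear[OF linear_on_comp[OF fl inv] mul] .
  have q: "form_on X (\<lambda>y. f (hinv X 2 (u \<cdot> y))) \<in> vcar (dual_space X)"
    by (intro form_on_dual vs bilinear_onD(1)[OF B u])
  have "hcomul (hom_dual X) f (\<lambda>f1 f2. f1 u * G f2)
      = (\<Sum>i\<in>I. \<Sum>j\<in>I. f (hinv X 2 (b i \<cdot> b j)) * (e i u * G (e j)))"
    using G by (intro hom_dual_comul_apply[OF f] bilinear_onI lin_mult_left lin_mult_right)
      (simp_all add: linear_on_hom_dual eval_dual_linear)
  also have "\<dots> = (\<Sum>j\<in>I. \<Sum>i\<in>I. f (hinv X 2 (b i \<cdot> b j)) * (e i u * G (e j)))"
    by (rule sum.swap)
  also have "\<dots> = (\<Sum>j\<in>I. (\<Sum>i\<in>I. e i u * f (hinv X 2 (b i \<cdot> b j))) * G (e j))"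
    by (simp add: sum_distrib_left sum_distrib_right mult_ac)
  also have "\<dots> = (\<Sum>j\<in>I. f (hinv X 2 (u \<cdot> b j)) * G (e j))"
    using coord_frame_linear[OF vs vs_scalars frame bilinear_onD(2)[OF B] u]
    by (intro sum.cong refl) (simp add: coord_frameD[OF frame])
  also have "\<dots> = G (form_on X (\<lambda>y. f (hinv X 2 (u \<cdot> y))))"
    using coord_frame_linear[OF vs_dual vs_scalars coord_frame_dual[OF vs frame] G q]
    by (simp add: q coord_frameD[OF frame])
  finally show ?thesis .
qed

lemma hom_dual_comul_right:
  assumes f: "f \<in> vcar (dual_space X)" and G: "linear_on (dual_space X) scalars G" and u: "u \<in> vcar X"
  shows "hcomul (hom_dual X) f (\<lambda>f1 f2. f2 u * G f1) = G (form_on X (\<lambda>y. f (hinv X 2 (y \<cdot> u))))"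
proof -
  have fl: "linear_on X scalars f" using f by (simp add: dual_space_simps)
  have B: "bilinear_on X X scalars (\<lambda>h k. f (hinv X 2 (h \<cdot> k)))"
    using linear_on_bilinear[OF linear_on_comp[OF fl inv] mul] .
  have q: "form_on X (\<lambda>y. f (hinv X 2 (y \<cdot> u))) \<in> vcar (dual_space X)"
    by (intro form_on_dual vs bilinear_onD(2)[OF B u])
  have "hcomul (hom_dual X) f (\<lambda>f1 f2. f2 u * G f1)
      = (\<Sum>i\<in>I. \<Sum>j\<in>I. f (hinv X 2 (b i \<cdot> b j)) * (e j u * G (e i)))"
    using G by (intro hom_dual_comul_apply[OF f] bilinear_onI lin_mult_left lin_mult_right)
      (simp_all add: linear_on_hom_dual eval_dual_linear)
  also have "\<dots> = (\<Sum>i\<in>I. (\<Sum>j\<in>I. e j u * f (hinv X 2 (b i \<cdot> b j))) * G (e i))"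
    by (simp add: sum_distrib_left sum_distrib_right mult_ac)
  also have "\<dots> = (\<Sum>i\<in>I. f (hinv X 2 (b i \<cdot> u)) * G (e i))"
    using coord_frame_linear[OF vs vs_scalars frame bilinear_onD(1)[OF B] u]
    by (intro sum.cong refl) (simp add: coord_frameD[OF frame])
  also have "\<dots> = G (form_on X (\<lambda>y. f (hinv X 2 (y \<cdot> u))))"
    using coord_frame_linear[OF vs_dual vs_scalars coord_frame_dual[OF vs frame] G q]
    by (simp add: q coord_frameD[OF frame])
  finally show ?thesis .
qed

end

section \<open>Twists of tensor products\<close>

text \<open>The products and the cocycles of both doubles have this shape, so facts about
  four-variable formulas need to be proved only once.\<close>

definition lift2 ::
  "('k::field, 'v::ab_group_add, 'z) vspace_scheme \<Rightarrow> ('k, 'w::ab_group_add, 'y) vspace_scheme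
    \<Rightarrow> ('v \<Rightarrow> 'w \<Rightarrow> 'v \<Rightarrow> 'w \<Rightarrow> 'u::ab_group_add)
    \<Rightarrow> ('v, 'w, 'k) tensor \<Rightarrow> ('v, 'w, 'k) tensor \<Rightarrow> 'u" where
  "lift2 V W F x y = tensor_lift V W (\<lambda>h f. tensor_lift V W (F h f) y) x"

definition quadrilinear_on ::
  "('k::field, 'v::ab_group_add, 'z) vspace_scheme \<Rightarrow> ('k, 'w::ab_group_add, 'y) vspace_scheme
    \<Rightarrow> ('k, 'u::ab_group_add, 'x) vspace_scheme \<Rightarrow> ('v \<Rightarrow> 'w \<Rightarrow> 'v \<Rightarrow> 'w \<Rightarrow> 'u) \<Rightarrow> bool" where
  "quadrilinear_on V W U F \<longleftrightarrow>
     (\<forall>h\<in>vcar V. \<forall>f\<in>vcar W. bilinear_on V W U (F h f)) \<and>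
     (\<forall>k\<in>vcar V. \<forall>g\<in>vcar W. bilinear_on V W U (\<lambda>h f. F h f k g))"

lemma quadrilinear_onI:
  assumes "\<And>f k g. f \<in> vcar W \<Longrightarrow> k \<in> vcar V \<Longrightarrow> g \<in> vcar W \<Longrightarrow> linear_on V U (\<lambda>h. F h f k g)"
    and "\<And>h k g. h \<in> vcar V \<Longrightarrow> k \<in> vcar V \<Longrightarrow> g \<in> vcar W \<Longrightarrow> linear_on W U (\<lambda>f. F h f k g)"
    and "\<And>h f g. h \<in> vcar V \<Longrightarrow> f \<in> vcar W \<Longrightarrow> g \<in> vcar W \<Longrightarrow> linear_on V U (\<lambda>k. F h f k g)"
    and "\<And>h f k. h \<in> vcar V \<Longrightarrow> f \<in> vcar W \<Longrightarrow> k \<in> vcar V \<Longrightarrow> linear_on W U (\<lambda>g. F h f k g)"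
  shows "quadrilinear_on V W U F"
  using assms by (simp add: quadrilinear_on_def bilinear_on_def)

lemma quadrilinear_onD:
  assumes "quadrilinear_on V W U F"
  shows "f \<in> vcar W \<Longrightarrow> k \<in> vcar V \<Longrightarrow> g \<in> vcar W \<Longrightarrow> linear_on V U (\<lambda>h. F h f k g)"
    and "h \<in> vcar V \<Longrightarrow> k \<in> vcar V \<Longrightarrow> g \<in> vcar W \<Longrightarrow> linear_on W U (\<lambda>f. F h f k g)"
    and "h \<in> vcar V \<Longrightarrow> f \<in> vcar W \<Longrightarrow> g \<in> vcar W \<Longrightarrow> linear_on V U (\<lambda>k. F h f k g)"
    and "h \<in> vcar V \<Longrightarrow> f \<in> vcar W \<Longrightarrow> k \<in> vcar V \<Longrightarrow> linear_on W U (\<lambda>g. F h f k g)"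
    and "h \<in> vcar V \<Longrightarrow> f \<in> vcar W \<Longrightarrow> bilinear_on V W U (F h f)"
    and "k \<in> vcar V \<Longrightarrow> g \<in> vcar W \<Longrightarrow> bilinear_on V W U (\<lambda>h f. F h f k g)"
  using assms by (simp_all add: quadrilinear_on_def bilinear_on_def)

lemma lift2_bilinear_inner:
  assumes V: "is_vspace V" and W: "is_vspace W" and U: "is_vspace U" and F: "quadrilinear_on V W U F"
    and y: "y \<in> vcar (vtensor V W)"
  shows "bilinear_on V W U (\<lambda>h f. tensor_lift V W (F h f) y)"
  by (intro bilinear_onI tensor_lift_linear_param V W U y) (auto intro: quadrilinear_onD[OF F])

lemma lift2_bilinear:
  assumes V: "is_vspace V" and W: "is_vspace W" and U: "is_vspace U" and F: "quadrilinear_on V W U F"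
  shows "bilinear_on (vtensor V W) (vtensor V W) U (lift2 V W F)"
proof (rule bilinear_onI)
  show "linear_on (vtensor V W) U (lift2 V W F x)" if "x \<in> vcar (vtensor V W)" for x
    unfolding lift2_def
  proof (rule tensor_lift_linear_param[OF V U vs_vtensor _ _ that])
    show "linear_on (vtensor V W) U (\<lambda>x. tensor_lift V W (F v w) x)"
      if "v \<in> vcar V" "w \<in> vcar W" for v w
      by (rule tensor_lift_linear[OF V U quadrilinear_onD(5)[OF F that]])
  qed (rule lift2_bilinear_inner[OF V W U F])
  show "linear_on (vtensor V W) U (\<lambda>x. lift2 V W F x y)" if "y \<in> vcar (vtensor V W)" for y
    unfolding lift2_def
    by (intro tensor_lift_linear V U lift2_bilinear_inner W F that)
qed

lemma lift2_ptensor: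
  assumes V: "is_vspace V" and W: "is_vspace W" and U: "is_vspace U" and F: "quadrilinear_on V W U F"
    and "h \<in> vcar V" "f \<in> vcar W" "k \<in> vcar V" "g \<in> vcar W"
  shows "lift2 V W F (ptensor V W h f) (ptensor V W k g) = F h f k g"
  unfolding lift2_def using assms
  by (simp add: tensor_lift_ptensor[OF U lift2_bilinear_inner[OF V W U F]] ptensor_in
    tensor_lift_ptensor[OF U quadrilinear_onD(5)[OF F]])

lemma vtensor_bilinear_eqI:
  assumes V: "is_vspace V" and U: "is_vspace U"
    and F: "bilinear_on (vtensor V W) (vtensor V W) U F" and G: "bilinear_on (vtensor V W) (vtensor V W) U G"
    and eq: "\<And>h f k g. \<lbrakk>h \<in> vcar V; f \<in> vcar W; k \<in> vcar V; g \<in> vcar W\<rbrakk> \<Longrightarrow>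
      F (ptensor V W h f) (ptensor V W k g) = G (ptensor V W h f) (ptensor V W k g)"
    and x: "x \<in> vcar (vtensor V W)" and y: "y \<in> vcar (vtensor V W)"
  shows "F x y = G x y"
proof (rule vtensor_linear_eqI[OF V U _ _ _ x, of "\<lambda>x. F x y" "\<lambda>x. G x y"])
  fix h f assume hf: "h \<in> vcar V" "f \<in> vcar W"
  then have pt: "ptensor V W h f \<in> vcar (vtensor V W)" by (rule ptensor_in)
  show "F (ptensor V W h f) y = G (ptensor V W h f) y"
    by (rule vtensor_linear_eqI[OF V U bilinear_onD(1)[OF F pt] bilinear_onD(1)[OF G pt] _ y])
       (rule eq[OF hf])
qed (rule bilinear_onD(2)[OF F y] bilinear_onD(2)[OF G y])+

lemma vtensor_apply_sum:
  assumes V: "is_vspace V" and t: "t \<in> vcar (vtensor V W)"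
    and E: "\<And>i. i \<in> I \<Longrightarrow> bilinear_on V W scalars (E i)"
  shows "t (\<lambda>v w. \<Sum>i\<in>I. E i v w) = (\<Sum>i\<in>I. t (E i))"
proof -
  obtain ps where ps: "t = (\<Sum>(v, w)\<leftarrow>ps. ptensor V W v w)"
    using vtensor_sum_list[OF V t] by metis
  have S: "bilinear_on V W scalars (\<lambda>v w. \<Sum>i\<in>I. E i v w)"
    by (intro bilinear_onI lin_sum) (use E in \<open>auto simp: bilinear_on_def\<close>)
  have "(\<Sum>(v, w)\<leftarrow>ps. \<Sum>i\<in>I. E i v w) = (\<Sum>i\<in>I. \<Sum>(v, w)\<leftarrow>ps. E i v w)"
    by (induction ps) (auto simp: sum.distrib)
  then show ?thesis
    unfolding ps by (simp add: sum_list_ptensor_apply[OF S] sum_list_ptensor_apply[OF E])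
qed

lemma linear_on_subst:
  assumes "vcar V = vcar V'" "vscale V = vscale V'"
  shows "linear_on V U = linear_on V' U" "linear_on U' V = linear_on U' V'"
  using assms by (intro ext; simp add: linear_on_def)+

lemma vtensor_apply_scale:
  assumes V: "is_vspace V" and t: "t \<in> vcar (vtensor V W)" and E: "bilinear_on V W scalars E"
  shows "t (\<lambda>v w. c * E v w) = c * t E"
proof -
  obtain ps where ps: "t = (\<Sum>(v, w)\<leftarrow>ps. ptensor V W v w)"
    using vtensor_sum_list[OF V t] by metis
  have *: "bilinear_on V W scalars (\<lambda>v w. c * E v w)"
    using E by (intro bilinear_onI lin_mult_left) (auto simp: bilinear_on_def)
  show ?thesis
    unfolding ps sum_list_ptensor_apply[OF *] sum_list_ptensor_apply[OF E]
    by (induction ps) (auto simp: distrib_left)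
qed

lemma quadrilinear_on_eval:
  "quadrilinear_on V W (vtensor X Y) F \<Longrightarrow> quadrilinear_on V W scalars (\<lambda>h f k g. F h f k g \<beta>)"
  by (simp add: quadrilinear_on_def bilinear_on_def linear_on_def vtensor_scale)

text \<open>Both sides are linear in each of the three tensors: x is reduced to pure tensors first,
  then y and z together.\<close>

lemma lift2_cocycle_eqI:
  assumes V: "is_vspace V" and W: "is_vspace W"
    and F: "quadrilinear_on V W (vtensor V W) F"
    and \<sigma>: "bilinear_on (vtensor V W) (vtensor V W) scalars \<sigma>"
    and m: "linear_on (vtensor V W) (vtensor V W) m"
    and key: "\<And>h f l p k g. \<lbrakk>h \<in> vcar V; f \<in> vcar W; l \<in> vcar V; p \<in> vcar W; k \<in> vcar V; g \<in> vcar W\<rbrakk> \<Longrightarrow>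
      \<sigma> (m (ptensor V W h f)) (F l p k g) = \<sigma> (F h f l p) (m (ptensor V W k g))"
    and x: "x \<in> vcar (vtensor V W)" and y: "y \<in> vcar (vtensor V W)" and z: "z \<in> vcar (vtensor V W)"
  shows "\<sigma> (m x) (lift2 V W F y z) = \<sigma> (lift2 V W F x y) (m z)"
proof -
  let ?U = "vtensor V W" and ?G = "lift2 V W F"
  note G = lift2_bilinear[OF V W vs_vtensor F]
  have mc: "m u \<in> vcar ?U" if "u \<in> vcar ?U" for u using linear_onD(1)[OF m that] .
  note lins = linear_on_comp[OF bilinear_onD(1)[OF \<sigma>]] linear_on_comp[OF bilinear_onD(2)[OF \<sigma>]]
    bilinear_onD[OF G] m mc
  show ?thesis
  proof (rule vtensor_linear_eqI[where f="\<lambda>x. \<sigma> (m x) (?G y z)" and g="\<lambda>x. \<sigma> (?G x y) (m z)",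
        OF V vs_scalars _ _ _ x])
    show "linear_on ?U scalars (\<lambda>x. \<sigma> (m x) (?G y z))" "linear_on ?U scalars (\<lambda>x. \<sigma> (?G x y) (m z))"
      using y z by (auto intro!: lins)
    fix h f assume hf: "h \<in> vcar V" "f \<in> vcar W"
    then have pt: "ptensor V W h f \<in> vcar ?U" by (rule ptensor_in)
    show "\<sigma> (m (ptensor V W h f)) (?G y z) = \<sigma> (?G (ptensor V W h f) y) (m z)"
    proof (rule vtensor_bilinear_eqI[where F="\<lambda>y z. \<sigma> (m (ptensor V W h f)) (?G y z)"
          and G="\<lambda>y z. \<sigma> (?G (ptensor V W h f) y) (m z)", OF V vs_scalars _ _ _ y z])
      show "bilinear_on ?U ?U scalars (\<lambda>y z. \<sigma> (m (ptensor V W h f)) (?G y z))"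
        "bilinear_on ?U ?U scalars (\<lambda>y z. \<sigma> (?G (ptensor V W h f) y) (m z))"
        using pt by (auto intro!: bilinear_onI lins)
      show "\<sigma> (m (ptensor V W h f)) (?G (ptensor V W l p) (ptensor V W k g)) =
        \<sigma> (?G (ptensor V W h f) (ptensor V W l p)) (m (ptensor V W k g))"
        if "l \<in> vcar V" "p \<in> vcar W" "k \<in> vcar V" "g \<in> vcar W" for l p k g
        using that hf by (simp add: lift2_ptensor[OF V W vs_vtensor F] key)
    qed
  qed
qed

text \<open>\<open>J\<close> is the inverse structure map, supplied as an explicit linear map. For
  the doubles it has a formula on pure tensors, which the \<open>inv_into\<close> behind
  \<open>hinv\<close> does not show.\<close>

locale twist_setup =
  fixes H :: "('k::field, 'v::ab_group_add, 'z) hom_bialg_scheme" (structure)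
    and \<sigma> :: "'v \<Rightarrow> 'v \<Rightarrow> 'k" and J :: "'v \<Rightarrow> 'v"
  assumes vs: "is_vspace H"
    and comul_lin: "linear_on H (vtensor H H) (hcomul H)"
    and mul: "bilinear_on H H H (hmul H)"
    and map_lin: "linear_on H H (hmap H)" and J_lin: "linear_on H H J"
    and J_map: "x \<in> vcar H \<Longrightarrow> J (hmap H x) = x" and map_J: "x \<in> vcar H \<Longrightarrow> hmap H (J x) = x"
    and \<sigma>: "bilinear_on H H scalars \<sigma>"
    and \<sigma>_map: "\<lbrakk>x \<in> vcar H; y \<in> vcar H\<rbrakk> \<Longrightarrow> \<sigma> (hmap H x) (hmap H y) = \<sigma> x y"
begin

lemma hinv_J: "x \<in> vcar H \<Longrightarrow> hinv H 1 x = J x"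
proof -
  assume x: "x \<in> vcar H"
  have "inj_on (hmap H) (vcar H)" by (rule inj_on_inverseI[of _ J]) (rule J_map)
  from inv_into_f_f[OF this linear_onD(1)[OF J_lin x]] show ?thesis
    by (simp add: hinv_def map_J x)
qed

lemma closed [simp]:
  "x \<in> vcar H \<Longrightarrow> y \<in> vcar H \<Longrightarrow> x \<cdot> y \<in> vcar H" "x \<in> vcar H \<Longrightarrow> J x \<in> vcar H"
  "x \<in> vcar H \<Longrightarrow> hmap H x \<in> vcar H"
  using bilinear_onD(3)[OF mul] linear_onD(1)[OF J_lin] linear_onD(1)[OF map_lin] by auto

lemma lin_mul_J:
  "y \<in> vcar H \<Longrightarrow> linear_on H H (\<lambda>x. J (x \<cdot> y))" "y \<in> vcar H \<Longrightarrow> linear_on H H (\<lambda>x. J (y \<cdot> x))"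
  using linear_on_comp[OF J_lin bilinear_onD(2)[OF mul]] linear_on_comp[OF J_lin bilinear_onD(1)[OF mul]]
  by auto

lemma lin_\<sigma>: "y \<in> vcar H \<Longrightarrow> linear_on H scalars (\<lambda>x. \<sigma> x y)" "y \<in> vcar H \<Longrightarrow> linear_on H scalars (\<sigma> y)"
  using bilinear_onD[OF \<sigma>] by auto

lemma lin_vscale_right: "linear_on X H g \<Longrightarrow> linear_on X H (\<lambda>x. vscale H c (g x))"
  by (rule linear_on_scale[OF vs])

lemma lin_vscale_left: "linear_on X scalars g \<Longrightarrow> w \<in> vcar H \<Longrightarrow> linear_on X H (\<lambda>x. vscale H (g x) w)"
  by (rule linear_on_scale_left[OF vs])

lemmas twist_lin = lin_mul_J lin_\<sigma> lin_vscale_right lin_vscale_left lin_sweedler_arg lin_sweedler_body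
  bilinear_onI vs comul_lin linear_on_id vs_scalars lin_mult_left lin_mult_right

definition ltw :: "'v \<Rightarrow> 'v \<Rightarrow> 'v" where
  "ltw x y = sweedler H x (\<lambda>x1 x2. sweedler H y (\<lambda>y1 y2. vscale H (\<sigma> x1 y1) (J (x2 \<cdot> y2))))"

definition rtw :: "'v \<Rightarrow> 'v \<Rightarrow> 'v" where
  "rtw x y = sweedler H x (\<lambda>x1 x2. sweedler H y (\<lambda>y1 y2. vscale H (\<sigma> x2 y2) (J (x1 \<cdot> y1))))"

lemma left_twist_mul: "hmul (left_twist H \<sigma>) x y = ltw x y"
  unfolding left_twist_def ltw_def
  by (simp, intro sweedler_cong) (simp add: hinv_J[simplified])

lemma right_twist_mul: "hmul (right_twist H \<sigma>) x y = rtw x y"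
  unfolding right_twist_def rtw_def
  by (simp, intro sweedler_cong) (simp add: hinv_J[simplified])

lemma ltw_bilinear: "bilinear_on H H H ltw"
  unfolding ltw_def by (auto intro!: twist_lin)

lemma rtw_bilinear: "bilinear_on H H H rtw"
  unfolding rtw_def by (auto intro!: twist_lin)

lemma ltw_apply:
  assumes U: "is_vspace U" and f: "linear_on H U f" and x: "x \<in> vcar H" and y: "y \<in> vcar H"
  shows "f (ltw x y) = sweedler H x (\<lambda>x1 x2. sweedler H y (\<lambda>y1 y2.
    vscale U (\<sigma> x1 y1) (f (J (x2 \<cdot> y2)))))"
proof -
  have "f (ltw x y) = sweedler H x (\<lambda>x1 x2. f (sweedler H y (\<lambda>y1 y2. vscale H (\<sigma> x1 y1) (J (x2 \<cdot> y2)))))"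
    unfolding ltw_def by (rule sweedler_commute[OF vs comul_lin vs U _ f x]) (auto intro!: twist_lin y)
  also have "\<dots> = sweedler H x (\<lambda>x1 x2. sweedler H y (\<lambda>y1 y2. f (vscale H (\<sigma> x1 y1) (J (x2 \<cdot> y2)))))"
    by (intro sweedler_cong sweedler_commute[OF vs comul_lin vs U _ f y]) (auto intro!: twist_lin)
  also have "\<dots> = sweedler H x (\<lambda>x1 x2. sweedler H y (\<lambda>y1 y2. vscale U (\<sigma> x1 y1) (f (J (x2 \<cdot> y2)))))"
    by (intro sweedler_cong linear_onD(3)[OF f]) simp
  finally show ?thesis .
qed

lemma rtw_apply:
  assumes U: "is_vspace U" and f: "linear_on H U f" and x: "x \<in> vcar H" and y: "y \<in> vcar H"
  shows "f (rtw x y) = sweedler H x (\<lambda>x1 x2. sweedler H y (\<lambda>y1 y2.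
    vscale U (\<sigma> x2 y2) (f (J (x1 \<cdot> y1)))))"
proof -
  have "f (rtw x y) = sweedler H x (\<lambda>x1 x2. f (sweedler H y (\<lambda>y1 y2. vscale H (\<sigma> x2 y2) (J (x1 \<cdot> y1)))))"
    unfolding rtw_def by (rule sweedler_commute[OF vs comul_lin vs U _ f x]) (auto intro!: twist_lin y)
  also have "\<dots> = sweedler H x (\<lambda>x1 x2. sweedler H y (\<lambda>y1 y2. f (vscale H (\<sigma> x2 y2) (J (x1 \<cdot> y1)))))"
    by (intro sweedler_cong sweedler_commute[OF vs comul_lin vs U _ f y]) (auto intro!: twist_lin)
  also have "\<dots> = sweedler H x (\<lambda>x1 x2. sweedler H y (\<lambda>y1 y2. vscale U (\<sigma> x2 y2) (f (J (x1 \<cdot> y1)))))"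
    by (intro sweedler_cong linear_onD(3)[OF f]) simp
  finally show ?thesis .
qed

lemma \<sigma>_J:
  "x \<in> vcar H \<Longrightarrow> y \<in> vcar H \<Longrightarrow> \<sigma> x (J y) = \<sigma> (hmap H x) y"
  "x \<in> vcar H \<Longrightarrow> y \<in> vcar H \<Longrightarrow> \<sigma> (J x) y = \<sigma> x (hmap H y)"
  using \<sigma>_map[of x "J y"] \<sigma>_map[of "J x" y] by (simp_all add: map_J)

text \<open>Invariance of \<sigma> under \<alpha> moves the \<open>J\<close> in the twisted product
  to the other argument as an \<alpha>. This produces exactly the second power of \<alpha> in the
  cocycle condition.\<close>

lemma left_cocycleI:
  assumes key: "\<And>h l k. \<lbrakk>h \<in> vcar H; l \<in> vcar H; k \<in> vcar H\<rbrakk> \<Longrightarrow>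
    \<sigma> (hmap H h) (ltw l k) = \<sigma> (ltw h l) (hmap H k)"
  shows "left_hom_cocycle H \<sigma>"
  unfolding left_hom_cocycle_def
proof (intro conjI ballI \<sigma> \<sigma>_map)
  fix h l k assume [simp]: "h \<in> vcar H" "l \<in> vcar H" "k \<in> vcar H"
  have "sweedler H l (\<lambda>l1 l2. sweedler H k (\<lambda>k1 k2. \<sigma> l1 k1 * \<sigma> ((hmap H ^^ 2) h) (l2 \<cdot> k2)))
    = \<sigma> (hmap H h) (ltw l k)"
    by (subst ltw_apply[OF vs_scalars lin_\<sigma>(2)])
       (auto intro!: sweedler_cong simp: \<sigma>_J numeral_2_eq_2)
  also have "\<dots> = \<sigma> (ltw h l) (hmap H k)"
    by (rule key) simp_all
  also have "\<dots> = sweedler H h (\<lambda>h1 h2. sweedler H l (\<lambda>l1 l2. \<sigma> h1 l1 * \<sigma> (h2 \<cdot> l2) ((hmap H ^^ 2) k)))"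
    by (subst ltw_apply[OF vs_scalars lin_\<sigma>(1)])
       (auto intro!: sweedler_cong simp: \<sigma>_J numeral_2_eq_2)
  finally show "sweedler H l (\<lambda>l1 l2. sweedler H k (\<lambda>k1 k2. \<sigma> l1 k1 * \<sigma> ((hmap H ^^ 2) h) (l2 \<cdot> k2)))
    = sweedler H h (\<lambda>h1 h2. sweedler H l (\<lambda>l1 l2. \<sigma> h1 l1 * \<sigma> (h2 \<cdot> l2) ((hmap H ^^ 2) k)))" .
qed

lemma right_cocycleI:
  assumes key: "\<And>h l k. \<lbrakk>h \<in> vcar H; l \<in> vcar H; k \<in> vcar H\<rbrakk> \<Longrightarrow>
    \<sigma> (hmap H h) (rtw l k) = \<sigma> (rtw h l) (hmap H k)"
  shows "right_hom_cocycle H \<sigma>"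
  unfolding right_hom_cocycle_def
proof (intro conjI ballI \<sigma> \<sigma>_map)
  fix h l k assume [simp]: "h \<in> vcar H" "l \<in> vcar H" "k \<in> vcar H"
  have "sweedler H l (\<lambda>l1 l2. sweedler H k (\<lambda>k1 k2. \<sigma> ((hmap H ^^ 2) h) (l1 \<cdot> k1) * \<sigma> l2 k2))
    = \<sigma> (hmap H h) (rtw l k)"
    by (subst rtw_apply[OF vs_scalars lin_\<sigma>(2)])
       (auto intro!: sweedler_cong simp: \<sigma>_J numeral_2_eq_2)
  also have "\<dots> = \<sigma> (rtw h l) (hmap H k)"
    by (rule key) simp_all
  also have "\<dots> = sweedler H h (\<lambda>h1 h2. sweedler H l (\<lambda>l1 l2. \<sigma> (h1 \<cdot> l1) ((hmap H ^^ 2) k) * \<sigma> h2 l2))"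
    by (subst rtw_apply[OF vs_scalars lin_\<sigma>(1)])
       (auto intro!: sweedler_cong simp: \<sigma>_J numeral_2_eq_2)
  finally show "sweedler H l (\<lambda>l1 l2. sweedler H k (\<lambda>k1 k2. \<sigma> ((hmap H ^^ 2) h) (l1 \<cdot> k1) * \<sigma> l2 k2))
    = sweedler H h (\<lambda>h1 h2. sweedler H l (\<lambda>l1 l2. \<sigma> (h1 \<cdot> l1) ((hmap H ^^ 2) k) * \<sigma> h2 l2))" .
qed

end

text \<open>The common shape of the two doubles: tensor coproduct and tensor structure map, while
  the product formula \<open>F\<close> and the cocycle formula \<open>c\<close> are left open. The
  maps \<open>iV\<close> and \<open>iW\<close> invert the structure maps of the factors.\<close>

locale tensor_double =
  fixes V :: "('k::field, 'v::ab_group_add, 'z) hom_bialg_scheme"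
    and W :: "('k, 'w::ab_group_add, 'y) hom_bialg_scheme"
    and H :: "('k, ('v, 'w, 'k) tensor, 'x) hom_bialg_scheme" (structure)
    and \<sigma> :: "('v, 'w, 'k) tensor \<Rightarrow> ('v, 'w, 'k) tensor \<Rightarrow> 'k"
    and F c mV mW iV iW
  assumes vsV: "is_vspace V" and vsW: "is_vspace W"
    and comulV: "linear_on V (vtensor V V) (hcomul V)"
    and comulW: "linear_on W (vtensor W W) (hcomul W)"
    and F: "quadrilinear_on V W (vtensor V W) F" and c: "quadrilinear_on V W scalars c"
    and mV: "linear_on V V mV" and mW: "linear_on W W mW"
    and iV: "linear_on V V iV" and iW: "linear_on W W iW"
    and inverse: "\<And>v. v \<in> vcar V \<Longrightarrow> iV (mV v) = v" "\<And>v. v \<in> vcar V \<Longrightarrow> mV (iV v) = v"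
      "\<And>w. w \<in> vcar W \<Longrightarrow> iW (mW w) = w" "\<And>w. w \<in> vcar W \<Longrightarrow> mW (iW w) = w"
    and c_map: "\<And>h f k g. \<lbrakk>h \<in> vcar V; f \<in> vcar W; k \<in> vcar V; g \<in> vcar W\<rbrakk> \<Longrightarrow>
      c (mV h) (mW f) (mV k) (mW g) = c h f k g"
    and H: "vcar H = vcar (vtensor V W)" "vscale H = vscale (vtensor V W)" "hmul H = lift2 V W F"
      "hcomul H = tensor_lift V W (\<lambda>h f. sweedler V h (\<lambda>h1 h2. sweedler W f (\<lambda>f1 f2.
        ptensor (vtensor V W) (vtensor V W) (ptensor V W h1 f1) (ptensor V W h2 f2))))"
      "hmap H = tensor_lift V W (\<lambda>h f. ptensor V W (mV h) (mW f))"
    and \<sigma>: "\<sigma> = lift2 V W c"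
begin

abbreviation VW where "VW \<equiv> vtensor V W"
abbreviation pt where "pt \<equiv> ptensor V W"

definition J where "J = tensor_lift V W (\<lambda>h f. pt (iV h) (iW f))"

lemma H_linear: "linear_on H U = linear_on VW U" "linear_on U' H = linear_on U' VW"
  by (intro linear_on_subst H)+

lemma H_bilinear: "bilinear_on H H U = bilinear_on VW VW U"
  by (intro bilinear_on_cong H refl)

lemma H_vtensor: "vtensor H H = vtensor VW VW"
  by (intro vtensor_cong H)

lemma vsH: "is_vspace H"
  using vs_cong[of H VW] vs_vtensor H by blast

lemma pt_lin:
  assumes "linear_on V V f" "linear_on W W g"
  shows "bilinear_on V W VW (\<lambda>v w. pt (f v) (g w))"
  by (rule bilinear_on_comp[OF ptensor_bilinear assms])

lemma map_lin: "linear_on VW VW (hmap H)" "linear_on VW VW J"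
  unfolding H J_def by (intro tensor_lift_linear vsV vs_vtensor pt_lin mV mW iV iW)+

lemma map_pt [simp]:
  assumes "h \<in> vcar V" "f \<in> vcar W"
  shows "hmap H (pt h f) = pt (mV h) (mW f)" "J (pt h f) = pt (iV h) (iW f)"
  unfolding H J_def using assms
  by (simp_all add: tensor_lift_ptensor[OF vs_vtensor pt_lin] mV mW iV iW)

lemma maps_closed [simp]: "h \<in> vcar V \<Longrightarrow> mV h \<in> vcar V" "h \<in> vcar V \<Longrightarrow> iV h \<in> vcar V"
  "f \<in> vcar W \<Longrightarrow> mW f \<in> vcar W" "f \<in> vcar W \<Longrightarrow> iW f \<in> vcar W"
  using mV mW iV iW by (auto simp: linear_on_def)

lemma pt_closed [simp]: "h \<in> vcar V \<Longrightarrow> f \<in> vcar W \<Longrightarrow> pt h f \<in> vcar VW"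
  by (rule ptensor_in)

lemma J_apply:
  assumes "z \<in> vcar VW" "linear_on VW scalars \<tau>"
  shows "\<tau> (J z) = z (\<lambda>v w. \<tau> (pt (iV v) (iW w)))"
  unfolding J_def by (rule tensor_lift_apply[OF vsV pt_lin[OF iV iW] assms(2) vs_vtensor assms(1)])

lemmas pt_lins = lin_bilinear_left[OF ptensor_bilinear] lin_bilinear_right[OF ptensor_bilinear]
  linear_on_id bilinear_onI vs_vtensor vsV vsW comulV comulW lin_sweedler_arg lin_sweedler_body

definition dcomul where
  "dcomul h f = sweedler V h (\<lambda>h1 h2. sweedler W f (\<lambda>f1 f2.
     ptensor VW VW (pt h1 f1) (pt h2 f2)))"

lemma dcomul_bilinear: "bilinear_on V W (vtensor VW VW) dcomul"
  unfolding dcomul_def by (auto intro!: pt_lins)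

lemmas mul_bilinear = lift2_bilinear[OF vsV vsW vs_vtensor F]
lemmas \<sigma>_bilinear = lift2_bilinear[OF vsV vsW vs_scalars c, folded \<sigma>]

sublocale D: twist_setup H \<sigma> J
proof
  show "is_vspace H" by (rule vsH)
  show "linear_on H (vtensor H H) (hcomul H)"
    unfolding H_linear H_vtensor H(4) dcomul_def[symmetric]
    by (rule tensor_lift_linear[OF vsV vs_vtensor dcomul_bilinear])
  show "bilinear_on H H H (hmul H)"
    using mul_bilinear by (simp add: bilinear_on_def H_linear H)
  show "linear_on H H (hmap H)" "linear_on H H J"
    unfolding H_linear by (rule map_lin)+
  show "bilinear_on H H scalars \<sigma>"
    unfolding H_bilinear by (rule \<sigma>_bilinear)
  fix x assume x: "x \<in> vcar H"
  show "J (hmap H x) = x"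
    by (rule vtensor_linear_eqI[where f="\<lambda>x. J (hmap H x)" and g="\<lambda>x. x",
          OF vsV vs_vtensor linear_on_comp[OF map_lin(2,1)] linear_on_id])
       (use x in \<open>simp_all add: H(1) inverse\<close>)
  show "hmap H (J x) = x"
    by (rule vtensor_linear_eqI[where f="\<lambda>x. hmap H (J x)" and g="\<lambda>x. x",
          OF vsV vs_vtensor linear_on_comp[OF map_lin(1,2)] linear_on_id])
       (use x in \<open>simp_all add: H(1) inverse\<close>)
  fix y assume y: "y \<in> vcar H"
  show "\<sigma> (hmap H x) (hmap H y) = \<sigma> x y"
    by (rule vtensor_bilinear_eqI[where F="\<lambda>x y. \<sigma> (hmap H x) (hmap H y)" and G=\<sigma>,
          OF vsV vs_scalars bilinear_on_comp[OF \<sigma>_bilinear map_lin(1,1)] \<sigma>_bilinear])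
       (use x y in \<open>simp_all add: H(1) \<sigma> c_map lift2_ptensor[OF vsV vsW vs_scalars c]\<close>)
qed

lemma sweedler_pt:
  assumes h: "h \<in> vcar V" and f: "f \<in> vcar W" and E: "bilinear_on VW VW scalars E"
  shows "sweedler H (pt h f) E =
    sweedler V h (\<lambda>h1 h2. sweedler W f (\<lambda>f1 f2. E (pt h1 f1) (pt h2 f2)))"
proof -
  note lins = linear_on_comp[OF bilinear_onD(1)[OF E]] linear_on_comp[OF bilinear_onD(2)[OF E]]
  have "sweedler H (pt h f) E = hcomul H (pt h f) E"
    using h f E by (intro sweedler_scalar D.vs D.comul_lin) (simp_all add: H_bilinear H)
  also have "\<dots> = dcomul h f E"
    unfolding H dcomul_def[symmetric]
    by (simp add: tensor_lift_ptensor[OF vs_vtensor dcomul_bilinear h f])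
  also have "\<dots> = sweedler V h (\<lambda>h1 h2. sweedler W f (\<lambda>f1 f2.
      ptensor VW VW (pt h1 f1) (pt h2 f2)) E)"
    unfolding dcomul_def
    by (rule sweedler_commute[where f="\<lambda>t. t E", OF vsV comulV vs_vtensor vs_scalars _ lin_eval_vtensor])
       (auto intro!: pt_lins h f)
  also have "\<dots> = sweedler V h (\<lambda>h1 h2. sweedler W f (\<lambda>f1 f2.
      ptensor VW VW (pt h1 f1) (pt h2 f2) E))"
    by (intro sweedler_cong sweedler_commute[where f="\<lambda>t. t E", OF vsW comulW vs_vtensor vs_scalars _ lin_eval_vtensor])
       (auto intro!: pt_lins h f)
  finally show ?thesis by (simp add: ptensor_apply[OF E])
qed

context
  fixes \<tau> h f k g
  assumes \<tau>: "linear_on VW scalars \<tau>"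
    and [simp]: "h \<in> vcar V" "f \<in> vcar W" "k \<in> vcar V" "g \<in> vcar W"
begin

lemma twist_term_linear:
  assumes "x \<in> vcar VW" "y \<in> vcar VW" "z \<in> vcar VW"
  shows "linear_on VW scalars (\<lambda>w. \<sigma> w x * \<tau> (J (lift2 V W F y z)))"
    "linear_on VW scalars (\<lambda>w. \<sigma> x w * \<tau> (J (lift2 V W F y z)))"
    "linear_on VW scalars (\<lambda>w. \<sigma> x y * \<tau> (J (lift2 V W F w z)))"
    "linear_on VW scalars (\<lambda>w. \<sigma> x y * \<tau> (J (lift2 V W F z w)))"
  using assms linear_on_comp[OF linear_on_comp[OF \<tau> map_lin(2)]]
  by (auto intro!: lin_mult_left lin_mult_right bilinear_onD[OF mul_bilinear] bilinear_onD[OF \<sigma>_bilinear])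

lemma twist_term_pt:
  assumes "h1 \<in> vcar V" "f1 \<in> vcar W" "k1 \<in> vcar V" "g1 \<in> vcar W"
    "h2 \<in> vcar V" "f2 \<in> vcar W" "k2 \<in> vcar V" "g2 \<in> vcar W"
  shows "\<sigma> (pt h1 f1) (pt k1 g1) * \<tau> (J (lift2 V W F (pt h2 f2) (pt k2 g2))) =
    c h1 f1 k1 g1 * \<tau> (J (F h2 f2 k2 g2))"
  using assms by (simp add: \<sigma> lift2_ptensor[OF vsV vsW vs_scalars c]
    lift2_ptensor[OF vsV vsW vs_vtensor F])

lemmas sweedler_pt_lins = bilinear_onI lin_sweedler_body D.vs D.comul_lin vs_scalars
  vs_vtensor twist_term_linear

text \<open>Read through a linear form \<tau>, the twisted product of pure tensors is a fourfold sum
  of scalars, over the legs of the four factors, and the tensors no longer interfere.\<close>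

lemma ltw_pt:
  "\<tau> (D.ltw (pt h f) (pt k g)) = sweedler V h (\<lambda>h1 h2. sweedler W f (\<lambda>f1 f2.
     sweedler V k (\<lambda>k1 k2. sweedler W g (\<lambda>g1 g2. c h1 f1 k1 g1 * \<tau> (J (F h2 f2 k2 g2))))))"
proof -
  have "\<tau> (D.ltw (pt h f) (pt k g)) = sweedler H (pt h f) (\<lambda>x1 x2. sweedler H (pt k g) (\<lambda>y1 y2.
      \<sigma> x1 y1 * \<tau> (J (lift2 V W F x2 y2))))"
    using D.ltw_apply[OF vs_scalars, of \<tau> "pt h f" "pt k g"] \<tau> by (simp add: H_linear H)
  also have "\<dots> = sweedler V h (\<lambda>h1 h2. sweedler W f (\<lambda>f1 f2. sweedler H (pt k g) (\<lambda>y1 y2.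
      \<sigma> (pt h1 f1) y1 * \<tau> (J (lift2 V W F (pt h2 f2) y2)))))"
    by (rule sweedler_pt) (auto simp: H_bilinear H_linear H intro!: sweedler_pt_lins)
  also have "\<dots> = sweedler V h (\<lambda>h1 h2. sweedler W f (\<lambda>f1 f2. sweedler V k (\<lambda>k1 k2. sweedler W g (\<lambda>g1 g2.
      \<sigma> (pt h1 f1) (pt k1 g1) * \<tau> (J (lift2 V W F (pt h2 f2) (pt k2 g2)))))))"
    by (intro sweedler_cong sweedler_pt) (auto intro!: bilinear_onI twist_term_linear)
  finally show ?thesis
    by (simp add: twist_term_pt cong: sweedler_cong)
qed

lemma rtw_pt:
  "\<tau> (D.rtw (pt h f) (pt k g)) = sweedler V h (\<lambda>h1 h2. sweedler W f (\<lambda>f1 f2.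
     sweedler V k (\<lambda>k1 k2. sweedler W g (\<lambda>g1 g2. c h2 f2 k2 g2 * \<tau> (J (F h1 f1 k1 g1))))))"
proof -
  have "\<tau> (D.rtw (pt h f) (pt k g)) = sweedler H (pt h f) (\<lambda>x1 x2. sweedler H (pt k g) (\<lambda>y1 y2.
      \<sigma> x2 y2 * \<tau> (J (lift2 V W F x1 y1))))"
    using D.rtw_apply[OF vs_scalars, of \<tau> "pt h f" "pt k g"] \<tau> by (simp add: H_linear H)
  also have "\<dots> = sweedler V h (\<lambda>h1 h2. sweedler W f (\<lambda>f1 f2. sweedler H (pt k g) (\<lambda>y1 y2.
      \<sigma> (pt h2 f2) y2 * \<tau> (J (lift2 V W F (pt h1 f1) y1)))))"
    by (rule sweedler_pt) (auto simp: H_bilinear H_linear H intro!: sweedler_pt_lins)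
  also have "\<dots> = sweedler V h (\<lambda>h1 h2. sweedler W f (\<lambda>f1 f2. sweedler V k (\<lambda>k1 k2. sweedler W g (\<lambda>g1 g2.
      \<sigma> (pt h2 f2) (pt k2 g2) * \<tau> (J (lift2 V W F (pt h1 f1) (pt k1 g1)))))))"
    by (intro sweedler_cong sweedler_pt) (auto intro!: bilinear_onI twist_term_linear)
  finally show ?thesis
    by (simp add: twist_term_pt cong: sweedler_cong)
qed

end

text \<open>Freezing one argument of the cocycle at a pure tensor leaves a bilinear form, and
  pairing with it is application of the tensor z.\<close>

lemma \<sigma>_left:
  assumes hf: "h \<in> vcar V" "f \<in> vcar W" and z: "z \<in> vcar VW"
  shows "\<sigma> (pt h f) z = z (c h f)"
proof -
  have "\<sigma> (pt h f) z = tensor_lift V W (c h f) z"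
    unfolding \<sigma> lift2_def
    by (rule tensor_lift_ptensor[OF vs_scalars lift2_bilinear_inner[OF vsV vsW vs_scalars c z] hf])
  then show ?thesis
    by (simp add: tensor_lift_scalar[OF vsV _ z] quadrilinear_onD[OF c] hf)
qed

lemma \<sigma>_right:
  assumes kg: "k \<in> vcar V" "g \<in> vcar W" and z: "z \<in> vcar VW"
  shows "\<sigma> z (pt k g) = z (\<lambda>h f. c h f k g)"
proof -
  have "\<sigma> z (pt k g) = tensor_lift V W (\<lambda>h f. c h f k g) z"
    unfolding \<sigma> lift2_def
    by (intro tensor_lift_cong tensor_lift_ptensor[OF vs_scalars])
       (simp_all add: quadrilinear_onD[OF c] kg)
  then show ?thesis
    by (simp add: tensor_lift_scalar[OF vsV _ z] quadrilinear_onD[OF c] kg)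
qed

lemma lift2_cocycle:
  assumes G: "quadrilinear_on V W VW G"
    and key: "\<And>h f l p k g. \<lbrakk>h \<in> vcar V; f \<in> vcar W; l \<in> vcar V; p \<in> vcar W; k \<in> vcar V; g \<in> vcar W\<rbrakk> \<Longrightarrow>
      \<sigma> (pt (mV h) (mW f)) (G l p k g) = \<sigma> (G h f l p) (pt (mV k) (mW g))"
    and "x \<in> vcar VW" "y \<in> vcar VW" "z \<in> vcar VW"
  shows "\<sigma> (hmap H x) (lift2 V W G y z) = \<sigma> (lift2 V W G x y) (hmap H z)"
  by (rule lift2_cocycle_eqI[OF vsV vsW G \<sigma>_bilinear map_lin(1) _ assms(3-5)]) (simp add: key)

lemma lift2_eqI:
  assumes G: "quadrilinear_on V W VW G" and T: "bilinear_on H H H T"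
    and "\<And>h f k g. \<lbrakk>h \<in> vcar V; f \<in> vcar W; k \<in> vcar V; g \<in> vcar W\<rbrakk> \<Longrightarrow> T (pt h f) (pt k g) = G h f k g"
    and "x \<in> vcar VW" "y \<in> vcar VW"
  shows "T x y = lift2 V W G x y"
proof (rule vtensor_bilinear_eqI[where F=T and G="lift2 V W G", OF vsV vs_vtensor _ _ _ assms(4,5)])
  show "bilinear_on VW VW VW T"
    using T by (simp add: bilinear_on_def H_linear H)
qed (simp_all add: lift2_bilinear[OF vsV vsW vs_vtensor G] assms(3)
  lift2_ptensor[OF vsV vsW vs_vtensor G])

text \<open>One formula \<open>G\<close> for the twisted product serves twice: it identifies the
  twist with X, and it turns the cocycle condition into an identity between pairings with
  \<open>G\<close> on pure tensors.\<close>

lemma left_twistI: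
  assumes G: "quadrilinear_on V W VW G"
    and tw: "\<And>h f k g. \<lbrakk>h \<in> vcar V; f \<in> vcar W; k \<in> vcar V; g \<in> vcar W\<rbrakk> \<Longrightarrow>
      D.ltw (pt h f) (pt k g) = G h f k g"
    and key: "\<And>h f l p k g. \<lbrakk>h \<in> vcar V; f \<in> vcar W; l \<in> vcar V; p \<in> vcar W; k \<in> vcar V; g \<in> vcar W\<rbrakk> \<Longrightarrow>
      \<sigma> (pt (mV h) (mW f)) (G l p k g) = \<sigma> (G h f l p) (pt (mV k) (mW g))"
    and X: "vcar X = vcar VW" "vscale X = vscale VW" "hmul X = lift2 V W G"
  shows "left_hom_cocycle H \<sigma> \<and> same_alg X (left_twist H \<sigma>)"
proof
  note eq = lift2_eqI[OF G D.ltw_bilinear tw]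
  show "left_hom_cocycle H \<sigma>"
    by (rule D.left_cocycleI) (simp add: eq H(1) lift2_cocycle[OF G key])
  have "vcar (left_twist H \<sigma>) = vcar VW" "vscale (left_twist H \<sigma>) = vscale VW"
    by (simp_all add: left_twist_def H)
  then show "same_alg X (left_twist H \<sigma>)"
    by (simp add: same_alg_def X D.left_twist_mul eq)
qed

lemma right_twistI:
  assumes G: "quadrilinear_on V W VW G"
    and tw: "\<And>h f k g. \<lbrakk>h \<in> vcar V; f \<in> vcar W; k \<in> vcar V; g \<in> vcar W\<rbrakk> \<Longrightarrow>
      D.rtw (pt h f) (pt k g) = G h f k g"
    and key: "\<And>h f l p k g. \<lbrakk>h \<in> vcar V; f \<in> vcar W; l \<in> vcar V; p \<in> vcar W; k \<in> vcar V; g \<in> vcar W\<rbrakk> \<Longrightarrow>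
      \<sigma> (pt (mV h) (mW f)) (G l p k g) = \<sigma> (G h f l p) (pt (mV k) (mW g))"
    and X: "vcar X = vcar VW" "vscale X = vscale VW" "hmul X = lift2 V W G"
  shows "right_hom_cocycle H \<sigma> \<and> same_alg X (right_twist H \<sigma>)"
proof
  note eq = lift2_eqI[OF G D.rtw_bilinear tw]
  show "right_hom_cocycle H \<sigma>"
    by (rule D.right_cocycleI) (simp add: eq H(1) lift2_cocycle[OF G key])
  have "vcar (right_twist H \<sigma>) = vcar VW" "vscale (right_twist H \<sigma>) = vscale VW"
    by (simp_all add: right_twist_def H)
  then show "same_alg X (right_twist H \<sigma>)"
    by (simp add: same_alg_def X D.right_twist_mul eq)
qed

end

section \<open>The opposite algebra and its dual\<close>

lemma hom_op_simps [simp]: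
  "vcar (hom_op X) = vcar X" "vscale (hom_op X) = vscale X" "hmul (hom_op X) a b = hmul X b a"
  "hone (hom_op X) = hone X" "hcomul (hom_op X) = hcomul X" "hcounit (hom_op X) = hcounit X"
  "hmap (hom_op X) = hmap X"
  by (simp_all add: hom_op_def)

lemma linear_on_hom_op: "linear_on (hom_op X) = linear_on X" "linear_on U (hom_op X) = linear_on U X"
  by (intro ext; simp add: linear_on_def)+

lemma dual_space_hom_op: "dual_space (hom_op X) = dual_space X"
  by (simp add: dual_space_def linear_on_hom_op)

lemma hinv_hom_op: "hinv (hom_op X) = hinv X"
  by (simp add: hinv_def fun_eq_iff)

lemma form_on_hom_op: "form_on (hom_op X) = form_on X"
  by (simp add: form_on_def fun_eq_iff)

lemma dual_pow_hom_op: "dual_pow (hom_op X) = dual_pow X"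
  by (simp add: dual_pow_def fun_eq_iff form_on_hom_op)

lemma sweedler_hom_op: "sweedler (hom_op X) = sweedler X"
  by (intro ext) (simp add: sweedler_def tensor_lift_scheme_cong[of "hom_op X" X "hom_op X" X])

text \<open>Product and structure map of the dual are built from \<Delta> and \<alpha>, which the
  opposite algebra shares with A. Only the dual coproduct sees the order of multiplication.\<close>

lemma hom_dual_hom_op:
  "hmul (hom_dual (hom_op X)) = hmul (hom_dual X)" "hmap (hom_dual (hom_op X)) = hmap (hom_dual X)"
  by (simp_all add: hom_dual_def sweedler_hom_op hinv_hom_op form_on_hom_op)

lemma reg_act_hom_op: "reg_act (hom_op X) = reg_act X"
  by (intro ext) (simp add: reg_act_def sweedler_hom_op)

section \<open>Operations on the dual in terms of the untwisted Hopf algebra\<close>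

context fd_hom_hopf begin

abbreviation "Dl \<equiv> dual_space A"
abbreviation "Aop' \<equiv> hom_dual (hom_op A)"
abbreviation "A' \<equiv> hom_dual A"
abbreviation "AD \<equiv> vtensor A Dl"
abbreviation "DA \<equiv> vtensor Dl A"
abbreviation "DD \<equiv> drinfeld_double A"
abbreviation "DT \<equiv> drinfeld_double_tilde A"
abbreviation "\<sigma> \<equiv> double_cocycle A"
abbreviation "\<eta> \<equiv> double_tilde_cocycle A"
abbreviation "pt \<equiv> ptensor A Dl"
abbreviation "qt \<equiv> ptensor Dl A"

lemma dual_lin: "f \<in> vcar Dl \<Longrightarrow> lin A f"
  by (simp add: dual_space_simps)

lemma lin_dual_comp: "f \<in> vcar Dl \<Longrightarrow> linear_on X A g \<Longrightarrow> linear_on X scalars (\<lambda>x. f (g x))"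
  using linear_on_comp[OF dual_lin] .

lemma lin_eval: "linear_on X Dl F \<Longrightarrow> linear_on X scalars (\<lambda>x. F x y)"
  using linear_on_comp[OF eval_dual_linear] .

lemmas lin_sweedler_A = lin_sweedler_arg[OF vsA comul_lin] lin_sweedler_body[OF vsA comul_lin]

lemmas A_lins = lin_mul_left lin_mul_right lin_al lin_ai lin_S_A lin_eps_A linear_on_id
  H.lin_T linear_on_comp[OF bilinear_onD(1)[OF um_bilinear]] linear_on_comp[OF bilinear_onD(2)[OF um_bilinear]]

lemma pow_closed: "x \<in> vcar A \<Longrightarrow> (al ^^ n) x \<in> vcar A"
  by (induction n) auto

lemma lin_pow: "linear_on A A (al ^^ n)"
  by (induction n) (auto simp: linear_on_def linear_onD[OF alg.map_linear] pow_closed)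

lemma dual_pow_linear: "linear_on Dl Dl (dual_pow A n)"
  unfolding dual_pow_def
  by (intro lin_into_dual vsA eval_dual_linear lin_dual_comp lin_pow)

lemma dual_lact_bilinear: "bilinear_on A Dl Dl (dual_lact A)"
  unfolding dual_lact_def hinv_simps
  by (intro bilinear_onI lin_into_dual vsA eval_dual_linear lin_dual_comp) (auto intro!: A_lins)

lemma dual_ract_bilinear: "bilinear_on Dl A Dl (dual_ract A)"
  unfolding dual_ract_def hinv_simps
  by (intro bilinear_onI lin_into_dual vsA eval_dual_linear lin_dual_comp) (auto intro!: A_lins)

lemma hom_dual_map_linear: "linear_on Dl Dl (hmap A')"
  unfolding hom_dual_def hinv_simps
  by (simp, intro lin_into_dual vsA eval_dual_linear lin_dual_comp) (auto intro!: A_lins)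

lemma hom_dual_mul_bilinear: "bilinear_on Dl Dl Dl (hmul A')"
  unfolding hom_dual_def hinv_simps
  by (simp, intro bilinear_onI lin_into_dual vsA lin_sweedler_A vs_scalars vs_dual
      linear_on_id lin_mult_left lin_mult_right eval_dual_linear lin_dual_comp)
     (auto intro!: A_lins)

lemma dual_pow_apply [simp]: "y \<in> vcar A \<Longrightarrow> dual_pow A n f y = f ((al ^^ n) y)"
  by (simp add: dual_pow_def)

lemma dual_lact_apply [simp]: "y \<in> vcar A \<Longrightarrow> dual_lact A h f y = f (ai (ai y) \<cdot> h)"
  by (simp add: dual_lact_def hinv_simps)

lemma dual_ract_apply [simp]: "y \<in> vcar A \<Longrightarrow> dual_ract A f h y = f (h \<cdot> ai (ai y))"
  by (simp add: dual_ract_def hinv_simps)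

lemma hom_dual_map_apply [simp]: "y \<in> vcar A \<Longrightarrow> hmap A' f y = f (ai y)"
  unfolding hom_dual_def hinv_simps by simp

text \<open>One of the two inverse powers of \<alpha> in the definition is used up by the conversion
  to the untwisted coproduct.\<close>

lemma hom_dual_mul_apply:
  assumes f: "f \<in> vcar Dl" and g: "g \<in> vcar Dl" and y: "y \<in> vcar A"
  shows "hmul A' f g y = H.sw y (\<lambda>y1 y2. f (ai y1) * g (ai y2))"
proof -
  note li = bilinear_onI lin_mult_left lin_mult_right lin_dual_comp[OF f] lin_dual_comp[OF g] A_lins
  have "hmul A' f g y = sweedler A y (\<lambda>y1 y2. f (ai (ai y1)) * g (ai (ai y2)))"
    using y by (simp add: hom_dual_def hinv_simps)
  also have "\<dots> = H.sw (al y) (\<lambda>y1 y2. f (ai (ai y1)) * g (ai (ai y2)))"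
    using y by (intro sweedler_sw) (auto intro!: li)
  also have "\<dots> = H.sw y (\<lambda>y1 y2. f (ai (ai (al y1))) * g (ai (ai (al y2))))"
    using y by (intro sw_al) (auto intro!: li)
  also have "\<dots> = H.sw y (\<lambda>y1 y2. f (ai y1) * g (ai y2))"
    by (rule H.sw_cong) simp
  finally show ?thesis .
qed

lemma closed_dual [simp]:
  "f \<in> vcar Dl \<Longrightarrow> dual_pow A n f \<in> vcar Dl"
  "h \<in> vcar A \<Longrightarrow> f \<in> vcar Dl \<Longrightarrow> dual_lact A h f \<in> vcar Dl"
  "h \<in> vcar A \<Longrightarrow> f \<in> vcar Dl \<Longrightarrow> dual_ract A f h \<in> vcar Dl"
  "f \<in> vcar Dl \<Longrightarrow> hmap A' f \<in> vcar Dl"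
  "f \<in> vcar Dl \<Longrightarrow> g \<in> vcar Dl \<Longrightarrow> hmul A' f g \<in> vcar Dl"
  using linear_onD(1)[OF dual_pow_linear] bilinear_onD(3)[OF dual_lact_bilinear]
    bilinear_onD(3)[OF dual_ract_bilinear] linear_onD(1)[OF hom_dual_map_linear]
    bilinear_onD(3)[OF hom_dual_mul_bilinear] by auto

lemmas dual_lins =
  linear_on_comp[OF dual_pow_linear] linear_on_comp[OF hom_dual_map_linear]
  lin_bilinear_left[OF dual_lact_bilinear] lin_bilinear_right[OF dual_lact_bilinear]
  lin_bilinear_left[OF dual_ract_bilinear] lin_bilinear_right[OF dual_ract_bilinear]
  lin_bilinear_left[OF hom_dual_mul_bilinear] lin_bilinear_right[OF hom_dual_mul_bilinear]

lemma hinv2_lin: "linear_on A A (hinv A 2)"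
  using lin_ai[OF ai_linear] by (simp add: linear_on_def hinv_simps)

lemmas comul_dual_linear = hom_dual_comul_linear[OF vsA frame_A alg.mul_bilinear hinv2_lin]

lemma frame_op: "is_vspace (hom_op A)" "coord_frame (hom_op A) B (\<lambda>i. i) e"
  "bilinear_on (hom_op A) (hom_op A) (hom_op A) (hmul (hom_op A))"
  "linear_on (hom_op A) (hom_op A) (hinv (hom_op A) 2)"
proof -
  show "is_vspace (hom_op A)" using vsA vs_cong[of "hom_op A" A] by simp
  show "coord_frame (hom_op A) B (\<lambda>i. i) e"
    using frame_A by (simp add: coord_frame_def dual_space_hom_op)
  show "bilinear_on (hom_op A) (hom_op A) (hom_op A) (hmul (hom_op A))"
    using alg.mul_bilinear by (simp add: bilinear_on_def linear_on_hom_op)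
  show "linear_on (hom_op A) (hom_op A) (hinv (hom_op A) 2)"
    using hinv2_lin by (simp add: linear_on_hom_op hinv_hom_op)
qed

lemmas comul_dual_op_linear = hom_dual_comul_linear[OF frame_op]

lemma comul_dual_in:
  "f \<in> vcar Dl \<Longrightarrow> hcomul A' f \<in> vcar (vtensor Dl Dl)"
  "f \<in> vcar Dl \<Longrightarrow> hcomul Aop' f \<in> vcar (vtensor Dl Dl)"
  using linear_onD(1)[OF comul_dual_linear, of f] linear_onD(1)[OF comul_dual_op_linear, of f]
  by (simp_all add: ptensor_hom_dual dual_space_hom_op)

lemma bilinear_on_dual:
  "bilinear_on A' A' U = bilinear_on Dl Dl U"
  "bilinear_on Aop' Aop' U = bilinear_on Dl Dl U"
  by (intro ext; simp add: bilinear_on_def linear_on_hom_dual dual_space_hom_op)+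

lemma lin_sweedler_dual:
  assumes "is_vspace U" "bilinear_on Dl Dl U E" "linear_on X Dl g"
  shows "linear_on X U (\<lambda>x. sweedler A' (g x) E)"
    "linear_on X U (\<lambda>x. sweedler Aop' (g x) E)"
  using lin_sweedler_arg[OF vs_hom_dual comul_dual_linear, of U E X g]
    lin_sweedler_arg[OF vs_hom_dual comul_dual_op_linear, of U E X g] assms
  by (simp_all add: bilinear_on_dual linear_on_hom_dual dual_space_hom_op)

lemma lin_sweedler_dual_body:
  assumes "is_vspace U" "is_vspace X" "f \<in> vcar Dl"
    "\<And>x. x \<in> vcar X \<Longrightarrow> bilinear_on Dl Dl U (E x)"
    "\<And>v w. v \<in> vcar Dl \<Longrightarrow> w \<in> vcar Dl \<Longrightarrow> linear_on X U (\<lambda>x. E x v w)"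
  shows "linear_on X U (\<lambda>x. sweedler A' f (E x))"
    "linear_on X U (\<lambda>x. sweedler Aop' f (E x))"
  using lin_sweedler_body[OF vs_hom_dual comul_dual_linear, of U X f E]
    lin_sweedler_body[OF vs_hom_dual comul_dual_op_linear, of U X f E] assms
  by (simp_all add: bilinear_on_dual dual_space_hom_op)

lemma sweedler_dual_apply:
  assumes "is_vspace U" "bilinear_on Dl Dl U E" "linear_on U scalars G" "f \<in> vcar Dl"
  shows "G (sweedler A' f E) = hcomul A' f (\<lambda>x y. G (E x y))"
    "G (sweedler Aop' f E) = hcomul Aop' f (\<lambda>x y. G (E x y))"
  using sweedler_apply_raw[OF vs_hom_dual comul_dual_linear, of U E G f]
    sweedler_apply_raw[OF vs_hom_dual comul_dual_op_linear, of U E G f] assms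
  by (simp_all add: bilinear_on_dual dual_space_hom_op)

lemma sweedler_dual_scalar:
  assumes "f \<in> vcar Dl" "bilinear_on Dl Dl scalars E"
  shows "sweedler A' f E = hcomul A' f E"
    "sweedler Aop' f E = hcomul Aop' f E"
  using sweedler_dual_apply[OF vs_scalars assms(2) linear_on_id assms(1)] by simp_all

lemma bilinear_eval_mult:
  assumes "linear_on Dl scalars G"
  shows "bilinear_on Dl Dl scalars (\<lambda>f1 f2. f1 u * G f2)" "bilinear_on Dl Dl scalars (\<lambda>f1 f2. f2 u * G f1)"
  using assms by (auto intro!: bilinear_onI lin_mult_left lin_mult_right eval_dual_linear)

text \<open>The side on which u multiplies y distinguishes the dual of A from the dual of the
  opposite algebra. Of the two inverses of \<alpha> in the dual coproduct, one is absorbed by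
  \<star>.\<close>

lemma sweedler_dual_left:
  assumes "f \<in> vcar Dl" "linear_on Dl scalars G" "u \<in> vcar A"
  shows "sweedler A' f (\<lambda>f1 f2. f1 u * G f2) = G (form_on A (\<lambda>y. f (ai (u \<star> y))))"
    "sweedler Aop' f (\<lambda>f1 f2. f1 u * G f2) = G (form_on A (\<lambda>y. f (ai (y \<star> u))))"
  using hom_dual_comul_left[OF vsA frame_A alg.mul_bilinear hinv2_lin assms]
    hom_dual_comul_left[OF frame_op, of f G u] assms
  by (simp_all add: sweedler_dual_scalar[OF _ bilinear_eval_mult(1)] dual_space_hom_op hinv_hom_op
    form_on_hom_op hinv_simps um_def)

lemma sweedler_dual_op_right:
  assumes "f \<in> vcar Dl" "linear_on Dl scalars G" "u \<in> vcar A"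
  shows "sweedler Aop' f (\<lambda>f1 f2. f2 u * G f1) = G (form_on A (\<lambda>y. f (ai (u \<star> y))))"
  using hom_dual_comul_right[OF frame_op, of f G u] assms
  by (simp add: sweedler_dual_scalar[OF _ bilinear_eval_mult(2)] dual_space_hom_op hinv_hom_op
    form_on_hom_op hinv_simps um_def)

text \<open>In coordinates a Sweedler sum over A is a finite combination of forms, and a tensor acts
  linearly on bilinear forms.\<close>

lemma sw_vtensor_swap:
  assumes t: "t \<in> vcar (vtensor Dl Dl)"
    and E: "\<And>x y. x \<in> vcar A \<Longrightarrow> y \<in> vcar A \<Longrightarrow> bilinear_on Dl Dl scalars (\<lambda>f1 f2. E f1 f2 x y)"
  shows "t (\<lambda>f1 f2. H.sw c (E f1 f2)) = H.sw c (\<lambda>x y. t (\<lambda>f1 f2. E f1 f2 x y))"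
proof -
  have *: "bilinear_on Dl Dl scalars (\<lambda>f1 f2. k * E f1 f2 x y)" if "x \<in> B" "y \<in> B" for k x y
    using E[of x y] that by (intro bilinear_onI lin_mult_left) (auto simp: bilinear_on_def)
  have k: "t (\<lambda>f1 f2. k * E f1 f2 x y) = k * t (\<lambda>f1 f2. E f1 f2 x y)" if "x \<in> B" "y \<in> B" for k x y
    using that by (intro vtensor_apply_scale[OF vs_dual t] E) simp_all
  have "t (\<lambda>f1 f2. H.sw c (E f1 f2))
      = (\<Sum>x\<in>B. t (\<lambda>f1 f2. \<Sum>y\<in>B. ud c x y * E f1 f2 x y))"
    unfolding H.sw_def
    by (rule vtensor_apply_sum[OF vs_dual t])
       (intro bilinear_onI lin_sum; use * in \<open>auto simp: bilinear_on_def\<close>)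
  also have "\<dots> = (\<Sum>x\<in>B. \<Sum>y\<in>B. t (\<lambda>f1 f2. ud c x y * E f1 f2 x y))"
    by (intro sum.cong refl vtensor_apply_sum[OF vs_dual t] *)
  finally show ?thesis by (simp add: H.sw_def k)
qed

lemma sweedler_dual_swap:
  assumes f: "f \<in> vcar Dl"
    and E: "\<And>x y. x \<in> vcar A \<Longrightarrow> y \<in> vcar A \<Longrightarrow> bilinear_on Dl Dl scalars (\<lambda>f1 f2. E f1 f2 x y)"
  shows "sweedler A' f (\<lambda>f1 f2. H.sw c (E f1 f2)) =
      H.sw c (\<lambda>x y. sweedler A' f (\<lambda>f1 f2. E f1 f2 x y))" (is ?a)
    "sweedler Aop' f (\<lambda>f1 f2. H.sw c (E f1 f2)) =
      H.sw c (\<lambda>x y. sweedler Aop' f (\<lambda>f1 f2. E f1 f2 x y))" (is ?b)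
proof -
  have "bilinear_on Dl Dl scalars (\<lambda>f1 f2. H.sw c (E f1 f2))"
    using E by (intro bilinear_onI H.lin_sw_body) (auto dest: bilinear_onD)
  with E f show ?a ?b
    by (simp_all add: sweedler_dual_scalar sw_vtensor_swap[OF comul_dual_in(1)]
      sw_vtensor_swap[OF comul_dual_in(2)] cong: H.sw_cong)
qed

text \<open>The outer conversion gives one \<alpha> on the first leg; the legs of the second leg
  receive two, one from each level. In the product formulas of the doubles these meet the second and
  third inverse powers of \<alpha>.\<close>

lemma sweedler_twice_eval:
  assumes k: "k \<in> vcar A"
    and E: "\<And>b c. b \<in> vcar A \<Longrightarrow> c \<in> vcar A \<Longrightarrow> linear_on A (vtensor X Y) (\<lambda>a. E a b c)"
      "\<And>a c. a \<in> vcar A \<Longrightarrow> c \<in> vcar A \<Longrightarrow> linear_on A (vtensor X Y) (\<lambda>b. E a b c)"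
      "\<And>a b. a \<in> vcar A \<Longrightarrow> b \<in> vcar A \<Longrightarrow> linear_on A (vtensor X Y) (\<lambda>c. E a b c)"
  shows "sweedler A k (\<lambda>k1 k2. sweedler A k2 (E k1)) \<beta> =
    H.sw k (\<lambda>a w. H.sw w (\<lambda>b c. E (al a) (al (al b)) (al (al c)) \<beta>))"
proof -
  have e: "linear_on A scalars (\<lambda>a. E (g a) b c \<beta>)" "linear_on A scalars (\<lambda>a. E b (g a) c \<beta>)"
    "linear_on A scalars (\<lambda>a. E b c (g a) \<beta>)"
    if "b \<in> vcar A" "c \<in> vcar A" "linear_on A A g" for b c g
    using E that unfolding linear_on_def by (auto simp: vtensor_scale)
  have "sweedler A k (\<lambda>k1 k2. sweedler A k2 (E k1)) \<beta> = H.sw (al k) (\<lambda>a w. sweedler A w (E a) \<beta>)"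
    by (rule sweedler_eval) (auto intro!: bilinear_onI lin_sweedler_A vs_vtensor linear_on_id E k)
  also have "\<dots> = H.sw (al k) (\<lambda>a w. H.sw (al w) (\<lambda>b c. E a b c \<beta>))"
    by (intro H.sw_cong sweedler_eval) (auto intro!: bilinear_onI E)
  also have "\<dots> = H.sw k (\<lambda>a w. H.sw (al (al w)) (\<lambda>b c. E (al a) b c \<beta>))"
    by (rule sw_al) (auto intro!: k H.lin_intros lin_al e)
  also have "\<dots> = H.sw k (\<lambda>a w. H.sw (al w) (\<lambda>b c. E (al a) (al b) (al c) \<beta>))"
    by (intro H.sw_cong sw_al) (auto intro!: H.lin_intros e)
  also have "\<dots> = H.sw k (\<lambda>a w. H.sw w (\<lambda>b c. E (al a) (al (al b)) (al (al c)) \<beta>))"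
    by (intro H.sw_cong sw_al) (auto intro!: H.lin_intros lin_al e)
  finally show ?thesis .
qed

lemma S_ai: "a \<in> vcar A \<Longrightarrow> hantipode A (ai a) = ai (hantipode A a)"
  using S_al[of "ai a"] ai_al[of "hantipode A (ai a)"] by simp

lemma T_al: "a \<in> vcar A \<Longrightarrow> H.T (al a) = al (H.T a)"
  using H.T_S[of "al (H.T a)"] by (simp add: S_al)

lemma T_ai: "a \<in> vcar A \<Longrightarrow> H.T (ai a) = ai (H.T a)"
  using T_al[of "ai a"] ai_al[of "H.T (ai a)"] by simp

lemmas untwist = mul_um al_um ai_um S_al S_ai T_al T_ai

lemma antipode_inv: "antipode_inv A = H.T"
  by (simp add: antipode_inv_def H.T_def)

lemma dual_form: "lin A f \<Longrightarrow> form_on A f \<in> vcar Dl"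
  by (rule form_on_dual[OF vsA])

lemma tensor_dual_cong:
  assumes W: "vcar W = vcar Dl" "vscale W = vscale Dl"
    and V: "vcar V = vcar A" "vscale V = vscale A"
  shows "ptensor V W = pt" "vtensor V W = AD" "tensor_lift V W = tensor_lift A Dl"
    "ptensor W V = qt" "vtensor W V = DA" "tensor_lift W V = tensor_lift Dl A"
  by (intro ptensor_cong vtensor_cong tensor_lift_scheme_cong assms)+

lemma dual_tensor_simps:
  "ptensor A A' = pt" "vtensor A A' = AD"
  "tensor_lift A A' = tensor_lift A Dl"
  "ptensor (hom_op A) Aop' = pt"
  "vtensor (hom_op A) Aop' = AD"
  "tensor_lift (hom_op A) Aop' = tensor_lift A Dl"
  "ptensor A' A = qt" "vtensor A' A = DA"
  "tensor_lift A' A = tensor_lift Dl A"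
  "ptensor Aop' A = qt" "vtensor Aop' A = DA"
  "tensor_lift Aop' A = tensor_lift Dl A"
  by (simp_all add: dual_space_hom_op tensor_dual_cong[of "A'" A]
    tensor_dual_cong[of "Aop'" "hom_op A"]
    tensor_dual_cong[of "Aop'" A])

lemma lift2_dual:
  "lift2 A A' F = lift2 A Dl F" "lift2 Aop' A G = lift2 Dl A G"
  by (simp_all add: lift2_def[abs_def] dual_tensor_simps)

lemma quadrilinear_on_dual:
  "quadrilinear_on A A' U F = quadrilinear_on A Dl U F"
  "quadrilinear_on Aop' A U G = quadrilinear_on Dl A U G"
  by (simp_all add: quadrilinear_on_def bilinear_on_def linear_on_hom_dual dual_space_hom_op)

section \<open>The Drinfel'd double and its left twist\<close>

lemma reg_act_bilinear: "bilinear_on Dl A A (reg_act A)"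
  unfolding reg_act_def
  by (auto intro!: bilinear_onI lin_sweedler_A linear_on_scale_left linear_on_scale A_lins
    lin_dual_comp eval_dual_linear vs_dual)

lemma reg_act_closed [simp]: "f \<in> vcar Dl \<Longrightarrow> b \<in> vcar A \<Longrightarrow> reg_act A f b \<in> vcar A"
  using bilinear_onD(3)[OF reg_act_bilinear] .

lemma reg_act_apply:
  assumes f: "f \<in> vcar Dl" and b: "b \<in> vcar A" and \<phi> [simp]: "lin A \<phi>"
  shows "\<phi> (reg_act A f b) = H.sw (al b) (\<lambda>b1 b2. f b2 * \<phi> b1)"
proof -
  have "\<phi> (reg_act A f b) = H.sw (al b) (\<lambda>b1 b2. \<phi> (vscale A (f b2) b1))"
    unfolding reg_act_def using f b
    by (intro sweedler_apply[OF vsA _ \<phi>])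
       (auto intro!: bilinear_onI linear_on_scale_left linear_on_scale A_lins lin_dual_comp)
  also have "\<dots> = H.sw (al b) (\<lambda>b1 b2. f b2 * \<phi> b1)"
    by (intro H.sw_cong) (simp add: linear_onD(3)[OF \<phi>])
  finally show ?thesis .
qed

definition double_mul :: "'v \<Rightarrow> ('v \<Rightarrow> 'k) \<Rightarrow> 'v \<Rightarrow> ('v \<Rightarrow> 'k) \<Rightarrow> ('v, 'v \<Rightarrow> 'k, 'k) tensor" where
  "double_mul h f k g = sweedler A k (\<lambda>k1 k2. sweedler A k2 (\<lambda>k21 k22.
     pt (hinv A 2 k21 \<cdot> h)
       (hmul A' (dual_lact A (hinv A 3 k22)
         (dual_ract A (dual_pow A 2 f) (hantipode A (hinv A 3 k1)))) g)))"

definition heis_mul :: "'v \<Rightarrow> ('v \<Rightarrow> 'k) \<Rightarrow> 'v \<Rightarrow> ('v \<Rightarrow> 'k) \<Rightarrow> ('v, 'v \<Rightarrow> 'k, 'k) tensor" where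
  "heis_mul h f k g = sweedler Aop' f (\<lambda>f1 f2.
     pt (reg_act A (dual_pow A 2 f1) (hinv A 1 k) \<cdot> h)
       (hmul A' (dual_pow A 1 f2) g))"

definition coc :: "'v \<Rightarrow> ('v \<Rightarrow> 'k) \<Rightarrow> 'v \<Rightarrow> ('v \<Rightarrow> 'k) \<Rightarrow> 'k" where
  "coc h f k g = hcounit A h * g (hone A) * f (al k)"

lemma double_simps:
  "vcar DD = vcar AD"
  "vscale DD = vscale AD"
  "hmul DD = lift2 A Dl double_mul"
  "hcomul DD = tensor_lift A Dl (\<lambda>h f. sweedler A h (\<lambda>h1 h2.
     sweedler A' f (\<lambda>f1 f2.
       ptensor AD AD (pt h1 f1) (pt h2 f2))))"
  "hmap DD = tensor_lift A Dl (\<lambda>h f. pt (al h) (hmap A' f))"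
  by (simp_all add: drinfeld_double_def Let_def dual_tensor_simps fun_eq_iff lift2_def
    double_mul_def[abs_def])

lemma heis_simps:
  "vcar (heisenberg_double (hom_op A)) = vcar AD"
  "vscale (heisenberg_double (hom_op A)) = vscale AD"
  "hmul (heisenberg_double (hom_op A)) = lift2 A Dl heis_mul"
  by (simp_all add: heisenberg_double_def Let_def dual_tensor_simps fun_eq_iff lift2_def
    heis_mul_def[abs_def] reg_act_hom_op dual_pow_hom_op hinv_hom_op hom_dual_hom_op)

lemma double_cocycle_lift: "\<sigma> = lift2 A Dl coc"
  by (simp add: double_cocycle_def Let_def dual_tensor_simps fun_eq_iff lift2_def coc_def[abs_def])

lemmas tensor_lins = quadrilinear_onI bilinear_onI lin_sweedler_A ptensor_lin A_lins dual_lins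
  lin_bilinear_left[OF reg_act_bilinear] lin_bilinear_right[OF reg_act_bilinear]
  lin_sweedler_dual lin_sweedler_dual_body vs_vtensor vs_dual ptensor_in

lemma double_mul_quad: "quadrilinear_on A Dl AD double_mul"
  unfolding double_mul_def hinv_simps by (auto intro!: tensor_lins linear_onD[OF antipode_linear])

lemma heis_mul_quad: "quadrilinear_on A Dl AD heis_mul"
  unfolding heis_mul_def hinv_simps by (auto intro!: tensor_lins)

lemma coc_quad: "quadrilinear_on A Dl scalars coc"
  unfolding coc_def
  by (auto intro!: quadrilinear_onI lin_mult_left lin_mult_right eval_dual_linear lin_dual_comp A_lins)

text \<open>Elements of \<open>A \<otimes> A\<^sup>*\<close> are compared by pairing them with the forms
  \<open>p \<otimes> q \<mapsto> \<phi>(p) q(x)\<close>.\<close>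

definition test :: "('v \<Rightarrow> 'k) \<Rightarrow> 'v \<Rightarrow> 'v \<Rightarrow> ('v \<Rightarrow> 'k) \<Rightarrow> 'k" where
  "test \<phi> x = (\<lambda>p q. \<phi> p * q x)"

lemma test_bilinear: "lin A \<phi> \<Longrightarrow> bilinear_on A Dl scalars (test \<phi> x)"
  unfolding test_def by (intro bilinear_onI lin_mult_left lin_mult_right eval_dual_linear) simp_all

lemma ptensor_test [simp]: "lin A \<phi> \<Longrightarrow> pt p q (test \<phi> x) = \<phi> p * q x"
  using ptensor_apply[OF test_bilinear] by (simp add: test_def)

text \<open>With \<phi> a coordinate form and x a frame vector, the tests include all products of
  coordinate forms of A and of its dual.\<close>

lemma test_eqI:
  assumes t: "t \<in> vcar AD" and t': "t' \<in> vcar AD"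
    and eq: "\<And>\<phi> x. lin A \<phi> \<Longrightarrow> x \<in> vcar A \<Longrightarrow> t (test \<phi> x) = t' (test \<phi> x)"
  shows "t = t'"
proof (rule vtensor_eqI[OF vsA vs_dual frame_A coord_frame_dual[OF vsA frame_A] t t'])
  fix i j assume ij: "i \<in> B" "j \<in> B"
  have "bilinear_on A Dl scalars (\<lambda>v w. e i v * form_on Dl (\<lambda>f. f j) w)"
    using form_on_dual[OF vs_dual eval_dual_linear, of A j] coord_frameD(4)[OF frame_A ij(1)]
    by (intro bilinear_onI lin_mult_left lin_mult_right) (auto simp: dual_space_simps)
  then have *: "s (\<lambda>v w. e i v * form_on Dl (\<lambda>f. f j) w) = s (test (e i) j)"
    if "s \<in> vcar AD" for s
    by (rule vtensor_apply_cong[OF vsA that _ test_bilinear])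
       (simp_all add: test_def coord_frameD(4)[OF frame_A ij(1)])
  show "t (\<lambda>v w. e i v * form_on Dl (\<lambda>f. f j) w) = t' (\<lambda>v w. e i v * form_on Dl (\<lambda>f. f j) w)"
    using ij by (simp add: * t t' eq coord_frameD(4)[OF frame_A])
qed

lemmas eval_lins = lin_eval[OF lin_bilinear_left[OF hom_dual_mul_bilinear]]
  lin_eval[OF lin_bilinear_right[OF hom_dual_mul_bilinear]]
  lin_eval[OF linear_on_comp[OF dual_pow_linear]] eval_dual_linear

lemmas scalar_lins = H.hopf_lin_intros bilinear_onI trilinear_onI lin_mult_left lin_mult_right
  A_lins dual_lins eval_lins

text \<open>After the powers of \<alpha> from \<open>sweedler_twice_eval\<close>, the square of the
  dual map and the inverses in the product have been combined, the middle leg carries none inside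
  its product with h, and one \<alpha> stays on the antipode and on the last leg.\<close>

lemma double_mul_test:
  assumes [simp]: "h \<in> vcar A" "f \<in> vcar Dl" "k \<in> vcar A" "g \<in> vcar Dl" "x \<in> vcar A" and \<phi> [simp]: "lin A \<phi>"
  shows "double_mul h f k g (test \<phi> x) = H.sw k (\<lambda>a w. H.sw w (\<lambda>b c. \<phi> (al (b \<star> h)) *
    H.sw x (\<lambda>x1 x2. f (al (hantipode A a) \<star> (ai x1 \<star> al c)) * g (ai x2))))"
proof -
  have q: "hmul A' (dual_lact A (ai c)
      (dual_ract A (dual_pow A 2 f) (hantipode A (ai (ai a))))) g x = H.sw x (\<lambda>x1 x2. f (al (hantipode A a) \<star> (ai x1 \<star> al c)) * g (ai x2))"
    if [simp]: "a \<in> vcar A" "c \<in> vcar A" for a c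
    by (subst hom_dual_mul_apply) (simp_all add: numeral_2_eq_2 untwist cong: H.sw_cong)
  show ?thesis
    unfolding double_mul_def hinv_simps
    by (subst sweedler_twice_eval) (auto intro!: tensor_lins simp: q mul_um cong: H.sw_cong)
qed

text \<open>The action of f1 on k makes \<Delta>(k) available; contracting f1 with the second leg of
  k then removes the sum over f. The leg ends up on the right of x1 because the coproduct is that of
  the dual of the opposite algebra.\<close>

lemma heis_mul_test:
  assumes [simp]: "h \<in> vcar A" "f \<in> vcar Dl" "k \<in> vcar A" "g \<in> vcar Dl" "x \<in> vcar A" and \<phi> [simp]: "lin A \<phi>"
  shows "heis_mul h f k g (test \<phi> x) = H.sw k (\<lambda>k1 k2. \<phi> (al (k1 \<star> h)) *
    H.sw x (\<lambda>x1 x2. f (ai x1 \<star> al k2) * g (ai x2)))"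
proof -
  note li = scalar_lins lin_dual_comp[OF assms(2)] lin_dual_comp[OF assms(4)] linear_on_comp[OF \<phi>]
  let ?m = "\<lambda>q. hmul A' (dual_pow A 1 q) g x"
  have "heis_mul h f k g (test \<phi> x) = sweedler Aop' f (\<lambda>f1 f2.
     pt (reg_act A (dual_pow A 2 f1) (ai k) \<cdot> h)
       (hmul A' (dual_pow A 1 f2) g) (test \<phi> x))"
    unfolding heis_mul_def hinv_simps
    by (rule sweedler_commute[where f="\<lambda>t. t (test \<phi> x)", OF vs_hom_dual comul_dual_op_linear
          vs_vtensor vs_scalars _ lin_eval_vtensor])
       (auto intro!: tensor_lins simp: bilinear_on_dual dual_space_hom_op)
  also have "\<dots> = sweedler Aop' f (\<lambda>f1 f2.
      H.sw k (\<lambda>k1 k2. f1 (al (al k2)) * (\<phi> (k1 \<cdot> h) * ?m f2)))"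
  proof (rule sweedler_cong)
    fix f1 f2 assume "f1 \<in> vcar Aop'" "f2 \<in> vcar Aop'"
    then have [simp]: "f1 \<in> vcar Dl" "f2 \<in> vcar Dl" by (simp_all add: dual_space_hom_op)
    have "\<phi> (reg_act A (dual_pow A 2 f1) (ai k) \<cdot> h)
        = H.sw (al (ai k)) (\<lambda>k1 k2. dual_pow A 2 f1 k2 * \<phi> (k1 \<cdot> h))"
      by (rule reg_act_apply[where \<phi>="\<lambda>t. \<phi> (t \<cdot> h)"]) (auto intro!: li)
    also have "\<dots> = H.sw k (\<lambda>k1 k2. f1 (al (al k2)) * \<phi> (k1 \<cdot> h))"
      by (simp add: numeral_2_eq_2 cong: H.sw_cong_arg)
    finally show "pt (reg_act A (dual_pow A 2 f1) (ai k) \<cdot> h)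
       (hmul A' (dual_pow A 1 f2) g) (test \<phi> x) =
      H.sw k (\<lambda>k1 k2. f1 (al (al k2)) * (\<phi> (k1 \<cdot> h) * ?m f2))"
      by (simp add: \<phi> H.sw_mult_right[symmetric] mult.assoc)
  qed
  also have "\<dots> = H.sw k (\<lambda>k1 k2. sweedler Aop' f (\<lambda>f1 f2.
      f1 (al (al k2)) * (\<phi> (k1 \<cdot> h) * ?m f2)))"
    \<comment> \<open>The sum over \<Delta>(k) has to come outside, so that f1 is evaluated at a
      fixed vector when it is contracted.\<close>
    by (rule sweedler_dual_swap(2)) (auto intro!: li)
  also have "\<dots> = H.sw k (\<lambda>k1 k2. \<phi> (k1 \<cdot> h) * ?m (form_on A (\<lambda>y. f (ai (y \<star> al (al k2))))))"
    by (intro H.sw_cong sweedler_dual_left(2)) (auto intro!: li)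
  also have "\<dots> = H.sw k (\<lambda>k1 k2. \<phi> (al (k1 \<star> h)) *
    H.sw x (\<lambda>x1 x2. f (ai x1 \<star> al k2) * g (ai x2)))"
  proof (intro H.sw_cong)
    fix k1 k2 assume [simp]: "k1 \<in> vcar A" "k2 \<in> vcar A"
    have [simp]: "form_on A (\<lambda>y. f (ai (y \<star> al (al k2)))) \<in> vcar Dl"
      by (intro dual_form) (auto intro!: li)
    show "\<phi> (k1 \<cdot> h) * ?m (form_on A (\<lambda>y. f (ai (y \<star> al (al k2))))) = \<phi> (al (k1 \<star> h)) *
      H.sw x (\<lambda>x1 x2. f (ai x1 \<star> al k2) * g (ai x2))"
      by (subst hom_dual_mul_apply) (simp_all add: mul_um ai_um cong: H.sw_cong)
  qed
  finally show ?thesis .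
qed

lemma dual_pow_map [simp]:
  "f \<in> vcar Dl \<Longrightarrow> dual_pow A (Suc 0) (hmap A' f) = f"
  "f \<in> vcar Dl \<Longrightarrow> hmap A' (dual_pow A (Suc 0) f) = f"
  by (auto intro!: dual_eqI)

text \<open>The structure map of the dual is composition with the inverse of \<alpha>, hence its
  inverse is \<open>dual_pow A 1\<close>. Invariance of the cocycle holds because \<epsilon> and 1
  are fixed by \<alpha> and the inverse on f meets the \<alpha> on k.\<close>

lemma double_setup:
  "tensor_double A A' DD \<sigma> double_mul coc
    al (hmap A') ai (dual_pow A 1)"
  by unfold_locales
     (use coalg.counit_map alg.one_closed in \<open>simp_all add: vs_hom_dual
        comul_dual_linear[unfolded linear_on_hom_dual] lift2_dual quadrilinear_on_dual dual_tensor_simps linear_on_hom_dual double_mul_quad coc_quad alg.map_linear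
        ai_linear hom_dual_map_linear dual_pow_linear double_simps double_cocycle_lift coc_def\<close>)

text \<open>The factors \<epsilon>(h1) and g1(1) of the cocycle dispose of the sums over h and g by
  counit axioms. The factor f1(\<alpha>(k1)) multiplies the argument of f on the left, directly
  before the antipode in the product of the double, and \<open>H.S_right\<close> cancels the
  pair.\<close>

lemma double_twist_test:
  assumes [simp]: "h \<in> vcar A" "f \<in> vcar Dl" "k \<in> vcar A" "g \<in> vcar Dl" "x \<in> vcar A" and \<phi> [simp]: "lin A \<phi>"
  shows "twist_setup.ltw DD \<sigma>
      (tensor_double.J A A' ai (dual_pow A 1))
      (pt h f) (pt k g) (test \<phi> x) = heis_mul h f k g (test \<phi> x)"
proof -
  interpret P: tensor_double A "A'" "DD" "\<sigma>" double_mul coc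
    al "hmap A'" ai "dual_pow A 1"
    by (rule double_setup)
  note li = scalar_lins lin_dual_comp[OF assms(2)] lin_dual_comp[OF assms(4)] linear_on_comp[OF \<phi>]
  have \<phi>' [simp]: "lin A (\<lambda>p. \<phi> (ai p))" by (auto intro!: li)
  \<comment> \<open>\<open>P.J\<close> is the inverse of \<alpha> on A and composition with \<alpha>
    on the dual. Both are moved into the test, so pairing with \<open>P.J z\<close> is pairing z
    with another test.\<close>
  define R where "R h f k g = double_mul h f k g (test (\<lambda>p. \<phi> (ai p)) (al x))" for h f k g
  have R: "quadrilinear_on A Dl scalars R"
    unfolding R_def by (rule quadrilinear_on_eval[OF double_mul_quad])
  note li = li quadrilinear_onD(1-4)[OF R]
  have JR: "P.J (double_mul h f k g) (test \<phi> x) = R h f k g"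
    if "h \<in> vcar A" "f \<in> vcar Dl" "k \<in> vcar A" "g \<in> vcar Dl" for h f k g
  proof -
    have z: "double_mul h f k g \<in> vcar AD"
      using linear_onD(1)[OF quadrilinear_onD(1)[OF double_mul_quad]] that by simp
    have "(\<lambda>v w. pt (ai v) (dual_pow A 1 w) (test \<phi> x)) = test (\<lambda>p. \<phi> (ai p)) (al x)"
      by (simp add: test_def[of "\<lambda>p. \<phi> (ai p)"])
    then show ?thesis
      using P.J_apply[OF _ lin_eval_vtensor, of "double_mul h f k g" "test \<phi> x"] z
      by (simp only: dual_tensor_simps R_def)
  qed
  have "P.D.ltw (pt h f) (pt k g) (test \<phi> x) =
    sweedler A h (\<lambda>h1 h2. sweedler A' f (\<lambda>f1 f2.
     sweedler A k (\<lambda>k1 k2. sweedler A' g (\<lambda>g1 g2.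
       coc h1 f1 k1 g1 * P.J (double_mul h2 f2 k2 g2) (test \<phi> x)))))"
    using P.ltw_pt[where \<tau>="\<lambda>t. t (test \<phi> x)", OF lin_eval_vtensor, of h f k g]
    by (simp add: dual_tensor_simps)
  also have "\<dots> = sweedler A h (\<lambda>h1 h2. sweedler A' f (\<lambda>f1 f2.
     sweedler A k (\<lambda>k1 k2. sweedler A' g (\<lambda>g1 g2.
       g1 (hone A) * (f1 (al k1) * (hcounit A h1 * R h2 f2 k2 g2))))))"
    by (intro sweedler_cong) (simp add: JR coc_def del: One_nat_def)
  also have "\<dots> = sweedler A h (\<lambda>h1 h2. sweedler A' f (\<lambda>f1 f2. sweedler A k (\<lambda>k1 k2.
       f1 (al k1) * (hcounit A h1 * R h2 f2 k2 (form_on A (\<lambda>y. g (ai (hone A \<star> y))))))))"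
    by (intro sweedler_cong sweedler_dual_left(1)) (auto intro!: li)
  \<comment> \<open>The Hom version of the counit axiom on the dual: removing a leg by evaluation at
    1 leaves the structure map.\<close>
  also have "form_on A (\<lambda>y. g (ai (hone A \<star> y))) = hmap A' g"
    by (rule dual_eqI) (auto intro!: dual_form li)
  also have "sweedler A h (\<lambda>h1 h2. sweedler A' f (\<lambda>f1 f2. sweedler A k (\<lambda>k1 k2.
       f1 (al k1) * (hcounit A h1 * R h2 f2 k2 (hmap A' g)))))
    = sweedler A h (\<lambda>h1 h2. sweedler A' f (\<lambda>f1 f2. H.sw (al k) (\<lambda>k1 k2.
       f1 (al k1) * (hcounit A h1 * R h2 f2 k2 (hmap A' g)))))"
    by (intro sweedler_cong sweedler_sw) (auto intro!: li intro: lin_dual_comp[OF _ alg.map_linear])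
  also have "\<dots> = sweedler A h (\<lambda>h1 h2. H.sw (al k) (\<lambda>k1 k2. sweedler A' f (\<lambda>f1 f2.
       f1 (al k1) * (hcounit A h1 * R h2 f2 k2 (hmap A' g)))))"
    by (intro sweedler_cong sweedler_dual_swap(1)) (auto intro!: li)
  \<comment> \<open>Here the multiplication by \<alpha>(k1) on the left enters the argument of
    f.\<close>
  also have "\<dots> = sweedler A h (\<lambda>h1 h2. H.sw (al k) (\<lambda>k1 k2.
      hcounit A h1 * R h2 (form_on A (\<lambda>y. f (ai (al k1 \<star> y)))) k2 (hmap A' g)))"
    by (intro sweedler_cong H.sw_cong sweedler_dual_left(1)) (auto intro!: li)
  also have "\<dots> = H.sw (al h) (\<lambda>h1 h2. H.sw (al k) (\<lambda>k1 k2.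
      hcounit A h1 * R h2 (form_on A (\<lambda>y. f (ai (al k1 \<star> y)))) k2 (hmap A' g)))"
    by (rule sweedler_sw) (auto intro!: li dual_form)
  also have "\<dots> = H.sw (al k) (\<lambda>k1 k2. H.sw (al h) (\<lambda>h1 h2.
      hcounit A h1 * R h2 (form_on A (\<lambda>y. f (ai (al k1 \<star> y)))) k2 (hmap A' g)))"
    by (rule H.sw_swap)
  also have "\<dots> = H.sw (al k) (\<lambda>k1 k2. R (al h) (form_on A (\<lambda>y. f (ai (al k1 \<star> y)))) k2 (hmap A' g))"
    by (intro H.sw_cong H.counit_left) (auto intro!: li dual_form)
  also have "\<dots> = H.sw (al k) (\<lambda>k1 k2. H.sw k2 (\<lambda>a w. H.sw w (\<lambda>b c. \<phi> (b \<star> al h) *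
      H.sw x (\<lambda>x1 x2. f (k1 \<star> hantipode A a \<star> (ai x1 \<star> c)) * g (ai x2)))))"
  proof (rule H.sw_cong)
    fix k1 k2 assume [simp]: "k1 \<in> vcar A" "k2 \<in> vcar A"
    let ?F = "form_on A (\<lambda>y. f (ai (al k1 \<star> y)))"
    have [simp]: "?F \<in> vcar Dl" by (auto intro!: li dual_form)
    have "R (al h) ?F k2 (hmap A' g) = H.sw k2 (\<lambda>a w. H.sw w (\<lambda>b c. \<phi> (ai (al (b \<star> al h))) *
      H.sw (al x) (\<lambda>x1 x2. ?F (al (hantipode A a) \<star> (ai x1 \<star> al c)) * hmap A' g (ai x2))))"
      unfolding R_def by (rule double_mul_test) simp_all
    also have "\<dots> = H.sw k2 (\<lambda>a w. H.sw w (\<lambda>b c. \<phi> (ai (al (b \<star> al h))) *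
      H.sw x (\<lambda>x1 x2. ?F (al (hantipode A a) \<star> (ai (al x1) \<star> al c)) * hmap A' g (ai (al x2)))))"
      by (intro H.sw_cong arg_cong2[where f="(*)"] refl sw_al) (auto intro!: li lin_dual_comp)
    also have "\<dots> = H.sw k2 (\<lambda>a w. H.sw w (\<lambda>b c. \<phi> (b \<star> al h) *
      H.sw x (\<lambda>x1 x2. f (k1 \<star> hantipode A a \<star> (ai x1 \<star> c)) * g (ai x2))))"
      by (simp add: ai_um H.M_assoc cong: H.sw_cong)
    finally show "R (al h) ?F k2 (hmap A' g) = \<dots>" .
  qed
  \<comment> \<open>Regrouping makes \<open>k1\<close> and the argument \<open>a\<close> of the
    antipode the two legs of one element z.\<close>
  also have "\<dots> = H.sw (al k) (\<lambda>z w. H.sw z (\<lambda>k1 a. H.sw w (\<lambda>b c. \<phi> (b \<star> al h) *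
      H.sw x (\<lambda>x1 x2. f (k1 \<star> hantipode A a \<star> (ai x1 \<star> c)) * g (ai x2)))))"
    by (rule H.coassoc[symmetric]) (auto intro!: li)
  also have "\<dots> = H.sw (al k) (\<lambda>z w. hcounit A z * H.sw w (\<lambda>b c. \<phi> (b \<star> al h) *
      H.sw x (\<lambda>x1 x2. f (hone A \<star> (ai x1 \<star> c)) * g (ai x2))))"
    by (intro H.sw_cong H.S_right) (auto intro!: li)
  also have "\<dots> = H.sw (al k) (\<lambda>b c. \<phi> (b \<star> al h) *
      H.sw x (\<lambda>x1 x2. f (hone A \<star> (ai x1 \<star> c)) * g (ai x2)))"
    by (rule H.counit_left) (auto intro!: li)
  also have "\<dots> = H.sw k (\<lambda>b c. \<phi> (al b \<star> al h) *
      H.sw x (\<lambda>x1 x2. f (hone A \<star> (ai x1 \<star> al c)) * g (ai x2)))"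
    by (rule sw_al) (auto intro!: li)
  also have "\<dots> = heis_mul h f k g (test \<phi> x)"
    by (simp add: heis_mul_test al_um cong: H.sw_cong)
  finally show ?thesis .
qed

text \<open>Both sides equal \<epsilon>(h) g(1) times the sum of f(\<alpha>(k1) \<star> \<alpha>(l))
  p(\<alpha>(k2)). On the left the product is tested at x = 1, where \<Delta>(1) = 1 \<otimes> 1
  removes the inner sum; on the right it is tested with \<epsilon>, which removes the sum over
  l.\<close>

lemma double_cocycle_key:
  assumes [simp]: "h \<in> vcar A" "f \<in> vcar Dl" "l \<in> vcar A" "p \<in> vcar Dl" "k \<in> vcar A" "g \<in> vcar Dl"
  shows "\<sigma> (pt (al h) (hmap A' f)) (heis_mul l p k g) =
    \<sigma> (heis_mul h f l p) (pt (al k) (hmap A' g))"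
proof -
  interpret P: tensor_double A "A'" "DD" "\<sigma>" double_mul coc
    al "hmap A'" ai "dual_pow A 1"
    by (rule double_setup)
  \<comment> \<open>With one pure argument fixed the cocycle is a multiple of a \<open>test\<close>
    form, so \<open>heis_mul_test\<close> evaluates both sides.\<close>
  have coc_left: "coc h f = (\<lambda>k g. hcounit A h * test (\<lambda>k. f (al k)) (hone A) k g)" for h f
    by (simp add: coc_def fun_eq_iff test_def)
  have coc_right: "(\<lambda>h f. coc h f k g) = (\<lambda>h f. g (hone A) * test (hcounit A) (al k) h f)" for k g
    by (simp add: coc_def fun_eq_iff test_def)
  have double_cocycle_left: "\<sigma> (pt h f) z = hcounit A h * z (test (\<lambda>k. f (al k)) (hone A))"
    if "h \<in> vcar A" "f \<in> vcar Dl" "z \<in> vcar AD" for h f z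
    using that P.\<sigma>_left[of h f z] lin_dual_comp[OF _ alg.map_linear, of f]
    by (simp add: dual_tensor_simps coc_left vtensor_apply_scale[OF vsA] test_bilinear)
  have double_cocycle_right: "\<sigma> z (pt k g) = g (hone A) * z (test (hcounit A) (al k))"
    if "k \<in> vcar A" "g \<in> vcar Dl" "z \<in> vcar AD" for k g z
    using that P.\<sigma>_right[of k g z]
    by (simp add: dual_tensor_simps coc_right vtensor_apply_scale[OF vsA] test_bilinear coalg.counit_linear)
  note li = scalar_lins lin_dual_comp[OF assms(2)] lin_dual_comp[OF assms(4)] lin_dual_comp[OF assms(6)]
  have [simp]: "heis_mul h f k g \<in> vcar AD"
    if "h \<in> vcar A" "f \<in> vcar Dl" "k \<in> vcar A" "g \<in> vcar Dl" for h f k g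
    using linear_onD(1)[OF quadrilinear_onD(1)[OF heis_mul_quad]] that by simp
  let ?r = "H.sw k (\<lambda>k1 k2. f (al k1 \<star> al l) * p (al k2))"
  have l: "lin A (\<lambda>k. hmap A' f (al k))"
    by (auto intro!: lin_dual_comp A_lins)
  have "\<sigma> (pt (al h) (hmap A' f)) (heis_mul l p k g)
    = hcounit A h * H.sw k (\<lambda>k1 k2. hmap A' f (al (al (k1 \<star> l))) *
      H.sw (hone A) (\<lambda>x1 x2. p (ai x1 \<star> al k2) * g (ai x2)))"
    by (simp add: double_cocycle_left heis_mul_test l)
  also have "\<dots> = hcounit A h * H.sw k (\<lambda>k1 k2. hmap A' f (al (al (k1 \<star> l))) *
      (p (ai (hone A) \<star> al k2) * g (ai (hone A))))"
    by (intro arg_cong2[where f="(*)"] refl H.sw_cong H.comul_one) (auto intro!: li)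
  also have "\<dots> = hcounit A h * (?r * g (hone A))"
    by (simp add: H.sw_mult_right[symmetric] al_um ai_um mult.assoc cong: H.sw_cong)
  finally have 1: "\<sigma> (pt (al h) (hmap A' f)) (heis_mul l p k g)
    = hcounit A h * (?r * g (hone A))" .
  have "\<sigma> (heis_mul h f l p) (pt (al k) (hmap A' g))
    = g (hone A) * H.sw l (\<lambda>l1 l2. hcounit A (al (l1 \<star> h)) *
      H.sw (al (al k)) (\<lambda>x1 x2. f (ai x1 \<star> al l2) * p (ai x2)))"
    by (simp add: double_cocycle_right heis_mul_test coalg.counit_linear)
  also have "\<dots> = g (hone A) * H.sw l (\<lambda>l1 l2. hcounit A l1 * (hcounit A h *
      H.sw (al k) (\<lambda>x1 x2. f (ai (al x1) \<star> al l2) * p (ai (al x2)))))"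
  proof -
    have "H.sw (al (al k)) (\<lambda>x1 x2. f (ai x1 \<star> al l2) * p (ai x2)) =
        H.sw (al k) (\<lambda>x1 x2. f (ai (al x1) \<star> al l2) * p (ai (al x2)))" if "l2 \<in> vcar A" for l2
      using that by (intro sw_al) (auto intro!: li)
    then show ?thesis
      by (simp add: mult.assoc cong: H.sw_cong)
  qed
  also have "\<dots> = g (hone A) * (hcounit A h *
      H.sw (al k) (\<lambda>x1 x2. f (ai (al x1) \<star> al l) * p (ai (al x2))))"
    by (intro arg_cong2[where f="(*)"] refl H.counit_left) (auto intro!: li)
  also have "H.sw (al k) (\<lambda>x1 x2. f (ai (al x1) \<star> al l) * p (ai (al x2)))
      = H.sw k (\<lambda>x1 x2. f (ai (al (al x1)) \<star> al l) * p (ai (al (al x2))))"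
    by (rule sw_al) (auto intro!: li)
  also have "\<dots> = ?r"
    by (rule H.sw_cong) simp
  finally show ?thesis using 1 by simp
qed

lemma heisenberg_left_twist:
  "left_hom_cocycle DD \<sigma> \<and>
   same_alg (heisenberg_double (hom_op A)) (left_twist DD \<sigma>)"
proof -
  interpret P: tensor_double A "A'" "DD" "\<sigma>" double_mul coc
    al "hmap A'" ai "dual_pow A 1"
    by (rule double_setup)
  show ?thesis
  proof (rule P.left_twistI[where G=heis_mul, unfolded dual_tensor_simps quadrilinear_on_dual lift2_dual hom_dual_simps])
    fix h f k g assume *: "h \<in> vcar A" "f \<in> vcar Dl" "k \<in> vcar A" "g \<in> vcar Dl"
    have "P.D.ltw (pt h f) (pt k g) \<in> vcar AD"
      using * bilinear_onD(3)[OF P.D.ltw_bilinear, of "pt h f" "pt k g"]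
      by (simp add: double_simps ptensor_in)
    then show "P.D.ltw (pt h f) (pt k g) = heis_mul h f k g"
      using * linear_onD(1)[OF quadrilinear_onD(1)[OF heis_mul_quad]]
      by (intro test_eqI) (simp_all add: double_twist_test del: One_nat_def)
  qed (simp_all add: heis_mul_quad double_cocycle_key heis_simps)
qed

section \<open>The second double and its right twist\<close>

definition tilde_mul :: "('v \<Rightarrow> 'k) \<Rightarrow> 'v \<Rightarrow> ('v \<Rightarrow> 'k) \<Rightarrow> 'v \<Rightarrow> ('v \<Rightarrow> 'k, 'v, 'k) tensor" where
  "tilde_mul f a g b = sweedler A a (\<lambda>a1 a2. sweedler A a2 (\<lambda>a21 a22.
     qt
       (hmul A' f (dual_ract A (dual_lact A (hinv A 3 a1) (dual_pow A 2 g))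
         (H.T (hinv A 3 a22))))
       (hinv A 2 a21 \<cdot> b)))"

definition heis_dual_mul :: "('v \<Rightarrow> 'k) \<Rightarrow> 'v \<Rightarrow> ('v \<Rightarrow> 'k) \<Rightarrow> 'v \<Rightarrow> ('v \<Rightarrow> 'k, 'v, 'k) tensor" where
  "heis_dual_mul f a g b = sweedler A a (\<lambda>a1 a2.
     qt (hmul A' f (dual_lact A (hinv A 2 a1) (dual_pow A 1 g)))
       (hinv A 1 a2 \<cdot> b))"

definition tilde_coc :: "('v \<Rightarrow> 'k) \<Rightarrow> 'v \<Rightarrow> ('v \<Rightarrow> 'k) \<Rightarrow> 'v \<Rightarrow> 'k" where
  "tilde_coc f a g b = hcounit A b * f (hone A) * g (al a)"

lemma tilde_simps:
  "vcar DT = vcar DA"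
  "vscale DT = vscale DA"
  "hmul DT = lift2 Dl A tilde_mul"
  "hcomul DT = tensor_lift Dl A (\<lambda>f a. sweedler Aop' f (\<lambda>f1 f2.
     sweedler A a (\<lambda>a1 a2.
       ptensor DA DA (qt f1 a1) (qt f2 a2))))"
  "hmap DT = tensor_lift Dl A (\<lambda>f a. qt (hmap A' f) (al a))"
  by (simp_all add: drinfeld_double_tilde_def Let_def dual_tensor_simps fun_eq_iff lift2_def
    tilde_mul_def[abs_def] hom_dual_hom_op antipode_inv)

lemma heis_dual_simps:
  "vcar (heisenberg_double_dual A) = vcar DA"
  "vscale (heisenberg_double_dual A) = vscale DA"
  "hmul (heisenberg_double_dual A) = lift2 Dl A heis_dual_mul"
  by (simp_all add: heisenberg_double_dual_def Let_def dual_tensor_simps fun_eq_iff lift2_def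
    heis_dual_mul_def[abs_def])

lemma tilde_cocycle_lift: "\<eta> = lift2 Dl A tilde_coc"
  by (simp add: double_tilde_cocycle_def Let_def dual_tensor_simps fun_eq_iff lift2_def tilde_coc_def[abs_def])

lemma tilde_mul_quad: "quadrilinear_on Dl A DA tilde_mul"
  unfolding tilde_mul_def hinv_simps by (auto intro!: tensor_lins)

lemma heis_dual_mul_quad: "quadrilinear_on Dl A DA heis_dual_mul"
  unfolding heis_dual_mul_def hinv_simps by (auto intro!: tensor_lins)

lemma tilde_coc_quad: "quadrilinear_on Dl A scalars tilde_coc"
  unfolding tilde_coc_def
  by (auto intro!: quadrilinear_onI lin_mult_left lin_mult_right eval_dual_linear lin_dual_comp A_lins)

text \<open>Counterpart of \<open>test\<close> for the factors in the other order.\<close>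

definition dtest :: "'v \<Rightarrow> ('v \<Rightarrow> 'k) \<Rightarrow> ('v \<Rightarrow> 'k) \<Rightarrow> 'v \<Rightarrow> 'k" where
  "dtest x \<phi> = (\<lambda>p q. p x * \<phi> q)"

lemma dtest_bilinear: "lin A \<phi> \<Longrightarrow> bilinear_on Dl A scalars (dtest x \<phi>)"
  unfolding dtest_def by (intro bilinear_onI lin_mult_left lin_mult_right eval_dual_linear) simp_all

lemma ptensor_dtest [simp]: "lin A \<phi> \<Longrightarrow> qt p q (dtest x \<phi>) = p x * \<phi> q"
  using ptensor_apply[OF dtest_bilinear] by (simp add: dtest_def)

lemma dtest_eqI:
  assumes t: "t \<in> vcar DA" and t': "t' \<in> vcar DA"
    and eq: "\<And>\<phi> x. lin A \<phi> \<Longrightarrow> x \<in> vcar A \<Longrightarrow> t (dtest x \<phi>) = t' (dtest x \<phi>)"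
  shows "t = t'"
proof (rule vtensor_eqI[OF vs_dual vsA coord_frame_dual[OF vsA frame_A] frame_A t t'])
  fix j i assume ij: "j \<in> B" "i \<in> B"
  have "bilinear_on Dl A scalars (\<lambda>w v. form_on Dl (\<lambda>f. f j) w * e i v)"
    using form_on_dual[OF vs_dual eval_dual_linear, of A j] coord_frameD(4)[OF frame_A ij(2)]
    by (intro bilinear_onI lin_mult_left lin_mult_right) (auto simp: dual_space_simps)
  then have *: "s (\<lambda>w v. form_on Dl (\<lambda>f. f j) w * e i v) = s (dtest j (e i))"
    if "s \<in> vcar DA" for s
    by (rule vtensor_apply_cong[OF vs_dual that _ dtest_bilinear])
       (simp_all add: dtest_def coord_frameD(4)[OF frame_A ij(2)])
  show "t (\<lambda>w v. form_on Dl (\<lambda>f. f j) w * e i v) = t' (\<lambda>w v. form_on Dl (\<lambda>f. f j) w * e i v)"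
    using ij by (simp add: * t t' eq coord_frameD(4)[OF frame_A])
qed

text \<open>The two actions place the first leg of a on the right of x2 and the inverse antipode of
  the last leg on its left; the middle leg goes to the second tensor factor.\<close>

lemma tilde_mul_test:
  assumes [simp]: "f \<in> vcar Dl" "a \<in> vcar A" "g \<in> vcar Dl" "b \<in> vcar A" "x \<in> vcar A" and \<phi> [simp]: "lin A \<phi>"
  shows "tilde_mul f a g b (dtest x \<phi>) = H.sw a (\<lambda>a1 w. H.sw w (\<lambda>a2 a3.
    H.sw x (\<lambda>x1 x2. f (ai x1) * g (al (H.T a3) \<star> ai x2 \<star> al a1)) * \<phi> (al (a2 \<star> b))))"
proof -
  have q: "hmul A' f (dual_ract A (dual_lact A (ai (ai a1)) (dual_pow A 2 g))
      (H.T (ai a3))) x = H.sw x (\<lambda>x1 x2. f (ai x1) * g (al (H.T a3) \<star> ai x2 \<star> al a1))"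
    if [simp]: "a1 \<in> vcar A" "a3 \<in> vcar A" for a1 a3
    by (subst hom_dual_mul_apply) (simp_all add: numeral_2_eq_2 untwist cong: H.sw_cong)
  show ?thesis
    unfolding tilde_mul_def hinv_simps
    by (subst sweedler_twice_eval) (auto intro!: tensor_lins simp: q mul_um cong: H.sw_cong)
qed

lemma heis_dual_mul_test:
  assumes [simp]: "f \<in> vcar Dl" "a \<in> vcar A" "g \<in> vcar Dl" "b \<in> vcar A" "x \<in> vcar A" and \<phi> [simp]: "lin A \<phi>"
  shows "heis_dual_mul f a g b (dtest x \<phi>) = H.sw a (\<lambda>a1 a2.
    H.sw x (\<lambda>x1 x2. f (ai x1) * g (ai x2 \<star> al a1)) * \<phi> (al (a2 \<star> b)))"
proof -
  note li = scalar_lins lin_dual_comp[OF assms(1)] lin_dual_comp[OF assms(3)] linear_on_comp[OF \<phi>]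
  let ?q = "\<lambda>a1. hmul A' f (dual_lact A (ai (ai a1)) (dual_pow A 1 g))"
  have q: "hmul A' f (dual_lact A (ai a1) (dual_pow A (Suc 0) g)) x
      = H.sw x (\<lambda>x1 x2. f (ai x1) * g (ai x2 \<star> al a1))"
    if [simp]: "a1 \<in> vcar A" for a1
    by (subst hom_dual_mul_apply) (simp_all add: untwist cong: H.sw_cong)
  have "heis_dual_mul f a g b (dtest x \<phi>) = H.sw (al a) (\<lambda>a1 a2.
      qt (?q a1) (ai a2 \<cdot> b) (dtest x \<phi>))"
    unfolding heis_dual_mul_def hinv_simps
    by (rule sweedler_eval)
       (auto intro!: tensor_lins)
  also have "\<dots> = H.sw (al a) (\<lambda>a1 a2. ?q a1 x * \<phi> (ai a2 \<cdot> b))"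
    by simp
  also have "\<dots> = H.sw a (\<lambda>a1 a2. ?q (al a1) x * \<phi> (ai (al a2) \<cdot> b))"
    by (rule sw_al) (auto intro!: li)
  also have "\<dots> = H.sw a (\<lambda>a1 a2.
    H.sw x (\<lambda>x1 x2. f (ai x1) * g (ai x2 \<star> al a1)) * \<phi> (al (a2 \<star> b)))"
    by (intro H.sw_cong) (simp add: q mul_um)
  finally show ?thesis .
qed

lemma tilde_setup:
  "tensor_double Aop' A DT \<eta> tilde_mul tilde_coc
    (hmap A') al (dual_pow A 1) ai"
  by unfold_locales
     (use coalg.counit_map alg.one_closed in \<open>simp_all add: vs_hom_dual dual_space_hom_op
        comul_dual_op_linear[unfolded linear_on_hom_dual dual_space_hom_op] lift2_dual quadrilinear_on_dual
        dual_tensor_simps linear_on_hom_dual tilde_mul_quad tilde_coc_quad alg.map_linear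
        ai_linear hom_dual_map_linear dual_pow_linear tilde_simps tilde_cocycle_lift tilde_coc_def\<close>)

text \<open>The factors \<epsilon>(b2) and f2(1) are removed by counit axioms, while
  g2(\<alpha>(a2)) puts the last leg of a in front of the inverse antipode of the leg before it.
  This is the order in \<open>H.T_right\<close>.\<close>

lemma tilde_twist_test:
  assumes [simp]: "f \<in> vcar Dl" "a \<in> vcar A" "g \<in> vcar Dl" "b \<in> vcar A" "x \<in> vcar A" and \<phi> [simp]: "lin A \<phi>"
  shows "twist_setup.rtw DT \<eta>
      (tensor_double.J Aop' A (dual_pow A 1) ai)
      (qt f a) (qt g b) (dtest x \<phi>) = heis_dual_mul f a g b (dtest x \<phi>)"
proof -
  interpret P: tensor_double "Aop'" A "DT" "\<eta>"
    tilde_mul tilde_coc "hmap A'" al "dual_pow A 1" ai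
    by (rule tilde_setup)
  note li = scalar_lins lin_dual_comp[OF assms(1)] lin_dual_comp[OF assms(3)] linear_on_comp[OF \<phi>]
  have \<phi>' [simp]: "lin A (\<lambda>p. \<phi> (ai p))" by (auto intro!: li)
  define R where "R f a g b = tilde_mul f a g b (dtest (al x) (\<lambda>p. \<phi> (ai p)))" for f a g b
  have R: "quadrilinear_on Dl A scalars R"
    unfolding R_def by (rule quadrilinear_on_eval[OF tilde_mul_quad])
  note li = li quadrilinear_onD(1-4)[OF R] lin_into_dual[OF vsA] dual_form
  have JR: "P.J (tilde_mul f a g b) (dtest x \<phi>) = R f a g b"
    if "f \<in> vcar Dl" "a \<in> vcar A" "g \<in> vcar Dl" "b \<in> vcar A" for f a g b
  proof -
    have z: "tilde_mul f a g b \<in> vcar DA"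
      using linear_onD(1)[OF quadrilinear_onD(1)[OF tilde_mul_quad]] that by simp
    have "(\<lambda>w v. qt (dual_pow A 1 w) (ai v) (dtest x \<phi>)) = dtest (al x) (\<lambda>p. \<phi> (ai p))"
      by (simp add: dtest_def[of _ "\<lambda>p. \<phi> (ai p)"])
    then show ?thesis
      using P.J_apply[OF _ lin_eval_vtensor, of "tilde_mul f a g b" "dtest x \<phi>"] z
      by (simp only: dual_tensor_simps R_def)
  qed
  have "P.D.rtw (qt f a) (qt g b) (dtest x \<phi>) =
    sweedler Aop' f (\<lambda>f1 f2. sweedler A a (\<lambda>a1 a2.
     sweedler Aop' g (\<lambda>g1 g2. sweedler A b (\<lambda>b1 b2.
       tilde_coc f2 a2 g2 b2 * P.J (tilde_mul f1 a1 g1 b1) (dtest x \<phi>)))))"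
    using P.rtw_pt[where \<tau>="\<lambda>t. t (dtest x \<phi>)", OF lin_eval_vtensor, of f a g b]
    by (simp add: dual_tensor_simps dual_space_hom_op)
  also have "\<dots> = sweedler Aop' f (\<lambda>f1 f2. sweedler A a (\<lambda>a1 a2.
     sweedler Aop' g (\<lambda>g1 g2. g2 (al a2) * (f2 (hone A) * R f1 a1 g1 (al b)))))"
  proof (intro sweedler_cong)
    fix f1 f2 a1 a2 g1 g2
    assume "f1 \<in> vcar Aop'" "f2 \<in> vcar Aop'"
      "g1 \<in> vcar Aop'" "g2 \<in> vcar Aop'"
      and [simp]: "a1 \<in> vcar A" "a2 \<in> vcar A"
    then have [simp]: "f1 \<in> vcar Dl" "f2 \<in> vcar Dl" "g1 \<in> vcar Dl" "g2 \<in> vcar Dl"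
      by (simp_all add: dual_space_hom_op)
    have "sweedler A b (\<lambda>b1 b2. tilde_coc f2 a2 g2 b2 * P.J (tilde_mul f1 a1 g1 b1) (dtest x \<phi>)) =
      sweedler A b (\<lambda>b1 b2. hcounit A b2 * (g2 (al a2) * (f2 (hone A) * R f1 a1 g1 b1)))"
      by (intro sweedler_cong) (simp add: JR tilde_coc_def del: One_nat_def)
    also have "\<dots> = H.sw (al b) (\<lambda>b1 b2. hcounit A b2 * (g2 (al a2) * (f2 (hone A) * R f1 a1 g1 b1)))"
      by (rule sweedler_sw) (auto intro!: li)
    also have "\<dots> = g2 (al a2) * (f2 (hone A) * R f1 a1 g1 (al b))"
      by (rule H.counit_right) (auto intro!: li)
    finally show "sweedler A b (\<lambda>b1 b2. tilde_coc f2 a2 g2 b2 * P.J (tilde_mul f1 a1 g1 b1) (dtest x \<phi>)) =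
      g2 (al a2) * (f2 (hone A) * R f1 a1 g1 (al b))" .
  qed
  \<comment> \<open>The coproduct is that of the dual of the opposite algebra, so contracting the
    second leg of g multiplies its argument on the left, which is where the inverse antipode
    stands.\<close>
  also have "\<dots> = sweedler Aop' f (\<lambda>f1 f2. sweedler A a (\<lambda>a1 a2.
      f2 (hone A) * R f1 a1 (form_on A (\<lambda>y. g (ai (al a2 \<star> y)))) (al b)))"
    by (intro sweedler_cong sweedler_dual_op_right) (auto intro!: li simp: dual_space_hom_op)
  also have "\<dots> = sweedler Aop' f (\<lambda>f1 f2. H.sw (al a) (\<lambda>a1 a2.
      f2 (hone A) * R f1 a1 (form_on A (\<lambda>y. g (ai (al a2 \<star> y)))) (al b)))"
    by (intro sweedler_cong sweedler_sw)
      (auto intro!: li linear_on_comp[OF quadrilinear_onD(3)[OF R]] simp: dual_space_hom_op)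
  also have "\<dots> = H.sw (al a) (\<lambda>a1 a2. sweedler Aop' f (\<lambda>f1 f2.
      f2 (hone A) * R f1 a1 (form_on A (\<lambda>y. g (ai (al a2 \<star> y)))) (al b)))"
    by (intro sweedler_dual_swap(2)) (auto intro!: li)
  also have "\<dots> = H.sw (al a) (\<lambda>a1 a2. R (form_on A (\<lambda>y. f (ai (hone A \<star> y)))) a1
      (form_on A (\<lambda>y. g (ai (al a2 \<star> y)))) (al b))"
    by (intro H.sw_cong sweedler_dual_op_right) (auto intro!: li)
  also have "form_on A (\<lambda>y. f (ai (hone A \<star> y))) = hmap A' f"
    by (rule dual_eqI) (auto intro!: dual_form li)
  also have "H.sw (al a) (\<lambda>a1 a2. R (hmap A' f) a1 (form_on A (\<lambda>y. g (ai (al a2 \<star> y)))) (al b))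
    = H.sw (al a) (\<lambda>z a4. H.sw z (\<lambda>a1 w. H.sw w (\<lambda>a2 a3.
      H.sw x (\<lambda>x1 x2. f (ai x1) * g (a4 \<star> H.T a3 \<star> (ai x2 \<star> a1))) * \<phi> (a2 \<star> al b))))"
  proof (rule H.sw_cong)
    fix z a4 assume [simp]: "z \<in> vcar A" "a4 \<in> vcar A"
    let ?F = "form_on A (\<lambda>y. g (ai (al a4 \<star> y)))"
    have [simp]: "?F \<in> vcar Dl" by (auto intro!: li dual_form)
    have "R (hmap A' f) z ?F (al b) = H.sw z (\<lambda>a1 w. H.sw w (\<lambda>a2 a3.
      H.sw (al x) (\<lambda>x1 x2. hmap A' f (ai x1) * ?F (al (H.T a3) \<star> ai x2 \<star> al a1)) *
        \<phi> (ai (al (a2 \<star> al b)))))"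
      unfolding R_def by (rule tilde_mul_test) simp_all
    also have "\<dots> = H.sw z (\<lambda>a1 w. H.sw w (\<lambda>a2 a3.
      H.sw x (\<lambda>x1 x2. hmap A' f (ai (al x1)) * ?F (al (H.T a3) \<star> ai (al x2) \<star> al a1)) *
        \<phi> (ai (al (a2 \<star> al b)))))"
      by (intro H.sw_cong arg_cong2[where f="(*)"] refl sw_al) (auto intro!: li lin_dual_comp)
    also have "\<dots> = H.sw z (\<lambda>a1 w. H.sw w (\<lambda>a2 a3.
      H.sw x (\<lambda>x1 x2. f (ai x1) * g (a4 \<star> H.T a3 \<star> (ai x2 \<star> a1))) * \<phi> (a2 \<star> al b)))"
      by (simp add: ai_um H.M_assoc cong: H.sw_cong)
    finally show "R (hmap A' f) z ?F (al b) = \<dots>" .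
  qed
  \<comment> \<open>The leg \<open>a4\<close> was split off first, outside the triple a1, a2, a3.
    Two applications of coassociativity are needed to make it the neighbour of
    \<open>a3\<close>.\<close>
  also have "\<dots> = H.sw (al a) (\<lambda>a1 y. H.sw y (\<lambda>w a4. H.sw w (\<lambda>a2 a3.
      H.sw x (\<lambda>x1 x2. f (ai x1) * g (a4 \<star> H.T a3 \<star> (ai x2 \<star> a1))) * \<phi> (a2 \<star> al b))))"
    by (rule H.coassoc) (auto intro!: li)
  also have "\<dots> = H.sw (al a) (\<lambda>a1 y. H.sw y (\<lambda>a2 u. H.sw u (\<lambda>a3 a4.
      H.sw x (\<lambda>x1 x2. f (ai x1) * g (a4 \<star> H.T a3 \<star> (ai x2 \<star> a1))) * \<phi> (a2 \<star> al b))))"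
    by (intro H.sw_cong H.coassoc) (auto intro!: li)
  also have "\<dots> = H.sw (al a) (\<lambda>a1 y. H.sw y (\<lambda>a2 u. hcounit A u * (
      H.sw x (\<lambda>x1 x2. f (ai x1) * g (hone A \<star> (ai x2 \<star> a1))) * \<phi> (a2 \<star> al b))))"
    by (intro H.sw_cong H.T_right) (auto intro!: li)
  also have "\<dots> = H.sw (al a) (\<lambda>a1 a2.
      H.sw x (\<lambda>x1 x2. f (ai x1) * g (hone A \<star> (ai x2 \<star> a1))) * \<phi> (a2 \<star> al b))"
    by (intro H.sw_cong H.counit_right) (auto intro!: li)
  also have "\<dots> = H.sw a (\<lambda>a1 a2.
      H.sw x (\<lambda>x1 x2. f (ai x1) * g (hone A \<star> (ai x2 \<star> al a1))) * \<phi> (al a2 \<star> al b))"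
    by (rule sw_al) (auto intro!: li)
  also have "\<dots> = heis_dual_mul f a g b (dtest x \<phi>)"
    by (simp add: heis_dual_mul_test al_um cong: H.sw_cong)
  finally show ?thesis .
qed

text \<open>The mirror image of \<open>double_cocycle_key\<close>: both sides equal \<epsilon>(c)
  f(1) times the sum of g(\<alpha>(a1)) p(\<alpha>(a2) \<star> \<alpha>(b)). Now the right side is
  tested at 1 and the left side with \<epsilon>, which removes the sum over b.\<close>

lemma tilde_cocycle_key:
  assumes [simp]: "f \<in> vcar Dl" "a \<in> vcar A" "g \<in> vcar Dl" "b \<in> vcar A" "p \<in> vcar Dl" "c \<in> vcar A"
  shows "\<eta> (qt (hmap A' f) (al a)) (heis_dual_mul g b p c) =
    \<eta> (heis_dual_mul f a g b) (qt (hmap A' p) (al c))"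
proof -
  interpret P: tensor_double "Aop'" A "DT" "\<eta>"
    tilde_mul tilde_coc "hmap A'" al "dual_pow A 1" ai
    by (rule tilde_setup)
  have coc_left: "tilde_coc f a = (\<lambda>g b. f (hone A) * dtest (al a) (hcounit A) g b)" for f a
    by (simp add: tilde_coc_def fun_eq_iff dtest_def)
  have coc_right: "(\<lambda>f a. tilde_coc f a g b) = (\<lambda>f a. hcounit A b * dtest (hone A) (\<lambda>a. g (al a)) f a)" for g b
    by (simp add: tilde_coc_def fun_eq_iff dtest_def)
  have cocycle_left: "\<eta> (qt f a) z = f (hone A) * z (dtest (al a) (hcounit A))"
    if "f \<in> vcar Dl" "a \<in> vcar A" "z \<in> vcar DA" for f a z
    using that P.\<sigma>_left[of f a z]
    by (simp add: dual_tensor_simps dual_space_hom_op coc_left vtensor_apply_scale[OF vs_dual]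
      dtest_bilinear coalg.counit_linear)
  have cocycle_right: "\<eta> z (qt g b) = hcounit A b * z (dtest (hone A) (\<lambda>a. g (al a)))"
    if "g \<in> vcar Dl" "b \<in> vcar A" "z \<in> vcar DA" for g b z
    using that P.\<sigma>_right[of g b z] lin_dual_comp[OF _ alg.map_linear, of g]
    by (simp add: dual_tensor_simps dual_space_hom_op coc_right vtensor_apply_scale[OF vs_dual] dtest_bilinear)
  note li = scalar_lins lin_dual_comp[OF assms(1)] lin_dual_comp[OF assms(3)] lin_dual_comp[OF assms(5)]
  have [simp]: "heis_dual_mul f a g b \<in> vcar DA"
    if "f \<in> vcar Dl" "a \<in> vcar A" "g \<in> vcar Dl" "b \<in> vcar A" for f a g b
    using linear_onD(1)[OF quadrilinear_onD(1)[OF heis_dual_mul_quad]] that by simp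
  let ?r = "H.sw a (\<lambda>a1 a2. g (al a1) * p (al a2 \<star> al b))"
  have l: "lin A (\<lambda>k. hmap A' p (al k))"
    by (auto intro!: lin_dual_comp A_lins)
  have "\<eta> (heis_dual_mul f a g b) (qt (hmap A' p) (al c))
    = hcounit A c * H.sw a (\<lambda>a1 a2. H.sw (hone A) (\<lambda>x1 x2. f (ai x1) * g (ai x2 \<star> al a1)) *
      hmap A' p (al (al (a2 \<star> b))))"
    by (simp add: cocycle_right heis_dual_mul_test l)
  also have "\<dots> = hcounit A c * H.sw a (\<lambda>a1 a2. (f (ai (hone A)) * g (ai (hone A) \<star> al a1)) *
      hmap A' p (al (al (a2 \<star> b))))"
    by (intro arg_cong2[where f="(*)"] refl H.sw_cong H.comul_one) (auto intro!: li)
  also have "\<dots> = hcounit A c * (f (hone A) * ?r)"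
    by (simp add: H.sw_mult_left[symmetric] al_um ai_um mult.assoc cong: H.sw_cong)
  finally have 1: "\<eta> (heis_dual_mul f a g b) (qt (hmap A' p) (al c))
    = hcounit A c * (f (hone A) * ?r)" .
  have "\<eta> (qt (hmap A' f) (al a)) (heis_dual_mul g b p c)
    = f (hone A) * H.sw b (\<lambda>b1 b2. H.sw (al (al a)) (\<lambda>x1 x2. g (ai x1) * p (ai x2 \<star> al b1)) *
      hcounit A (al (b2 \<star> c)))"
    by (simp add: cocycle_left heis_dual_mul_test coalg.counit_linear)
  also have "\<dots> = f (hone A) * H.sw b (\<lambda>b1 b2. hcounit A b2 * (hcounit A c *
      H.sw (al a) (\<lambda>x1 x2. g (ai (al x1)) * p (ai (al x2) \<star> al b1))))"
  proof -
    have "H.sw (al (al a)) (\<lambda>x1 x2. g (ai x1) * p (ai x2 \<star> al b1)) =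
        H.sw (al a) (\<lambda>x1 x2. g (ai (al x1)) * p (ai (al x2) \<star> al b1))" if "b1 \<in> vcar A" for b1
      using that by (intro sw_al) (auto intro!: li)
    then show ?thesis
      by (simp add: mult_ac cong: H.sw_cong)
  qed
  also have "\<dots> = f (hone A) * (hcounit A c *
      H.sw (al a) (\<lambda>x1 x2. g (ai (al x1)) * p (ai (al x2) \<star> al b)))"
    by (intro arg_cong2[where f="(*)"] refl H.counit_right) (auto intro!: li)
  also have "H.sw (al a) (\<lambda>x1 x2. g (ai (al x1)) * p (ai (al x2) \<star> al b))
      = H.sw a (\<lambda>x1 x2. g (ai (al (al x1))) * p (ai (al (al x2)) \<star> al b))"
    by (rule sw_al) (auto intro!: li)
  also have "\<dots> = ?r"
    by (rule H.sw_cong) simp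
  finally show ?thesis using 1 by simp
qed

lemma heisenberg_right_twist:
  "right_hom_cocycle DT \<eta> \<and>
   same_alg (heisenberg_double_dual A) (right_twist DT \<eta>)"
proof -
  interpret P: tensor_double "Aop'" A "DT" "\<eta>"
    tilde_mul tilde_coc "hmap A'" al "dual_pow A 1" ai
    by (rule tilde_setup)
  show ?thesis
  proof (rule P.right_twistI[where G=heis_dual_mul, unfolded dual_tensor_simps quadrilinear_on_dual lift2_dual
        hom_dual_simps dual_space_hom_op])
    fix f a g b assume *: "f \<in> vcar Dl" "a \<in> vcar A" "g \<in> vcar Dl" "b \<in> vcar A"
    have "P.D.rtw (qt f a) (qt g b) \<in> vcar DA"
      using * bilinear_onD(3)[OF P.D.rtw_bilinear, of "qt f a" "qt g b"]
      by (simp add: tilde_simps ptensor_in)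
    then show "P.D.rtw (qt f a) (qt g b) = heis_dual_mul f a g b"
      using * linear_onD(1)[OF quadrilinear_onD(1)[OF heis_dual_mul_quad]]
      by (intro dtest_eqI) (simp_all add: tilde_twist_test del: One_nat_def)
  qed (simp_all add: heis_dual_mul_quad tilde_cocycle_key heis_dual_simps)
qed

end

theorem theorem4p5:
  fixes A :: "('k::field, 'a::ab_group_add) hom_hopf"
  assumes "hom_hopf_algebra A"
    and "fin_dim A"
    and "bij_betw (hmap A) (vcar A) (vcar A)"
  shows "(left_hom_cocycle (drinfeld_double A) (double_cocycle A) \<and>
          same_alg (heisenberg_double (hom_op A))
                   (left_twist (drinfeld_double A) (double_cocycle A))) \<and>
         (right_hom_cocycle (drinfeld_double_tilde A) (double_tilde_cocycle A) \<and>
          same_alg (heisenberg_double_dual A)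
                   (right_twist (drinfeld_double_tilde A) (double_tilde_cocycle A)))"
proof -
  interpret hom_hopf_algebra A by fact
  obtain B e where "coord_frame A B (\<lambda>i. i) e"
    using fin_dim_coord_frame[OF alg.vspace assms(2)] .
  then interpret fd_hom_hopf A B e
    using assms(3) by unfold_locales
  show ?thesis
    using heisenberg_left_twist heisenberg_right_twist by blast
qed

end
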